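(* Let $k$ be a field, let $(A,\mu_A,1_A)$ and $(C,\mu_C,1_C)$ be two associative unital $k$-algebras and let $V$ be a $k$-linear space equipped with a distinguished nonzero element $1_V\in V$. Assume that on $A\otimes V\otimes C$ we have an associative algebra structure (with multiplication denoted by $\cdot$) with unit $1_A\otimes 1_V\otimes 1_C$ such that the maps $$A\to A\otimes V\otimes C,\ a\mapsto a\otimes 1_V\otimes 1_C,\qquad C\to A\otimes V\otimes C,\ c\mapsto 1_A\otimes 1_V\otimes c$$ are algebra maps, and moreover, for all $a,a'\in A$, $v,v'\in V$, $c,c'\in C$, $$(1_A\otimes v\otimes 1_C)\cdot(a'\otimes 1_V\otimes 1_C)=\sum_i a_i\otimes v_i\otimes 1_C,$$ $$(1_A\otimes 1_V\otimes c)\cdot(1_A\otimes v'\otimes 1_C)=\sum_j 1_A\otimes v_j\otimes c_j,$$ $$(1_A\otimes 1_V\otimes c)\cdot(a'\otimes 1_V\otimes 1_C)=\sum_l a_l\otimes 1_V\otimes c_l,$$ $$a\otimes v\otimes c=(a\otimes 1_V\otimes 1_C)\cdot(1_A\otimes v\otimes 1_C)\cdot(1_A\otimes 1_V\otimes c),$$ where $a_i,a_l\in A$, $v_i,v_j\in V$, $c_j,c_l\in C$ are some elements (the sums being finite, and the elements depending on the factors on the left-hand side). Then there exist linear maps $R_1:V\otimes A\to A\otimes V$, $R_2:C\otimes V\to V\otimes C$, $R_3:C\otimes A\to A\otimes C$, $E:V\otimes V\to A\otimes V\otimes C$ satisfying the conditions (i)--(v) of two-sided crossed product data (listed in the context),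 and the given algebra structure on $A\otimes V\otimes C$ coincides with the two-sided crossed product afforded by the maps $R_1,R_2,R_3,E$.
   Context: All algebras and linear spaces are over a field $k$, $\otimes=\otimes_k$, and all algebras are associative and unital. Let $(A,\mu_A,1_A)$, $(C,\mu_C,1_C)$ be algebras and $V$ a linear space with a distinguished nonzero element $1_V$. For linear maps $R_1:V\otimes A\to A\otimes V$, $R_2:C\otimes V\to V\otimes C$, $R_3:C\otimes A\to A\otimes C$, $E:V\otimes V\to A\otimes V\otimes C$ use the Sweedler-type notation (summation understood) $R_1(v\otimes a)=a_{R_1}\otimes v_{R_1}$, $R_2(c\otimes v)=v_{R_2}\otimes c_{R_2}$, $R_3(c\otimes a)=a_{R_3}\otimes c_{R_3}=a_{r_3}\otimes c_{r_3}$, $E(v\otimes v')=E_A(v,v')\otimes E_V(v,v')\otimes E_C(v,v')$; different letters $R_3,r_3$ denote different copies of the same map. The conditions of two-sided crossed product data are: (i) $R_3$ is a twisting map between $A$ and $C$, that is, for all $a,a'\in A$, $c,c'\in C$: $R_3(c\otimes 1_A)=1_A\otimes c$, $R_3(1_C\otimes a)=a\otimes 1_C$, $(aa')_{R_3}\otimes c_{R_3}=a_{R_3}a'_{r_3}\otimes (c_{R_3})_{r_3}$, $a_{R_3}\otimes (cc')_{R_3}=(a_{R_3})_{r_3}\otimes c_{r_3}c'_{R_3}$; (ii) $R_1(1_V\otimes a)=a\otimes 1_V$, $R_1(v\otimes 1_A)=1_A\otimes v$ for all $a\in A$, $v\in V$; (iii) $R_2(c\otimes 1_V)=1_V\otimes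 c$, $R_2(1_C\otimes v)=v\otimes 1_C$ for all $v\in V$, $c\in C$; (iv) $E(1_V\otimes v)=E(v\otimes 1_V)=1_A\otimes v\otimes 1_C$ for all $v\in V$; (v) the following relations hold: $$R_1\circ(id_V\otimes\mu_A)=(\mu_A\otimes id_V)\circ(id_A\otimes R_1)\circ(R_1\otimes id_A),$$ $$R_2\circ(\mu_C\otimes id_V)=(id_V\otimes\mu_C)\circ(R_2\otimes id_C)\circ(id_C\otimes R_2),$$ $$(id_A\otimes R_2)\circ(R_3\otimes id_V)\circ(id_C\otimes R_1)=(R_1\otimes id_C)\circ(id_V\otimes R_3)\circ(R_2\otimes id_A),$$ $$(\mu_A\otimes id_V\otimes id_C)\circ(id_A\otimes E)\circ(R_1\otimes id_V)\circ(id_V\otimes R_1)=(\mu_A\otimes id_V\otimes id_C)\circ(id_A\otimes R_1\otimes id_C)\circ(id_A\otimes id_V\otimes R_3)\circ(E\otimes id_A),$$ $$(id_A\otimes id_V\otimes\mu_C)\circ(E\otimes id_C)\circ(id_V\otimes R_2)\circ(R_2\otimes id_V)=(id_A\otimes id_V\otimes\mu_C)\circ(id_A\otimes R_2\otimes id_C)\circ(R_3\otimes id_V\otimes id_C)\circ(id_C\otimes E),$$ $$(\mu_A\otimes id_V\otimes\mu_C)\circ(id_A\otimes E\otimes id_C)\circ(R_1\otimes id_V\otimes id_C)\circ(id_V\otimes E)=(\mu_A\otimes id_V\otimes\mu_C)\circ(id_A\otimes E\otimes id_C)\circ(id_A\otimes id_V\otimes R_2)\circ(E\otimes id_V).$$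 When (i)--(v) hold, the two-sided crossed product afforded by $R_1,R_2,R_3,E$ is the associative algebra structure on $A\otimes V\otimes C$ with unit $1_A\otimes 1_V\otimes 1_C$ and multiplication $$(a\otimes v\otimes c)(a'\otimes v'\otimes c')=a(a'_{R_3})_{R_1}E_A(v_{R_1},v'_{R_2})\otimes E_V(v_{R_1},v'_{R_2})\otimes E_C(v_{R_1},v'_{R_2})(c_{R_3})_{R_2}c'.$$ *)

theory Defs
  imports "HOL-Algebra.Module" "HOL-Algebra.AbelCoset"
begin

text \<open>
  Vector spaces over a field \<open>k\<close> are \<open>module k V\<close> with \<open>field k\<close>. The library locale
  \<open>algebra\<close> is restricted to commutative algebras, hence the following variant.
\<close>

locale unital_algebra = module k A + A?: ring A
  for k :: "('k, 'r) ring_scheme" (structure) and A :: "('k, 'a, 'm) module_scheme" (structure) +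
  assumes smult_mult_left:
      "\<lbrakk>r \<in> carrier k; x \<in> carrier A; y \<in> carrier A\<rbrakk> \<Longrightarrow>
        (r \<odot>\<^bsub>A\<^esub> x) \<otimes>\<^bsub>A\<^esub> y = r \<odot>\<^bsub>A\<^esub> (x \<otimes>\<^bsub>A\<^esub> y)"
    and smult_mult_right:
      "\<lbrakk>r \<in> carrier k; x \<in> carrier A; y \<in> carrier A\<rbrakk> \<Longrightarrow>
        x \<otimes>\<^bsub>A\<^esub> (r \<odot>\<^bsub>A\<^esub> y) = r \<odot>\<^bsub>A\<^esub> (x \<otimes>\<^bsub>A\<^esub> y)"

definition linear_maps ::
    "('k, 'r) ring_scheme \<Rightarrow> ('k, 'm, 'x) module_scheme \<Rightarrow> ('k, 'n, 'y) module_scheme \<Rightarrow> ('m \<Rightarrow> 'n) set"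
  where "linear_maps k M N =
    {f \<in> carrier M \<rightarrow> carrier N.
      (\<forall>x\<in>carrier M. \<forall>y\<in>carrier M. f (x \<oplus>\<^bsub>M\<^esub> y) = f x \<oplus>\<^bsub>N\<^esub> f y) \<and>
      (\<forall>r\<in>carrier k. \<forall>x\<in>carrier M. f (r \<odot>\<^bsub>M\<^esub> x) = r \<odot>\<^bsub>N\<^esub> f x)}"

definition algebra_maps ::
    "('k, 'r) ring_scheme \<Rightarrow> ('k, 'a, 'x) module_scheme \<Rightarrow> ('k, 'b, 'y) module_scheme \<Rightarrow> ('a \<Rightarrow> 'b) set"
  where "algebra_maps k A B = ring_hom A B \<inter> linear_maps k A B"


section \<open>Tensor products\<close>

text \<open>
  \<open>M \<otimes> N\<close> is the free module on \<open>carrier M \<times> carrier N\<close> modulo the submodule generated by the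
  bilinearity relations. The record type \<open>module\<close> extends \<open>ring\<close>, so a module record carries
  fields \<open>mult\<close> and \<open>one\<close> that the locale \<open>module\<close> never mentions; they are left unspecified.
\<close>

definition free_module :: "('k, 'r) ring_scheme \<Rightarrow> 's set \<Rightarrow> ('k, 's \<Rightarrow> 'k) module"
  where "free_module k S =
    \<lparr>carrier = {\<phi> \<in> S \<rightarrow> carrier k. (\<forall>s. s \<notin> S \<longrightarrow> \<phi> s = \<zero>\<^bsub>k\<^esub>) \<and> finite {s. \<phi> s \<noteq> \<zero>\<^bsub>k\<^esub>}},
     mult = undefined, one = undefined,
     zero = (\<lambda>s. \<zero>\<^bsub>k\<^esub>), add = (\<lambda>\<phi> \<psi> s. \<phi> s \<oplus>\<^bsub>k\<^esub> \<psi> s),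
     smult = (\<lambda>r \<phi> s. r \<otimes>\<^bsub>k\<^esub> \<phi> s)\<rparr>"

definition basis_vec :: "('k, 'r) ring_scheme \<Rightarrow> 's \<Rightarrow> 's \<Rightarrow> 'k"
  where "basis_vec k s = (\<lambda>t. if t = s then \<one>\<^bsub>k\<^esub> else \<zero>\<^bsub>k\<^esub>)"

definition submodule_generated ::
    "('k, 'r) ring_scheme \<Rightarrow> ('k, 'm, 'x) module_scheme \<Rightarrow> 'm set \<Rightarrow> 'm set"
  where "submodule_generated k M S = \<Inter>{H. submodule H k M \<and> S \<subseteq> H}"

definition quotient_module :: "('k, 'm, 'x) module_scheme \<Rightarrow> 'm set \<Rightarrow> ('k, 'm set) module"
  where "quotient_module M H =
    \<lparr>carrier = a_rcosets\<^bsub>M\<^esub> H, mult = undefined, one = undefined,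
     zero = H, add = set_add M, smult = (\<lambda>r X. \<Union>x\<in>X. H +>\<^bsub>M\<^esub> (r \<odot>\<^bsub>M\<^esub> x))\<rparr>"

definition tensor_relations ::
    "('k, 'r) ring_scheme \<Rightarrow> ('k, 'm, 'x) module_scheme \<Rightarrow> ('k, 'n, 'y) module_scheme \<Rightarrow>
      ('m \<times> 'n \<Rightarrow> 'k) set"
  where "tensor_relations k M N =
    (let F = free_module k (carrier M \<times> carrier N); e = basis_vec k in
      {e (x \<oplus>\<^bsub>M\<^esub> x', y) \<ominus>\<^bsub>F\<^esub> (e (x, y) \<oplus>\<^bsub>F\<^esub> e (x', y)) | x x' y.
        x \<in> carrier M \<and> x' \<in> carrier M \<and> y \<in> carrier N} \<union>
      {e (x, y \<oplus>\<^bsub>N\<^esub> y') \<ominus>\<^bsub>F\<^esub> (e (x, y) \<oplus>\<^bsub>F\<^esub> e (x, y')) | x y y'.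
        x \<in> carrier M \<and> y \<in> carrier N \<and> y' \<in> carrier N} \<union>
      {e (r \<odot>\<^bsub>M\<^esub> x, y) \<ominus>\<^bsub>F\<^esub> r \<odot>\<^bsub>F\<^esub> e (x, y) | r x y.
        r \<in> carrier k \<and> x \<in> carrier M \<and> y \<in> carrier N} \<union>
      {e (x, r \<odot>\<^bsub>N\<^esub> y) \<ominus>\<^bsub>F\<^esub> r \<odot>\<^bsub>F\<^esub> e (x, y) | r x y.
        r \<in> carrier k \<and> x \<in> carrier M \<and> y \<in> carrier N})"

definition tensor_kernel ::
    "('k, 'r) ring_scheme \<Rightarrow> ('k, 'm, 'x) module_scheme \<Rightarrow> ('k, 'n, 'y) module_scheme \<Rightarrow>
      ('m \<times> 'n \<Rightarrow> 'k) set"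
  where "tensor_kernel k M N =
    submodule_generated k (free_module k (carrier M \<times> carrier N)) (tensor_relations k M N)"

definition tensor_product ::
    "('k, 'r) ring_scheme \<Rightarrow> ('k, 'm, 'x) module_scheme \<Rightarrow> ('k, 'n, 'y) module_scheme \<Rightarrow>
      ('k, ('m \<times> 'n \<Rightarrow> 'k) set) module"
  where "tensor_product k M N =
    quotient_module (free_module k (carrier M \<times> carrier N)) (tensor_kernel k M N)"

definition pure_tensor ::
    "('k, 'r) ring_scheme \<Rightarrow> ('k, 'm, 'x) module_scheme \<Rightarrow> ('k, 'n, 'y) module_scheme \<Rightarrow>
      'm \<Rightarrow> 'n \<Rightarrow> ('m \<times> 'n \<Rightarrow> 'k) set"
  where "pure_tensor k M N x y =
    tensor_kernel k M N +>\<^bsub>free_module k (carrier M \<times> carrier N)\<^esub> basis_vec k (x, y)"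

text \<open>
  For bilinear \<open>b\<close>, the map \<open>tensor_lift k P b\<close> is the linear map \<open>M \<otimes> N \<rightarrow> P\<close> with
  \<open>x \<otimes> y \<mapsto> b x y\<close>; by bilinearity its value does not depend on the representative \<open>\<phi>\<close> of the
  coset. It also renders Sweedler notation: \<open>tensor_lift k P (\<lambda>x y. b x y) t\<close> is \<open>b(t\<^sub>1, t\<^sub>2)\<close>
  (summation understood) for \<open>t = t\<^sub>1 \<otimes> t\<^sub>2\<close>.
\<close>

definition tensor_lift ::
    "('k, 'r) ring_scheme \<Rightarrow> ('k, 'p, 'x) module_scheme \<Rightarrow> ('m \<Rightarrow> 'n \<Rightarrow> 'p) \<Rightarrow>
      ('m \<times> 'n \<Rightarrow> 'k) set \<Rightarrow> 'p"
  where "tensor_lift k P b t =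
    (let \<phi> = (SOME \<phi>. \<phi> \<in> t) in
      \<Oplus>\<^bsub>P\<^esub>s\<in>{s. \<phi> s \<noteq> \<zero>\<^bsub>k\<^esub>}. \<phi> s \<odot>\<^bsub>P\<^esub> b (fst s) (snd s))"

text \<open>In \<open>tensor_map k M N f g\<close> the modules \<open>M\<close> and \<open>N\<close> are the codomains of \<open>f\<close> and \<open>g\<close>.\<close>

definition tensor_map ::
    "('k, 'r) ring_scheme \<Rightarrow> ('k, 'm, 'x) module_scheme \<Rightarrow> ('k, 'n, 'y) module_scheme \<Rightarrow>
      ('p \<Rightarrow> 'm) \<Rightarrow> ('q \<Rightarrow> 'n) \<Rightarrow> ('p \<times> 'q \<Rightarrow> 'k) set \<Rightarrow> ('m \<times> 'n \<Rightarrow> 'k) set"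
  where "tensor_map k M N f g =
    tensor_lift k (tensor_product k M N) (\<lambda>x y. pure_tensor k M N (f x) (g y))"

definition associator ::
    "('k, 'r) ring_scheme \<Rightarrow> ('k, 'm, 'x) module_scheme \<Rightarrow> ('k, 'n, 'y) module_scheme \<Rightarrow>
      ('k, 'p, 'z) module_scheme \<Rightarrow>
      (('m \<times> 'n \<Rightarrow> 'k) set \<times> 'p \<Rightarrow> 'k) set \<Rightarrow> ('m \<times> ('n \<times> 'p \<Rightarrow> 'k) set \<Rightarrow> 'k) set"
  where "associator k M N P =
    (let T = tensor_product k M (tensor_product k N P) in
      tensor_lift k T (\<lambda>t z. tensor_lift k T
        (\<lambda>x y. pure_tensor k M (tensor_product k N P) x (pure_tensor k N P y z)) t))"

definition associator_inv ::
    "('k, 'r) ring_scheme \<Rightarrow> ('k, 'm, 'x) module_scheme \<Rightarrow> ('k, 'n, 'y) module_scheme \<Rightarrow>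
      ('k, 'p, 'z) module_scheme \<Rightarrow>
      ('m \<times> ('n \<times> 'p \<Rightarrow> 'k) set \<Rightarrow> 'k) set \<Rightarrow> (('m \<times> 'n \<Rightarrow> 'k) set \<times> 'p \<Rightarrow> 'k) set"
  where "associator_inv k M N P =
    (let T = tensor_product k (tensor_product k M N) P in
      tensor_lift k T (\<lambda>x t. tensor_lift k T
        (\<lambda>y z. pure_tensor k (tensor_product k M N) P (pure_tensor k M N x y) z) t))"


section \<open>Two-sided crossed products\<close>

definition twisting_map ::
    "('k, 'r) ring_scheme \<Rightarrow> ('k, 'a, 'x) module_scheme \<Rightarrow> ('k, 'c, 'y) module_scheme \<Rightarrow>
      (('c \<times> 'a \<Rightarrow> 'k) set \<Rightarrow> ('a \<times> 'c \<Rightarrow> 'k) set) \<Rightarrow> bool"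
  where "twisting_map k A C R \<longleftrightarrow>
    R \<in> linear_maps k (tensor_product k C A) (tensor_product k A C) \<and>
    (\<forall>c\<in>carrier C. R (pure_tensor k C A c \<one>\<^bsub>A\<^esub>) = pure_tensor k A C \<one>\<^bsub>A\<^esub> c) \<and>
    (\<forall>a\<in>carrier A. R (pure_tensor k C A \<one>\<^bsub>C\<^esub> a) = pure_tensor k A C a \<one>\<^bsub>C\<^esub>) \<and>
    (\<forall>a\<in>carrier A. \<forall>a'\<in>carrier A. \<forall>c\<in>carrier C.
      R (pure_tensor k C A c (a \<otimes>\<^bsub>A\<^esub> a')) =
        tensor_lift k (tensor_product k A C)
          (\<lambda>a\<^sub>R c\<^sub>R. tensor_lift k (tensor_product k A C)
            (\<lambda>a'\<^sub>r c\<^sub>R\<^sub>r. pure_tensor k A C (a\<^sub>R \<otimes>\<^bsub>A\<^esub> a'\<^sub>r) c\<^sub>R\<^sub>r)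
            (R (pure_tensor k C A c\<^sub>R a')))
          (R (pure_tensor k C A c a))) \<and>
    (\<forall>a\<in>carrier A. \<forall>c\<in>carrier C. \<forall>c'\<in>carrier C.
      R (pure_tensor k C A (c \<otimes>\<^bsub>C\<^esub> c') a) =
        tensor_lift k (tensor_product k A C)
          (\<lambda>a\<^sub>R c'\<^sub>R. tensor_lift k (tensor_product k A C)
            (\<lambda>a\<^sub>R\<^sub>r c\<^sub>r. pure_tensor k A C a\<^sub>R\<^sub>r (c\<^sub>r \<otimes>\<^bsub>C\<^esub> c'\<^sub>R))
            (R (pure_tensor k C A c a\<^sub>R)))
          (R (pure_tensor k C A c' a)))"

text \<open>
  Iterated tensor products are nested to the right, so \<open>A \<otimes> V \<otimes> C\<close> is \<open>A \<otimes> (V \<otimes> C)\<close>. The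
  identifications \<open>(X \<otimes> Y) \<otimes> Z \<cong> X \<otimes> (Y \<otimes> Z)\<close>, usually suppressed, are written out below as
  \<open>\<alpha>[X, Y, Z]\<close> (from left to right) and \<open>\<beta>[X, Y, Z]\<close> (from right to left).
  The subscripts in \<open>f \<star>[M, N] g\<close> are the codomains of \<open>f\<close> and \<open>g\<close>.
\<close>

locale two_sided_notation =
  fixes k :: "('k, 'r) ring_scheme"
begin

abbreviation tensor_abbrev (infixr "\<boxtimes>" 75)
  where "M \<boxtimes> N \<equiv> tensor_product k M N"

abbreviation pure_abbrev ("_ \<diamondop>[_, _] _" [76, 0, 0, 75] 75)
  where "x \<diamondop>[M, N] y \<equiv> pure_tensor k M N x y"

abbreviation map_abbrev ("_ \<star>[_, _] _" [76, 0, 0, 75] 75)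
  where "f \<star>[M, N] g \<equiv> tensor_map k M N f g"

abbreviation assoc_abbrev ("\<alpha>[_, _, _]")
  where "\<alpha>[M, N, P] \<equiv> associator k M N P"

abbreviation assoc_inv_abbrev ("\<beta>[_, _, _]")
  where "\<beta>[M, N, P] \<equiv> associator_inv k M N P"

abbreviation mult_abbrev ("\<mu>[_]")
  where "\<mu>[B] \<equiv> tensor_lift k B (mult B)"

end

locale two_sided_crossed_product_data = two_sided_notation k
  for k :: "('k, 'r) ring_scheme" +
  fixes A :: "('k, 'a, 'x) module_scheme" and V :: "('k, 'v, 'y) module_scheme"
    and v1 :: 'v and C :: "('k, 'c, 'z) module_scheme"
    and R1 :: "('v \<times> 'a \<Rightarrow> 'k) set \<Rightarrow> ('a \<times> 'v \<Rightarrow> 'k) set"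
    and R2 :: "('c \<times> 'v \<Rightarrow> 'k) set \<Rightarrow> ('v \<times> 'c \<Rightarrow> 'k) set"
    and R3 :: "('c \<times> 'a \<Rightarrow> 'k) set \<Rightarrow> ('a \<times> 'c \<Rightarrow> 'k) set"
    and E :: "('v \<times> 'v \<Rightarrow> 'k) set \<Rightarrow> ('a \<times> ('v \<times> 'c \<Rightarrow> 'k) set \<Rightarrow> 'k) set"
  assumes R1_linear: "R1 \<in> linear_maps k (V \<boxtimes> A) (A \<boxtimes> V)"
    and R2_linear: "R2 \<in> linear_maps k (C \<boxtimes> V) (V \<boxtimes> C)"
    and R3_linear: "R3 \<in> linear_maps k (C \<boxtimes> A) (A \<boxtimes> C)"
    and E_linear: "E \<in> linear_maps k (V \<boxtimes> V) (A \<boxtimes> V \<boxtimes> C)"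
    and R3_twisting: "twisting_map k A C R3"
    and R1_one_left: "\<And>a. a \<in> carrier A \<Longrightarrow> R1 (v1 \<diamondop>[V, A] a) = a \<diamondop>[A, V] v1"
    and R1_one_right: "\<And>v. v \<in> carrier V \<Longrightarrow> R1 (v \<diamondop>[V, A] \<one>\<^bsub>A\<^esub>) = \<one>\<^bsub>A\<^esub> \<diamondop>[A, V] v"
    and R2_one_right: "\<And>c. c \<in> carrier C \<Longrightarrow> R2 (c \<diamondop>[C, V] v1) = v1 \<diamondop>[V, C] c"
    and R2_one_left: "\<And>v. v \<in> carrier V \<Longrightarrow> R2 (\<one>\<^bsub>C\<^esub> \<diamondop>[C, V] v) = v \<diamondop>[V, C] \<one>\<^bsub>C\<^esub>"
    and E_one_left: "\<And>v. v \<in> carrier V \<Longrightarrow>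
      E (v1 \<diamondop>[V, V] v) = \<one>\<^bsub>A\<^esub> \<diamondop>[A, V \<boxtimes> C] (v \<diamondop>[V, C] \<one>\<^bsub>C\<^esub>)"
    and E_one_right: "\<And>v. v \<in> carrier V \<Longrightarrow>
      E (v \<diamondop>[V, V] v1) = \<one>\<^bsub>A\<^esub> \<diamondop>[A, V \<boxtimes> C] (v \<diamondop>[V, C] \<one>\<^bsub>C\<^esub>)"
    and R1_mult: "\<And>t. t \<in> carrier (V \<boxtimes> A \<boxtimes> A) \<Longrightarrow>
      (R1 \<circ> (id \<star>[V, A] \<mu>[A])) t =
      ((\<mu>[A] \<star>[A, V] id) \<circ> \<beta>[A, A, V] \<circ> (id \<star>[A, A \<boxtimes> V] R1) \<circ> \<alpha>[A, V, A]
        \<circ> (R1 \<star>[A \<boxtimes> V, A] id) \<circ> \<beta>[V, A, A]) t"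
    and R2_mult: "\<And>t. t \<in> carrier (C \<boxtimes> C \<boxtimes> V) \<Longrightarrow>
      (R2 \<circ> (\<mu>[C] \<star>[C, V] id) \<circ> \<beta>[C, C, V]) t =
      ((id \<star>[V, C] \<mu>[C]) \<circ> \<alpha>[V, C, C] \<circ> (R2 \<star>[V \<boxtimes> C, C] id) \<circ> \<beta>[C, V, C]
        \<circ> (id \<star>[C, V \<boxtimes> C] R2)) t"
    and R1_R2_R3: "\<And>t. t \<in> carrier (C \<boxtimes> V \<boxtimes> A) \<Longrightarrow>
      ((id \<star>[A, V \<boxtimes> C] R2) \<circ> \<alpha>[A, C, V] \<circ> (R3 \<star>[A \<boxtimes> C, V] id) \<circ> \<beta>[C, A, V]
        \<circ> (id \<star>[C, A \<boxtimes> V] R1)) t =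
      (\<alpha>[A, V, C] \<circ> (R1 \<star>[A \<boxtimes> V, C] id) \<circ> \<beta>[V, A, C] \<circ> (id \<star>[V, A \<boxtimes> C] R3)
        \<circ> \<alpha>[V, C, A] \<circ> (R2 \<star>[V \<boxtimes> C, A] id) \<circ> \<beta>[C, V, A]) t"
    and E_R1: "\<And>t. t \<in> carrier (V \<boxtimes> V \<boxtimes> A) \<Longrightarrow>
      ((\<mu>[A] \<star>[A, V \<boxtimes> C] id) \<circ> \<beta>[A, A, V \<boxtimes> C]
        \<circ> (id \<star>[A, A \<boxtimes> V \<boxtimes> C] E) \<circ> \<alpha>[A, V, V]
        \<circ> (R1 \<star>[A \<boxtimes> V, V] id) \<circ> \<beta>[V, A, V]
        \<circ> (id \<star>[V, A \<boxtimes> V] R1)) t =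
      ((\<mu>[A] \<star>[A, V \<boxtimes> C] id) \<circ> \<beta>[A, A, V \<boxtimes> C]
        \<circ> (id \<star>[A, A \<boxtimes> V \<boxtimes> C] (\<alpha>[A, V, C] \<circ> (R1 \<star>[A \<boxtimes> V, C] id) \<circ> \<beta>[V, A, C]))
        \<circ> (id \<star>[A, V \<boxtimes> A \<boxtimes> C] ((id \<star>[V, A \<boxtimes> C] R3) \<circ> \<alpha>[V, C, A]))
        \<circ> \<alpha>[A, V \<boxtimes> C, A] \<circ> (E \<star>[A \<boxtimes> V \<boxtimes> C, A] id) \<circ> \<beta>[V, V, A]) t"
    and E_R2: "\<And>t. t \<in> carrier (C \<boxtimes> V \<boxtimes> V) \<Longrightarrow>
      ((id \<star>[A, V \<boxtimes> C] ((id \<star>[V, C] \<mu>[C]) \<circ> \<alpha>[V, C, C]))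
        \<circ> \<alpha>[A, V \<boxtimes> C, C] \<circ> (E \<star>[A \<boxtimes> V \<boxtimes> C, C] id) \<circ> \<beta>[V, V, C]
        \<circ> (id \<star>[V, V \<boxtimes> C] R2) \<circ> \<alpha>[V, C, V]
        \<circ> (R2 \<star>[V \<boxtimes> C, V] id) \<circ> \<beta>[C, V, V]) t =
      ((id \<star>[A, V \<boxtimes> C] ((id \<star>[V, C] \<mu>[C]) \<circ> \<alpha>[V, C, C]))
        \<circ> (id \<star>[A, (V \<boxtimes> C) \<boxtimes> C] ((R2 \<star>[V \<boxtimes> C, C] id) \<circ> \<beta>[C, V, C]))
        \<circ> \<alpha>[A, C, V \<boxtimes> C] \<circ> (R3 \<star>[A \<boxtimes> C, V \<boxtimes> C] id) \<circ> \<beta>[C, A, V \<boxtimes> C]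
        \<circ> (id \<star>[C, A \<boxtimes> V \<boxtimes> C] E)) t"
    and E_E: "\<And>t. t \<in> carrier (V \<boxtimes> V \<boxtimes> V) \<Longrightarrow>
      ((\<mu>[A] \<star>[A, V \<boxtimes> C] (id \<star>[V, C] \<mu>[C])) \<circ> \<beta>[A, A, V \<boxtimes> C \<boxtimes> C]
        \<circ> (id \<star>[A, A \<boxtimes> V \<boxtimes> C \<boxtimes> C]
            ((id \<star>[A, V \<boxtimes> C \<boxtimes> C] \<alpha>[V, C, C]) \<circ> \<alpha>[A, V \<boxtimes> C, C]
              \<circ> (E \<star>[A \<boxtimes> V \<boxtimes> C, C] id) \<circ> \<beta>[V, V, C]))
        \<circ> \<alpha>[A, V, V \<boxtimes> C] \<circ> (R1 \<star>[A \<boxtimes> V, V \<boxtimes> C] id) \<circ> \<beta>[V, A, V \<boxtimes> C]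
        \<circ> (id \<star>[V, A \<boxtimes> V \<boxtimes> C] E)) t =
      ((\<mu>[A] \<star>[A, V \<boxtimes> C] (id \<star>[V, C] \<mu>[C])) \<circ> \<beta>[A, A, V \<boxtimes> C \<boxtimes> C]
        \<circ> (id \<star>[A, A \<boxtimes> V \<boxtimes> C \<boxtimes> C]
            ((id \<star>[A, V \<boxtimes> C \<boxtimes> C] \<alpha>[V, C, C]) \<circ> \<alpha>[A, V \<boxtimes> C, C]
              \<circ> (E \<star>[A \<boxtimes> V \<boxtimes> C, C] id) \<circ> \<beta>[V, V, C]))
        \<circ> (id \<star>[A, V \<boxtimes> V \<boxtimes> C] ((id \<star>[V, V \<boxtimes> C] R2) \<circ> \<alpha>[V, C, V]))
        \<circ> \<alpha>[A, V \<boxtimes> C, V] \<circ> (E \<star>[A \<boxtimes> V \<boxtimes> C, V] id) \<circ> \<beta>[V, V, V]) t"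

definition pure_tensor3 ::
    "('k, 'r) ring_scheme \<Rightarrow> ('k, 'a, 'x) module_scheme \<Rightarrow> ('k, 'v, 'y) module_scheme \<Rightarrow>
      ('k, 'c, 'z) module_scheme \<Rightarrow> 'a \<Rightarrow> 'v \<Rightarrow> 'c \<Rightarrow> ('a \<times> ('v \<times> 'c \<Rightarrow> 'k) set \<Rightarrow> 'k) set"
  where "pure_tensor3 k A V C a v c =
    pure_tensor k A (tensor_product k V C) a (pure_tensor k V C v c)"

definition tensor_lift3 ::
    "('k, 'r) ring_scheme \<Rightarrow> ('k, 'p, 'x) module_scheme \<Rightarrow> ('a \<Rightarrow> 'v \<Rightarrow> 'c \<Rightarrow> 'p) \<Rightarrow>
      ('a \<times> ('v \<times> 'c \<Rightarrow> 'k) set \<Rightarrow> 'k) set \<Rightarrow> 'p"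
  where "tensor_lift3 k P b = tensor_lift k P (\<lambda>a. tensor_lift k P (b a))"

text \<open>
  The multiplication is the bilinear extension of
  \<open>(a \<otimes> v \<otimes> c)(a' \<otimes> v' \<otimes> c') =
    a (a'\<^sub>R\<^sub>3)\<^sub>R\<^sub>1 E\<^sub>A(v\<^sub>R\<^sub>1, v'\<^sub>R\<^sub>2) \<otimes> E\<^sub>V(v\<^sub>R\<^sub>1, v'\<^sub>R\<^sub>2) \<otimes> E\<^sub>C(v\<^sub>R\<^sub>1, v'\<^sub>R\<^sub>2) (c\<^sub>R\<^sub>3)\<^sub>R\<^sub>2 c'\<close>,
  with \<open>p \<otimes> q\<close>, \<open>p' \<otimes> w\<close>, \<open>w' \<otimes> q'\<close> and \<open>e \<otimes> u \<otimes> d\<close> below standing for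
  \<open>R\<^sub>3(c \<otimes> a')\<close>, \<open>R\<^sub>1(v \<otimes> p)\<close>, \<open>R\<^sub>2(q \<otimes> v')\<close> and \<open>E(w \<otimes> w')\<close>.
\<close>

definition two_sided_crossed_product ::
    "('k, 'r) ring_scheme \<Rightarrow> ('k, 'a, 'x) module_scheme \<Rightarrow> ('k, 'v, 'y) module_scheme \<Rightarrow> 'v \<Rightarrow>
      ('k, 'c, 'z) module_scheme \<Rightarrow>
      (('v \<times> 'a \<Rightarrow> 'k) set \<Rightarrow> ('a \<times> 'v \<Rightarrow> 'k) set) \<Rightarrow>
      (('c \<times> 'v \<Rightarrow> 'k) set \<Rightarrow> ('v \<times> 'c \<Rightarrow> 'k) set) \<Rightarrow>
      (('c \<times> 'a \<Rightarrow> 'k) set \<Rightarrow> ('a \<times> 'c \<Rightarrow> 'k) set) \<Rightarrow>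
      (('v \<times> 'v \<Rightarrow> 'k) set \<Rightarrow> ('a \<times> ('v \<times> 'c \<Rightarrow> 'k) set \<Rightarrow> 'k) set) \<Rightarrow>
      ('k, ('a \<times> ('v \<times> 'c \<Rightarrow> 'k) set \<Rightarrow> 'k) set) module"
  where "two_sided_crossed_product k A V v1 C R1 R2 R3 E =
    (let T = tensor_product k A (tensor_product k V C) in
     T\<lparr>one := pure_tensor3 k A V C \<one>\<^bsub>A\<^esub> v1 \<one>\<^bsub>C\<^esub>,
       mult := (\<lambda>s t.
         tensor_lift3 k T (\<lambda>a v c.
         tensor_lift3 k T (\<lambda>a' v' c'.
         tensor_lift k T (\<lambda>p q.
         tensor_lift k T (\<lambda>p' w.
         tensor_lift k T (\<lambda>w' q'.
         tensor_lift3 k T (\<lambda>e u d.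
           pure_tensor3 k A V C (a \<otimes>\<^bsub>A\<^esub> p' \<otimes>\<^bsub>A\<^esub> e) u (d \<otimes>\<^bsub>C\<^esub> q' \<otimes>\<^bsub>C\<^esub> c'))
         (E (pure_tensor k V V w w')))
         (R2 (pure_tensor k C V q v')))
         (R1 (pure_tensor k V A v p)))
         (R3 (pure_tensor k C A c a')))
         t) s)\<rparr>)"

end

theory Submission
  imports Defs
begin

text \<open>
  Denote by \<open>f \<ast> g\<close> the map \<open>x \<otimes> y \<mapsto> f(x) g(y)\<close> for linear maps \<open>f\<close> and \<open>g\<close> into the given algebra
  \<open>W\<close> on \<open>A \<otimes> V \<otimes> C\<close>, and by \<open>inA\<close>, \<open>inV\<close>, \<open>inC\<close> the embeddings of the three factors. The
  hypothesis on \<open>a \<otimes> v \<otimes> c\<close> says that \<open>inA \<ast> inV \<ast> inC\<close> is the identity. The other three say that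
  the products \<open>v a\<close>, \<open>c v\<close> and \<open>c a\<close> can be rewritten in the order \<open>A\<close>, \<open>V\<close>, \<open>C\<close> without the
  missing factor. The maps of the crossed product perform this rewriting:
  \<open>(inA \<ast> inV) \<circ> R\<^sub>1 = inV \<ast> inA\<close>, \<open>(inV \<ast> inC) \<circ> R\<^sub>2 = inC \<ast> inV\<close>,
  \<open>(inA \<ast> inC) \<circ> R\<^sub>3 = inC \<ast> inA\<close>, and \<open>E = inV \<ast> inV\<close>.

  Each relation between these maps becomes trivial after composition with \<open>inA \<ast> inV \<ast> inC\<close> or its
  analogue for two factors: the displayed equations, multiplicativity of \<open>inA\<close> and \<open>inC\<close>, and
  associativity of \<open>W\<close> turn both sides into the same multiplication map, for instance
  \<open>inV \<ast> inV \<ast> inA\<close>. The predicate \<open>factors\<close> and its rules make this computation mechanical. The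
  multiplication formula is the same rewriting applied to \<open>a v c a' v' c'\<close>; this is
  \<open>crossed_product_mult\<close>.

  It remains to see that the maps to \<open>W\<close> are injective. For \<open>inA \<ast> inV \<ast> inC\<close> this is clear.
  The maps \<open>inA \<ast> inV\<close>, \<open>inV \<ast> inC\<close> and \<open>inA \<ast> inC\<close> insert \<open>1\<^sub>C\<close>, \<open>1\<^sub>A\<close> and \<open>v1\<close>, and a linear
  functional with value one at the inserted vector gives a linear left inverse, which at the same
  time constructs \<open>R\<^sub>1\<close>, \<open>R\<^sub>2\<close> and \<open>R\<^sub>3\<close>. Such functionals exist by Zorn's lemma if the vector is
  nonzero. The only exception is a zero algebra \<open>A\<close> or \<open>C\<close>. Then \<open>W = 0\<close>, all
  relations in \<open>A \<otimes> V \<otimes> C\<close> hold for this reason, and where a left inverse is missing the flip of the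
  tensor factors satisfies the relations that remain.

  The proof rests on the universal property of the tensor product, which is derived from its
  construction as a quotient of a free module: \<open>tensor_lift_linear\<close> and \<open>tensor_lift_pure\<close> for the
  existence, and \<open>tensor_lift_eqI\<close> for the uniqueness of the induced maps.
\<close>

section \<open>Linear maps\<close>

lemma linear_mapsI:
  assumes "\<And>x. x \<in> carrier M \<Longrightarrow> f x \<in> carrier N"
    and "\<And>x y. x \<in> carrier M \<Longrightarrow> y \<in> carrier M \<Longrightarrow> f (x \<oplus>\<^bsub>M\<^esub> y) = f x \<oplus>\<^bsub>N\<^esub> f y"
    and "\<And>r x. r \<in> carrier k \<Longrightarrow> x \<in> carrier M \<Longrightarrow> f (r \<odot>\<^bsub>M\<^esub> x) = r \<odot>\<^bsub>N\<^esub> f x"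
  shows "f \<in> linear_maps k M N"
  using assms by (auto simp: linear_maps_def)

lemma linear_mapsD:
  assumes "f \<in> linear_maps k M N"
  shows "\<And>x. x \<in> carrier M \<Longrightarrow> f x \<in> carrier N"
    and "\<And>x y. x \<in> carrier M \<Longrightarrow> y \<in> carrier M \<Longrightarrow> f (x \<oplus>\<^bsub>M\<^esub> y) = f x \<oplus>\<^bsub>N\<^esub> f y"
    and "\<And>r x. r \<in> carrier k \<Longrightarrow> x \<in> carrier M \<Longrightarrow> f (r \<odot>\<^bsub>M\<^esub> x) = r \<odot>\<^bsub>N\<^esub> f x"
  using assms by (auto simp: linear_maps_def)

lemma linear_maps_comp:
  assumes "g \<in> linear_maps k N P" "f \<in> linear_maps k M N"
  shows "(g \<circ> f) \<in> linear_maps k M P"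
  using assms by (auto simp: linear_maps_def Pi_iff)

lemma linear_maps_id: "id \<in> linear_maps k M M"
  by (auto simp: linear_maps_def)

lemma linear_maps_zero:
  assumes "module k M" "module k N" "f \<in> linear_maps k M N"
  shows "f \<zero>\<^bsub>M\<^esub> = \<zero>\<^bsub>N\<^esub>"
proof -
  interpret M: module k M by fact
  interpret N: module k N by fact
  have "f (\<zero>\<^bsub>k\<^esub> \<odot>\<^bsub>M\<^esub> \<zero>\<^bsub>M\<^esub>) = \<zero>\<^bsub>k\<^esub> \<odot>\<^bsub>N\<^esub> f \<zero>\<^bsub>M\<^esub>"
    using linear_mapsD(3)[OF assms(3)] by blast
  then show ?thesis
    using linear_mapsD(1)[OF assms(3)] by simp
qed

lemma linear_maps_uminus:
  assumes "module k M" "module k N" "f \<in> linear_maps k M N" "x \<in> carrier M"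
  shows "f (\<ominus>\<^bsub>M\<^esub> x) = \<ominus>\<^bsub>N\<^esub> f x"
proof -
  interpret M: module k M by fact
  interpret N: module k N by fact
  show ?thesis
    using M.smult_l_minus[of "\<one>\<^bsub>k\<^esub>" x] N.smult_l_minus[of "\<one>\<^bsub>k\<^esub>" "f x"] assms(4)
      linear_mapsD(1,3)[OF assms(3)]
    by (metis M.R.add.inv_closed M.R.one_closed M.smult_one N.smult_one)
qed

lemma linear_maps_finsum:
  assumes "module k M" "module k N" "f \<in> linear_maps k M N" "g \<in> I \<rightarrow> carrier M"
  shows "f (\<Oplus>\<^bsub>M\<^esub>i\<in>I. g i) = (\<Oplus>\<^bsub>N\<^esub>i\<in>I. f (g i))"
proof -
  interpret M: module k M by fact
  interpret N: module k N by fact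
  have zero: "f \<zero>\<^bsub>M\<^esub> = \<zero>\<^bsub>N\<^esub>"
    using linear_maps_zero assms by blast
  show ?thesis
  proof (cases "finite I")
    case True
    then show ?thesis
      using assms(4)
    proof (induction I)
      case empty
      then show ?case by (simp add: zero)
    next
      case (insert i I)
      have "(\<lambda>i. f (g i)) \<in> I \<rightarrow> carrier N" "f (g i) \<in> carrier N"
        using insert.prems linear_mapsD(1)[OF assms(3)] by auto
      moreover have "g \<in> I \<rightarrow> carrier M" "g i \<in> carrier M"
        using insert.prems by auto
      ultimately show ?case
        using insert linear_mapsD(2)[OF assms(3)] by simp
    qed
  next
    case False
    then show ?thesis
      by (simp add: zero M.finsum_infinite N.finsum_infinite)
  qed
qed

lemma linear_kernel_submodule:
  assumes "module k M" "module k N" "f \<in> linear_maps k M N"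
  shows "submodule {x \<in> carrier M. f x = \<zero>\<^bsub>N\<^esub>} k M"
proof -
  interpret M: module k M by fact
  interpret N: module k N by fact
  show ?thesis
    by (rule M.submoduleI)
      (auto simp: linear_mapsD[OF assms(3)] linear_maps_zero[OF assms] linear_maps_uminus[OF assms])
qed

lemma linear_maps_minus:
  assumes "module k M" "module k N" "f \<in> linear_maps k M N" "x \<in> carrier M" "y \<in> carrier M"
  shows "f (x \<ominus>\<^bsub>M\<^esub> y) = f x \<ominus>\<^bsub>N\<^esub> f y"
proof -
  interpret M: module k M by fact
  interpret N: module k N by fact
  show ?thesis
    using assms(4,5) linear_mapsD(2)[OF assms(3)] linear_maps_uminus[OF assms(1-3,5)]
    by (simp add: a_minus_def)
qed


section \<open>Free modules\<close>

lemma free_module_simps [simp]: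
  "\<zero>\<^bsub>free_module k S\<^esub> = (\<lambda>s. \<zero>\<^bsub>k\<^esub>)"
  "\<phi> \<oplus>\<^bsub>free_module k S\<^esub> \<psi> = (\<lambda>s. \<phi> s \<oplus>\<^bsub>k\<^esub> \<psi> s)"
  "r \<odot>\<^bsub>free_module k S\<^esub> \<phi> = (\<lambda>s. r \<otimes>\<^bsub>k\<^esub> \<phi> s)"
  by (simp_all add: free_module_def)

lemma free_module_carrier:
  assumes "cring k"
  shows "\<phi> \<in> carrier (free_module k S) \<longleftrightarrow>
    (\<forall>s. \<phi> s \<in> carrier k) \<and> {s. \<phi> s \<noteq> \<zero>\<^bsub>k\<^esub>} \<subseteq> S \<and> finite {s. \<phi> s \<noteq> \<zero>\<^bsub>k\<^esub>}"
proof -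
  interpret cring k by fact
  show ?thesis
    by (auto simp: free_module_def Pi_iff)
qed

lemma free_module_module:
  assumes "cring k"
  shows "module k (free_module k S)"
proof -
  interpret k: cring k by fact
  let ?F = "free_module k S"
  note carr = free_module_carrier[OF assms, of _ S]
  have add: "(\<lambda>s. \<phi> s \<oplus>\<^bsub>k\<^esub> \<psi> s) \<in> carrier ?F"
    if "\<phi> \<in> carrier ?F" "\<psi> \<in> carrier ?F" for \<phi> \<psi>
  proof -
    have "{s. \<phi> s \<oplus>\<^bsub>k\<^esub> \<psi> s \<noteq> \<zero>\<^bsub>k\<^esub>} \<subseteq> {s. \<phi> s \<noteq> \<zero>\<^bsub>k\<^esub>} \<union> {s. \<psi> s \<noteq> \<zero>\<^bsub>k\<^esub>}"
      by auto
    then show ?thesis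
      using that unfolding carr by (meson finite_UnI finite_subset k.a_closed le_supI subset_trans)
  qed
  have smult: "(\<lambda>s. r \<otimes>\<^bsub>k\<^esub> \<phi> s) \<in> carrier ?F" if "r \<in> carrier k" "\<phi> \<in> carrier ?F" for r \<phi>
  proof -
    have "{s. r \<otimes>\<^bsub>k\<^esub> \<phi> s \<noteq> \<zero>\<^bsub>k\<^esub>} \<subseteq> {s. \<phi> s \<noteq> \<zero>\<^bsub>k\<^esub>}"
      using that by auto
    then show ?thesis
      using that unfolding carr by (meson finite_subset k.m_closed subset_trans)
  qed
  have neg: "(\<lambda>s. \<ominus>\<^bsub>k\<^esub> \<phi> s) \<in> carrier ?F" if "\<phi> \<in> carrier ?F" for \<phi>
    using that unfolding carr by auto
  have zero: "(\<lambda>s. \<zero>\<^bsub>k\<^esub>) \<in> carrier ?F"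
    unfolding carr by auto
  have "abelian_group ?F"
  proof (rule abelian_groupI)
    show "\<exists>\<psi>\<in>carrier ?F. \<psi> \<oplus>\<^bsub>?F\<^esub> \<phi> = \<zero>\<^bsub>?F\<^esub>" if "\<phi> \<in> carrier ?F" for \<phi>
      using that carr by (intro bexI[OF _ neg[OF that]]) (auto simp: k.l_neg)
    show "\<phi> \<oplus>\<^bsub>?F\<^esub> \<psi> \<in> carrier ?F" if "\<phi> \<in> carrier ?F" "\<psi> \<in> carrier ?F" for \<phi> \<psi>
      using add that by simp
  qed (use zero in \<open>simp_all add: carr k.a_ac\<close>)
  then show ?thesis
    by (rule moduleI[OF assms])
      (use smult in \<open>simp_all add: carr k.l_distr k.r_distr k.m_assoc\<close>)
qed

lemma basis_vec_closed:
  assumes "cring k" "s \<in> S"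
  shows "basis_vec k s \<in> carrier (free_module k S)"
proof -
  interpret cring k by fact
  have "{t. basis_vec k s t \<noteq> \<zero>\<^bsub>k\<^esub>} \<subseteq> {s}"
    by (auto simp: basis_vec_def)
  then show ?thesis
    using assms unfolding free_module_carrier[OF assms(1)]
    by (auto simp: basis_vec_def intro: finite_subset)
qed

lemma free_module_finsum_apply:
  assumes "cring k" "g \<in> I \<rightarrow> carrier (free_module k S)" "finite I"
  shows "(\<Oplus>\<^bsub>free_module k S\<^esub>i\<in>I. g i) t = (\<Oplus>\<^bsub>k\<^esub>i\<in>I. g i t)"
proof -
  interpret k: cring k by fact
  interpret F: module k "free_module k S" by (rule free_module_module) fact
  show ?thesis
    using assms(3,2)
  proof (induction I)
    case empty
    then show ?case by simp
  next
    case (insert i I)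
    then have "(\<lambda>i. g i t) \<in> I \<rightarrow> carrier k" "g i t \<in> carrier k"
      by (auto simp: Pi_iff free_module_carrier[OF assms(1)])
    with insert show ?case
      by (auto simp: Pi_iff)
  qed
qed

lemma free_module_expand:
  assumes "cring k" and \<phi>: "\<phi> \<in> carrier (free_module k S)"
  shows "\<phi> = (\<Oplus>\<^bsub>free_module k S\<^esub>s\<in>{s. \<phi> s \<noteq> \<zero>\<^bsub>k\<^esub>}. \<phi> s \<odot>\<^bsub>free_module k S\<^esub> basis_vec k s)"
proof
  fix t
  let ?F = "free_module k S" and ?I = "{s. \<phi> s \<noteq> \<zero>\<^bsub>k\<^esub>}"
  interpret k: cring k by fact
  interpret F: module k ?F by (rule free_module_module) fact
  have I: "finite ?I" "?I \<subseteq> S" and val: "\<And>s. \<phi> s \<in> carrier k"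
    using \<phi> unfolding free_module_carrier[OF assms(1)] by auto
  have "(\<lambda>s. \<phi> s \<odot>\<^bsub>?F\<^esub> basis_vec k s) \<in> ?I \<rightarrow> carrier ?F"
    using I val basis_vec_closed[OF assms(1), of _ S]
    by (intro Pi_I F.smult_closed) auto
  then have "(\<Oplus>\<^bsub>?F\<^esub>s\<in>?I. \<phi> s \<odot>\<^bsub>?F\<^esub> basis_vec k s) t =
      (\<Oplus>\<^bsub>k\<^esub>s\<in>?I. (\<phi> s \<odot>\<^bsub>?F\<^esub> basis_vec k s) t)"
    by (rule free_module_finsum_apply[OF assms(1) _ I(1)])
  also have "\<dots> = (\<Oplus>\<^bsub>k\<^esub>s\<in>?I. if t = s then \<phi> s else \<zero>\<^bsub>k\<^esub>)"
    using val by (intro k.finsum_cong') (auto simp: basis_vec_def)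
  also have "\<dots> = \<phi> t"
  proof (cases "t \<in> ?I")
    case True
    then show ?thesis using I val k.finsum_singleton[of t ?I \<phi>] by simp
  next
    case False
    then have "(\<Oplus>\<^bsub>k\<^esub>s\<in>?I. if t = s then \<phi> s else \<zero>\<^bsub>k\<^esub>) = (\<Oplus>\<^bsub>k\<^esub>s\<in>?I. \<zero>\<^bsub>k\<^esub>)"
      by (intro k.finsum_cong') auto
    with False show ?thesis by simp
  qed
  finally show "\<phi> t = (\<Oplus>\<^bsub>?F\<^esub>s\<in>?I. \<phi> s \<odot>\<^bsub>?F\<^esub> basis_vec k s) t" ..
qed

text \<open>
  This is the linear extension of \<open>b\<close>; \<open>tensor_lift\<close> evaluates the same sum at some
  representative of a coset.
\<close>

definition free_lift ::
    "('k, 'r) ring_scheme \<Rightarrow> ('k, 'p, 'x) module_scheme \<Rightarrow> ('s \<Rightarrow> 'p) \<Rightarrow> ('s \<Rightarrow> 'k) \<Rightarrow> 'p"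
  where "free_lift k P b \<phi> = (\<Oplus>\<^bsub>P\<^esub>s\<in>{s. \<phi> s \<noteq> \<zero>\<^bsub>k\<^esub>}. \<phi> s \<odot>\<^bsub>P\<^esub> b s)"

lemma free_lift_superset:
  assumes "module k P" "b \<in> S \<rightarrow> carrier P" "\<phi> \<in> carrier (free_module k S)"
    and "finite I" "{s. \<phi> s \<noteq> \<zero>\<^bsub>k\<^esub>} \<subseteq> I" "I \<subseteq> S"
  shows "free_lift k P b \<phi> = (\<Oplus>\<^bsub>P\<^esub>s\<in>I. \<phi> s \<odot>\<^bsub>P\<^esub> b s)"
proof -
  interpret P: module k P by fact
  have "\<And>s. \<phi> s \<in> carrier k"
    using assms(3) unfolding free_module_carrier[OF P.is_cring] by auto
  then show ?thesis
    unfolding free_lift_def using assms(2,4-6)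
    by (intro P.add.finprod_mono_neutral_cong_left) (auto simp: Pi_iff subset_iff)
qed

lemma free_lift_linear:
  assumes P: "module k P" and b: "b \<in> S \<rightarrow> carrier P"
  shows "free_lift k P b \<in> linear_maps k (free_module k S) P"
proof (rule linear_mapsI)
  let ?F = "free_module k S"
  interpret P: module k P by fact
  interpret F: module k ?F by (rule free_module_module) (rule P.is_cring)
  note carr = free_module_carrier[OF P.is_cring, of _ S]
  note super = free_lift_superset[OF P b]
  have summands: "(\<lambda>s. \<phi> s \<odot>\<^bsub>P\<^esub> b s) \<in> I \<rightarrow> carrier P" if "\<phi> \<in> carrier ?F" "I \<subseteq> S" for \<phi> I
    using that b unfolding carr by auto
  show "free_lift k P b \<phi> \<in> carrier P" if "\<phi> \<in> carrier ?F" for \<phi>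
    unfolding free_lift_def using summands[OF that] that unfolding carr by (intro P.finsum_closed) blast
  show "free_lift k P b (\<phi> \<oplus>\<^bsub>?F\<^esub> \<psi>) = free_lift k P b \<phi> \<oplus>\<^bsub>P\<^esub> free_lift k P b \<psi>"
    if "\<phi> \<in> carrier ?F" "\<psi> \<in> carrier ?F" for \<phi> \<psi>
  proof -
    let ?I = "{s. \<phi> s \<noteq> \<zero>\<^bsub>k\<^esub>} \<union> {s. \<psi> s \<noteq> \<zero>\<^bsub>k\<^esub>}"
    have I: "finite ?I" "?I \<subseteq> S" and val: "\<And>s. \<phi> s \<in> carrier k" "\<And>s. \<psi> s \<in> carrier k"
      using that unfolding carr by auto
    have "free_lift k P b (\<phi> \<oplus>\<^bsub>?F\<^esub> \<psi>) = (\<Oplus>\<^bsub>P\<^esub>s\<in>?I. (\<phi> \<oplus>\<^bsub>?F\<^esub> \<psi>) s \<odot>\<^bsub>P\<^esub> b s)"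
      using that I F.a_closed[OF that] by (intro super) auto
    also have "\<dots> = (\<Oplus>\<^bsub>P\<^esub>s\<in>?I. \<phi> s \<odot>\<^bsub>P\<^esub> b s \<oplus>\<^bsub>P\<^esub> \<psi> s \<odot>\<^bsub>P\<^esub> b s)"
      using I b val by (intro P.finsum_cong') (auto simp: P.smult_l_distr Pi_iff subset_iff)
    also have "\<dots> = (\<Oplus>\<^bsub>P\<^esub>s\<in>?I. \<phi> s \<odot>\<^bsub>P\<^esub> b s) \<oplus>\<^bsub>P\<^esub> (\<Oplus>\<^bsub>P\<^esub>s\<in>?I. \<psi> s \<odot>\<^bsub>P\<^esub> b s)"
      by (intro P.finsum_addf summands that I)
    also have "\<dots> = free_lift k P b \<phi> \<oplus>\<^bsub>P\<^esub> free_lift k P b \<psi>"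
      using super[OF that(1) I(1) _ I(2)] super[OF that(2) I(1) _ I(2)] by simp
    finally show ?thesis .
  qed
  show "free_lift k P b (r \<odot>\<^bsub>?F\<^esub> \<phi>) = r \<odot>\<^bsub>P\<^esub> free_lift k P b \<phi>"
    if "r \<in> carrier k" "\<phi> \<in> carrier ?F" for r \<phi>
  proof -
    let ?I = "{s. \<phi> s \<noteq> \<zero>\<^bsub>k\<^esub>}"
    have I: "finite ?I" "?I \<subseteq> S" and val: "\<And>s. \<phi> s \<in> carrier k"
      using that unfolding carr by auto
    have "free_lift k P b (r \<odot>\<^bsub>?F\<^esub> \<phi>) = (\<Oplus>\<^bsub>P\<^esub>s\<in>?I. (r \<odot>\<^bsub>?F\<^esub> \<phi>) s \<odot>\<^bsub>P\<^esub> b s)"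
      using that I F.smult_closed[OF that] by (intro super) auto
    also have "\<dots> = (\<Oplus>\<^bsub>P\<^esub>s\<in>?I. r \<odot>\<^bsub>P\<^esub> (\<phi> s \<odot>\<^bsub>P\<^esub> b s))"
      using I b val that(1) by (intro P.finsum_cong') (auto simp: P.smult_assoc1 Pi_iff subset_iff)
    also have "\<dots> = r \<odot>\<^bsub>P\<^esub> free_lift k P b \<phi>"
      unfolding free_lift_def by (intro P.finsum_smult_ldistr[symmetric] summands that I)
    finally show ?thesis .
  qed
qed

lemma free_lift_basis_vec:
  assumes P: "module k P" and b: "b \<in> S \<rightarrow> carrier P" and s: "s \<in> S"
  shows "free_lift k P b (basis_vec k s) = b s"
proof -
  interpret P: module k P by fact
  have "free_lift k P b (basis_vec k s) = (\<Oplus>\<^bsub>P\<^esub>t\<in>{s}. basis_vec k s t \<odot>\<^bsub>P\<^esub> b t)"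
    using basis_vec_closed[OF P.is_cring s] s
    by (intro free_lift_superset[OF P b]) (auto simp: basis_vec_def)
  also have "\<dots> = b s"
    using b s by (auto simp: basis_vec_def Pi_iff)
  finally show ?thesis .
qed


section \<open>Quotient modules\<close>

lemma submodule_abelian_subgroup:
  assumes "module k M" "submodule H k M"
  shows "abelian_subgroup H M"
  using assms by (intro abelian_subgroupI3 additive_subgroupI)
    (auto simp: submodule_def module_def)

lemma quotient_module_simps:
  assumes "module k M" "submodule H k M"
  shows "x \<in> carrier M \<Longrightarrow> y \<in> carrier M \<Longrightarrow>
      (H +>\<^bsub>M\<^esub> x) \<oplus>\<^bsub>quotient_module M H\<^esub> (H +>\<^bsub>M\<^esub> y) = H +>\<^bsub>M\<^esub> (x \<oplus>\<^bsub>M\<^esub> y)"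
    and "r \<in> carrier k \<Longrightarrow> x \<in> carrier M \<Longrightarrow>
      r \<odot>\<^bsub>quotient_module M H\<^esub> (H +>\<^bsub>M\<^esub> x) = H +>\<^bsub>M\<^esub> (r \<odot>\<^bsub>M\<^esub> x)"
    and "\<zero>\<^bsub>quotient_module M H\<^esub> = H +>\<^bsub>M\<^esub> \<zero>\<^bsub>M\<^esub>"
    and "carrier (quotient_module M H) = (\<lambda>x. H +>\<^bsub>M\<^esub> x) ` carrier M"
proof -
  interpret M: module k M by fact
  interpret H: abelian_subgroup H M
    by (rule submodule_abelian_subgroup) fact+
  show "(H +>\<^bsub>M\<^esub> x) \<oplus>\<^bsub>quotient_module M H\<^esub> (H +>\<^bsub>M\<^esub> y) = H +>\<^bsub>M\<^esub> (x \<oplus>\<^bsub>M\<^esub> y)"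
    if "x \<in> carrier M" "y \<in> carrier M"
    using that by (simp add: quotient_module_def H.a_rcos_sum)
  show "\<zero>\<^bsub>quotient_module M H\<^esub> = H +>\<^bsub>M\<^esub> \<zero>\<^bsub>M\<^esub>"
    by (simp add: quotient_module_def H.a_subset)
  show "carrier (quotient_module M H) = (\<lambda>x. H +>\<^bsub>M\<^esub> x) ` carrier M"
    by (auto simp: quotient_module_def A_RCOSETS_def' )
  show "r \<odot>\<^bsub>quotient_module M H\<^esub> (H +>\<^bsub>M\<^esub> x) = H +>\<^bsub>M\<^esub> (r \<odot>\<^bsub>M\<^esub> x)"
    if r: "r \<in> carrier k" and x: "x \<in> carrier M"
  proof -
    have eq: "H +>\<^bsub>M\<^esub> (r \<odot>\<^bsub>M\<^esub> y) = H +>\<^bsub>M\<^esub> (r \<odot>\<^bsub>M\<^esub> x)" if y: "y \<in> H +>\<^bsub>M\<^esub> x" for y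
    proof -
      obtain h where h: "h \<in> H" "y = h \<oplus>\<^bsub>M\<^esub> x"
        using y by (auto simp: a_r_coset_def')
      then have "r \<odot>\<^bsub>M\<^esub> h \<in> H" "r \<odot>\<^bsub>M\<^esub> y = r \<odot>\<^bsub>M\<^esub> h \<oplus>\<^bsub>M\<^esub> r \<odot>\<^bsub>M\<^esub> x"
        using submodule.smult_closed[OF assms(2)] r x M.smult_r_distr by auto
      then have "r \<odot>\<^bsub>M\<^esub> y \<in> H +>\<^bsub>M\<^esub> (r \<odot>\<^bsub>M\<^esub> x)"
        by (auto simp: a_r_coset_def')
      then show ?thesis
        by (rule H.a_repr_independence'[OF _ M.smult_closed[OF r x], symmetric])
    qed
    moreover have "x \<in> H +>\<^bsub>M\<^esub> x"
      using x by (rule H.a_rcos_self)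
    ultimately have "(\<Union>y\<in>H +>\<^bsub>M\<^esub> x. H +>\<^bsub>M\<^esub> (r \<odot>\<^bsub>M\<^esub> y)) = H +>\<^bsub>M\<^esub> (r \<odot>\<^bsub>M\<^esub> x)"
      by blast
    then show ?thesis
      by (simp add: quotient_module_def)
  qed
qed

lemma quotient_module_module:
  assumes "module k M" "submodule H k M"
  shows "module k (quotient_module M H)"
proof -
  interpret M: module k M by fact
  let ?Q = "quotient_module M H"
  note simps = quotient_module_simps[OF assms]
  have "abelian_group ?Q"
  proof (rule abelian_groupI)
    show "\<exists>Y\<in>carrier ?Q. Y \<oplus>\<^bsub>?Q\<^esub> X = \<zero>\<^bsub>?Q\<^esub>" if X: "X \<in> carrier ?Q" for X
    proof -
      obtain x where "x \<in> carrier M" "X = H +>\<^bsub>M\<^esub> x"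
        using X simps(4) by auto
      then show ?thesis
        using simps by (intro bexI[of _ "H +>\<^bsub>M\<^esub> (\<ominus>\<^bsub>M\<^esub> x)"]) (auto simp: M.l_neg)
    qed
    show "X \<oplus>\<^bsub>?Q\<^esub> Y \<in> carrier ?Q" if "X \<in> carrier ?Q" "Y \<in> carrier ?Q" for X Y
      using that unfolding simps(4) by (auto simp: simps)
    show "X \<oplus>\<^bsub>?Q\<^esub> Y = Y \<oplus>\<^bsub>?Q\<^esub> X" if "X \<in> carrier ?Q" "Y \<in> carrier ?Q" for X Y
      using that unfolding simps(4) by (auto simp: simps M.a_comm)
  qed (auto simp: simps M.a_assoc)
  then show ?thesis
    by (rule moduleI[OF M.is_cring])
      (auto simp: simps M.smult_l_distr M.smult_r_distr M.smult_assoc1)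
qed

section \<open>Tensor products\<close>

(* From here on elements of a free module are handled through its module operations; unfolding
   these to pointwise sums would break the algebra. *)
declare free_module_simps [simp del]

lemma coset_eqI:
  assumes "module k M" "submodule H k M" "x \<in> carrier M" "y \<in> carrier M" "x \<ominus>\<^bsub>M\<^esub> y \<in> H"
  shows "H +>\<^bsub>M\<^esub> x = H +>\<^bsub>M\<^esub> y"
proof -
  interpret M: module k M by fact
  interpret H: abelian_subgroup H M
    by (rule submodule_abelian_subgroup) fact+
  have "x = (x \<ominus>\<^bsub>M\<^esub> y) \<oplus>\<^bsub>M\<^esub> y"
    using assms(3,4) by (simp add: a_minus_def M.a_assoc M.l_neg)
  then have "x \<in> H +>\<^bsub>M\<^esub> y"
    using assms(5) by (auto simp: a_r_coset_def')
  then show ?thesis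
    by (rule H.a_repr_independence'[OF _ assms(4), symmetric])
qed

lemma coset_linear:
  assumes "module k M" "submodule H k M"
  shows "(\<lambda>x. H +>\<^bsub>M\<^esub> x) \<in> linear_maps k M (quotient_module M H)"
  by (rule linear_mapsI) (auto simp: quotient_module_simps[OF assms])

lemma tensor_relations_subset:
  assumes "module k M" "module k N"
  shows "tensor_relations k M N \<subseteq> carrier (free_module k (carrier M \<times> carrier N))"
proof -
  interpret M: module k M by fact
  interpret N: module k N by fact
  interpret F: module k "free_module k (carrier M \<times> carrier N)"
    by (rule free_module_module) (rule M.is_cring)
  have "\<And>x y. x \<in> carrier M \<Longrightarrow> y \<in> carrier N \<Longrightarrow>
      basis_vec k (x, y) \<in> carrier (free_module k (carrier M \<times> carrier N))"
    by (intro basis_vec_closed M.is_cring) simp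
  then show ?thesis
    unfolding tensor_relations_def Let_def
    by (auto intro!: F.minus_closed F.a_closed F.smult_closed)
qed

lemma tensor_kernel_submodule:
  assumes "module k M" "module k N"
  shows "submodule (tensor_kernel k M N) k (free_module k (carrier M \<times> carrier N))"
proof -
  interpret M: module k M by fact
  let ?F = "free_module k (carrier M \<times> carrier N)"
  interpret F: module k ?F
    by (rule free_module_module) (rule M.is_cring)
  let ?\<H> = "{H. submodule H k ?F \<and> tensor_relations k M N \<subseteq> H}"
  have "carrier ?F \<in> ?\<H>"
    using F.carrier_is_submodule tensor_relations_subset[OF assms] by simp
  then have "\<Inter>?\<H> \<subseteq> carrier ?F"
    by blast
  moreover have "\<zero>\<^bsub>?F\<^esub> \<in> H" if "submodule H k ?F" for H
    using subgroup.one_closed[OF submodule.axioms(1)[OF that]] by simp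
  ultimately show ?thesis
    unfolding tensor_kernel_def submodule_generated_def
    by (intro F.submoduleI) (auto simp: F.submoduleE(3-5))
qed

lemma tensor_relations_in_kernel: "tensor_relations k M N \<subseteq> tensor_kernel k M N"
  by (auto simp: tensor_kernel_def submodule_generated_def)

lemma tensor_kernel_least:
  assumes "submodule H k (free_module k (carrier M \<times> carrier N))" "tensor_relations k M N \<subseteq> H"
  shows "tensor_kernel k M N \<subseteq> H"
  using assms by (auto simp: tensor_kernel_def submodule_generated_def)

lemma tensor_product_module:
  assumes "module k M" "module k N"
  shows "module k (tensor_product k M N)"
proof -
  interpret M: module k M by fact
  show ?thesis
    unfolding tensor_product_def
    by (intro quotient_module_module free_module_module tensor_kernel_submodule assms M.is_cring)
qed

lemma tensor_coset_linear:
  assumes "module k M" "module k N"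
  shows "(\<lambda>\<phi>. tensor_kernel k M N +>\<^bsub>free_module k (carrier M \<times> carrier N)\<^esub> \<phi>)
    \<in> linear_maps k (free_module k (carrier M \<times> carrier N)) (tensor_product k M N)"
proof -
  interpret M: module k M by fact
  show ?thesis
    unfolding tensor_product_def
    by (intro coset_linear free_module_module tensor_kernel_submodule assms M.is_cring)
qed

lemma pure_tensor_closed:
  assumes "module k M" "module k N" "x \<in> carrier M" "y \<in> carrier N"
  shows "pure_tensor k M N x y \<in> carrier (tensor_product k M N)"
proof -
  interpret M: module k M by fact
  show ?thesis
    unfolding pure_tensor_def using assms
    by (intro linear_mapsD(1)[OF tensor_coset_linear] basis_vec_closed M.is_cring) auto
qed

text \<open>
  Bilinear maps are kept curried: this is the form that \<open>tensor_lift\<close> takes, and fixing either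
  argument gives a linear map.
\<close>

definition bilinear_maps ::
    "('k, 'r) ring_scheme \<Rightarrow> ('k, 'm, 'x) module_scheme \<Rightarrow> ('k, 'n, 'y) module_scheme \<Rightarrow>
      ('k, 'p, 'z) module_scheme \<Rightarrow> ('m \<Rightarrow> 'n \<Rightarrow> 'p) set"
  where "bilinear_maps k M N P =
    {b. (\<forall>x\<in>carrier M. b x \<in> linear_maps k N P) \<and>
        (\<forall>y\<in>carrier N. (\<lambda>x. b x y) \<in> linear_maps k M P)}"

lemma pure_tensor_bilinear:
  fixes M :: "('k, 'm, 'x) module_scheme" and N :: "('k, 'n, 'y) module_scheme"
  assumes "module k M" "module k N"
  shows "pure_tensor k M N \<in> bilinear_maps k M N (tensor_product k M N)"
proof -
  interpret M: module k M by fact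
  interpret N: module k N by fact
  let ?F = "free_module k (carrier M \<times> carrier N)" and ?T = "tensor_product k M N"
  interpret F: module k ?F
    by (rule free_module_module) (rule M.is_cring)
  define e :: "'m \<times> 'n \<Rightarrow> 'm \<times> 'n \<Rightarrow> 'k" where "e = basis_vec k"
  define \<pi> where "\<pi> = (\<lambda>\<phi>. tensor_kernel k M N +>\<^bsub>?F\<^esub> \<phi>)"
  have pure: "pure_tensor k M N x y = \<pi> (e (x, y))" for x y
    by (simp add: pure_tensor_def e_def \<pi>_def)
  have e: "e (x, y) \<in> carrier ?F" if "x \<in> carrier M" "y \<in> carrier N" for x y
    using that unfolding e_def by (intro basis_vec_closed M.is_cring) simp
  have \<pi>_eq: "\<pi> \<phi> = \<pi> \<psi>"
    if "\<phi> \<ominus>\<^bsub>?F\<^esub> \<psi> \<in> tensor_relations k M N" "\<phi> \<in> carrier ?F" "\<psi> \<in> carrier ?F" for \<phi> \<psi>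
    using that tensor_relations_in_kernel unfolding \<pi>_def
    by (intro coset_eqI[where k = k] F.module_axioms tensor_kernel_submodule assms) auto
  have \<pi>: "\<pi> \<in> linear_maps k ?F ?T"
    unfolding \<pi>_def by (rule tensor_coset_linear[OF assms])
  note \<pi>_simps = linear_mapsD[OF \<pi>]
  have "\<pi> (e (x \<oplus>\<^bsub>M\<^esub> x', y)) = \<pi> (e (x, y) \<oplus>\<^bsub>?F\<^esub> e (x', y))"
    if "x \<in> carrier M" "x' \<in> carrier M" "y \<in> carrier N" for x x' y
    using that by (intro \<pi>_eq e F.a_closed) (auto simp: tensor_relations_def Let_def e_def)
  moreover have "\<pi> (e (x, y \<oplus>\<^bsub>N\<^esub> y')) = \<pi> (e (x, y) \<oplus>\<^bsub>?F\<^esub> e (x, y'))"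
    if "x \<in> carrier M" "y \<in> carrier N" "y' \<in> carrier N" for x y y'
    using that by (intro \<pi>_eq e F.a_closed) (auto simp: tensor_relations_def Let_def e_def)
  moreover have "\<pi> (e (r \<odot>\<^bsub>M\<^esub> x, y)) = \<pi> (r \<odot>\<^bsub>?F\<^esub> e (x, y))"
    if "r \<in> carrier k" "x \<in> carrier M" "y \<in> carrier N" for r x y
    using that by (intro \<pi>_eq e F.smult_closed) (auto simp: tensor_relations_def Let_def e_def)
  moreover have "\<pi> (e (x, r \<odot>\<^bsub>N\<^esub> y)) = \<pi> (r \<odot>\<^bsub>?F\<^esub> e (x, y))"
    if "r \<in> carrier k" "x \<in> carrier M" "y \<in> carrier N" for r x y
    using that by (intro \<pi>_eq e F.smult_closed) (auto simp: tensor_relations_def Let_def e_def)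
  ultimately show ?thesis
    unfolding bilinear_maps_def pure
    by (auto intro!: linear_mapsI simp: \<pi>_simps e pure)
qed

lemma bilinear_mapsD:
  assumes "b \<in> bilinear_maps k M N P"
  shows "\<And>x. x \<in> carrier M \<Longrightarrow> b x \<in> linear_maps k N P"
    and "\<And>y. y \<in> carrier N \<Longrightarrow> (\<lambda>x. b x y) \<in> linear_maps k M P"
  using assms by (auto simp: bilinear_maps_def)

lemmas pure_tensor_linear_right = pure_tensor_bilinear[THEN bilinear_mapsD(1)]
lemmas pure_tensor_linear_left = pure_tensor_bilinear[THEN bilinear_mapsD(2)]

text \<open>
  The coset map is linear, and a function of finite support is the combination of basis vectors
  with its own values as coefficients.
\<close>

lemma tensor_expand:
  assumes "module k M" "module k N" "t \<in> carrier (tensor_product k M N)" "\<phi> \<in> t"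
  shows "\<phi> \<in> carrier (free_module k (carrier M \<times> carrier N))"
    and "t = free_lift k (tensor_product k M N) (\<lambda>s. pure_tensor k M N (fst s) (snd s)) \<phi>"
proof -
  interpret M: module k M by fact
  let ?S = "carrier M \<times> carrier N"
  let ?F = "free_module k ?S" and ?K = "tensor_kernel k M N" and ?T = "tensor_product k M N"
  interpret F: module k ?F
    by (rule free_module_module) (rule M.is_cring)
  interpret T: module k ?T
    by (rule tensor_product_module) fact+
  interpret K: abelian_subgroup ?K ?F
    by (intro submodule_abelian_subgroup[where k = k] tensor_kernel_submodule F.module_axioms assms)
  obtain \<psi> where \<psi>: "\<psi> \<in> carrier ?F" "t = ?K +>\<^bsub>?F\<^esub> \<psi>"
    using assms(3) quotient_module_simps(4)[OF F.module_axioms tensor_kernel_submodule[OF assms(1,2)]]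
    unfolding tensor_product_def by auto
  then show \<phi>: "\<phi> \<in> carrier ?F"
    using assms(4) K.a_elemrcos_carrier by blast
  have supp: "s \<in> ?S" "\<phi> s \<in> carrier k" if "\<phi> s \<noteq> \<zero>\<^bsub>k\<^esub>" for s
    using that \<phi> unfolding free_module_carrier[OF M.is_cring] by blast+
  have "t = ?K +>\<^bsub>?F\<^esub> \<phi>"
    using K.a_repr_independence' assms(4) \<psi> by blast
  also have "\<dots> = ?K +>\<^bsub>?F\<^esub> (\<Oplus>\<^bsub>?F\<^esub>s\<in>{s. \<phi> s \<noteq> \<zero>\<^bsub>k\<^esub>}. \<phi> s \<odot>\<^bsub>?F\<^esub> basis_vec k s)"
    by (rule arg_cong[where f = "\<lambda>\<psi>. ?K +>\<^bsub>?F\<^esub> \<psi>",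
          OF free_module_expand[OF M.is_cring \<phi>]])
  also have "\<dots> = (\<Oplus>\<^bsub>?T\<^esub>s\<in>{s. \<phi> s \<noteq> \<zero>\<^bsub>k\<^esub>}. ?K +>\<^bsub>?F\<^esub> (\<phi> s \<odot>\<^bsub>?F\<^esub> basis_vec k s))"
    using supp
    by (intro linear_maps_finsum[OF F.module_axioms T.module_axioms tensor_coset_linear] assms(1,2)
        Pi_I F.smult_closed basis_vec_closed M.is_cring) simp_all
  also have "\<dots> = (\<Oplus>\<^bsub>?T\<^esub>s\<in>{s. \<phi> s \<noteq> \<zero>\<^bsub>k\<^esub>}. \<phi> s \<odot>\<^bsub>?T\<^esub> pure_tensor k M N (fst s) (snd s))"
  proof (intro T.finsum_cong' refl Pi_I)
    fix s
    assume "s \<in> {s. \<phi> s \<noteq> \<zero>\<^bsub>k\<^esub>}"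
    then have s: "s \<in> ?S" "\<phi> s \<in> carrier k"
      using supp by simp_all
    then show "\<phi> s \<odot>\<^bsub>?T\<^esub> pure_tensor k M N (fst s) (snd s) \<in> carrier ?T"
      by (intro T.smult_closed pure_tensor_closed assms) auto
    show "?K +>\<^bsub>?F\<^esub> (\<phi> s \<odot>\<^bsub>?F\<^esub> basis_vec k s) = \<phi> s \<odot>\<^bsub>?T\<^esub> pure_tensor k M N (fst s) (snd s)"
      unfolding pure_tensor_def prod.collapse
      using s by (intro linear_mapsD(3)[OF tensor_coset_linear] assms basis_vec_closed M.is_cring)
  qed
  finally show "t = free_lift k ?T (\<lambda>s. pure_tensor k M N (fst s) (snd s)) \<phi>"
    by (simp add: free_lift_def)
qed

text \<open>
  This is how expressions in Sweedler notation are evaluated below: one exhibits a linear map with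
  the right values on pure tensors. The sum that defines \<open>tensor_lift\<close> is then term by term the
  image of the expansion of \<open>t\<close> into pure tensors, whichever representative was chosen, so no
  statement about representatives is left to the applications.
\<close>

lemma tensor_lift_eqI:
  assumes M: "module k M" and N: "module k N" and P: "module k P"
    and g: "g \<in> linear_maps k (tensor_product k M N) P"
    and b: "\<And>x y. x \<in> carrier M \<Longrightarrow> y \<in> carrier N \<Longrightarrow> b x y = g (pure_tensor k M N x y)"
    and t: "t \<in> carrier (tensor_product k M N)"
  shows "tensor_lift k P b t = g t"
proof -
  interpret M: module k M by fact
  interpret P: module k P by fact
  let ?S = "carrier M \<times> carrier N"
  let ?F = "free_module k ?S" and ?K = "tensor_kernel k M N" and ?T = "tensor_product k M N"
  interpret F: module k ?F
    by (rule free_module_module) (rule M.is_cring)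
  interpret T: module k ?T
    by (rule tensor_product_module) fact+
  interpret K: abelian_subgroup ?K ?F
    by (intro submodule_abelian_subgroup[where k = k] tensor_kernel_submodule F.module_axioms M N)
  let ?\<phi> = "SOME \<phi>. \<phi> \<in> t"
  obtain \<psi> where "\<psi> \<in> carrier ?F" "t = ?K +>\<^bsub>?F\<^esub> \<psi>"
    using t quotient_module_simps(4)[OF F.module_axioms tensor_kernel_submodule[OF M N]]
    unfolding tensor_product_def by auto
  then have "?\<phi> \<in> t"
    using K.a_rcos_self by (metis someI)
  note \<phi> = tensor_expand[OF M N t this]
  have supp: "s \<in> ?S" "?\<phi> s \<in> carrier k" if "?\<phi> s \<noteq> \<zero>\<^bsub>k\<^esub>" for s
    using that \<phi>(1) unfolding free_module_carrier[OF M.is_cring] by blast+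
  have "g t = g (free_lift k ?T (\<lambda>s. pure_tensor k M N (fst s) (snd s)) ?\<phi>)"
    by (rule arg_cong[where f = g, OF \<phi>(2)])
  also have "\<dots> = (\<Oplus>\<^bsub>P\<^esub>s\<in>{s. ?\<phi> s \<noteq> \<zero>\<^bsub>k\<^esub>}. g (?\<phi> s \<odot>\<^bsub>?T\<^esub> pure_tensor k M N (fst s) (snd s)))"
    unfolding free_lift_def using supp
    by (intro linear_maps_finsum[OF T.module_axioms P g] Pi_I T.smult_closed pure_tensor_closed M N)
      (auto simp: mem_Times_iff)
  also have "\<dots> = (\<Oplus>\<^bsub>P\<^esub>s\<in>{s. ?\<phi> s \<noteq> \<zero>\<^bsub>k\<^esub>}. ?\<phi> s \<odot>\<^bsub>P\<^esub> b (fst s) (snd s))"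
    using supp b pure_tensor_closed[OF M N]
    by (intro P.finsum_cong') (auto simp: linear_mapsD[OF g] mem_Times_iff)
  finally show ?thesis
    by (simp add: tensor_lift_def Let_def)
qed

lemma linear_maps_tensor_ext:
  assumes M: "module k M" and N: "module k N" and P: "module k P"
    and f: "f \<in> linear_maps k (tensor_product k M N) P"
    and g: "g \<in> linear_maps k (tensor_product k M N) P"
    and eq: "\<And>x y. x \<in> carrier M \<Longrightarrow> y \<in> carrier N \<Longrightarrow>
      f (pure_tensor k M N x y) = g (pure_tensor k M N x y)"
    and t: "t \<in> carrier (tensor_product k M N)"
  shows "f t = g t"
  using tensor_lift_eqI[OF M N P f _ t, of "\<lambda>x y. f (pure_tensor k M N x y)"]
    tensor_lift_eqI[OF M N P g _ t, of "\<lambda>x y. f (pure_tensor k M N x y)"] eq by simp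

text \<open>
  Conversely, a bilinear map does extend: the linear extension to the free module kills the
  bilinearity relations, hence the submodule that they generate.
\<close>

lemma tensor_lift_coset:
  assumes M: "module k M" and N: "module k N" and P: "module k P"
    and b: "b \<in> bilinear_maps k M N P"
    and \<phi>: "\<phi> \<in> carrier (free_module k (carrier M \<times> carrier N))"
  shows "tensor_lift k P b (tensor_kernel k M N +>\<^bsub>free_module k (carrier M \<times> carrier N)\<^esub> \<phi>) =
    free_lift k P (\<lambda>s. b (fst s) (snd s)) \<phi>"
proof -
  interpret M: module k M by fact
  interpret N: module k N by fact
  interpret P: module k P by fact
  let ?S = "carrier M \<times> carrier N"
  let ?F = "free_module k ?S" and ?K = "tensor_kernel k M N"
  interpret F: module k ?F
    by (rule free_module_module) (rule M.is_cring)
  interpret K: abelian_subgroup ?K ?F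
    by (intro submodule_abelian_subgroup[where k = k] tensor_kernel_submodule F.module_axioms M N)
  define g where "g = free_lift k P (\<lambda>s. b (fst s) (snd s))"
  note b_left = linear_mapsD[OF bilinear_mapsD(2)[OF b]]
  note b_right = linear_mapsD[OF bilinear_mapsD(1)[OF b]]
  have b_closed: "(\<lambda>s. b (fst s) (snd s)) \<in> ?S \<rightarrow> carrier P"
    by (intro Pi_I b_right(1)) (simp_all add: mem_Times_iff)
  have g: "g \<in> linear_maps k ?F P"
    unfolding g_def by (rule free_lift_linear[OF P b_closed])
  have basis: "basis_vec k (x, y) \<in> carrier ?F" "g (basis_vec k (x, y)) = b x y"
    if "x \<in> carrier M" "y \<in> carrier N" for x y
    using that basis_vec_closed[OF M.is_cring, of "(x, y)" ?S]
      free_lift_basis_vec[OF P b_closed, of "(x, y)"] by (auto simp: g_def)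
  have diff: "x \<ominus>\<^bsub>P\<^esub> x = \<zero>\<^bsub>P\<^esub>" if "x \<in> carrier P" for x
    using that by (simp add: a_minus_def P.r_neg)
  have "tensor_relations k M N \<subseteq> {\<psi> \<in> carrier ?F. g \<psi> = \<zero>\<^bsub>P\<^esub>}"
    using tensor_relations_subset[OF M N] unfolding tensor_relations_def Let_def
    by (auto simp: linear_maps_minus[OF F.module_axioms P g] linear_mapsD[OF g] basis
        b_left(2,3) b_right diff)
  then have "?K \<subseteq> {\<psi> \<in> carrier ?F. g \<psi> = \<zero>\<^bsub>P\<^esub>}"
    by (intro tensor_kernel_least linear_kernel_submodule[OF F.module_axioms P g])
  moreover have "(SOME \<psi>. \<psi> \<in> ?K +>\<^bsub>?F\<^esub> \<phi>) \<in> ?K +>\<^bsub>?F\<^esub> \<phi>"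
    using someI[where P = "\<lambda>\<psi>. \<psi> \<in> ?K +>\<^bsub>?F\<^esub> \<phi>", OF K.a_rcos_self[OF \<phi>]] .
  ultimately have "g (SOME \<psi>. \<psi> \<in> ?K +>\<^bsub>?F\<^esub> \<phi>) = g \<phi>"
    using \<phi> by (auto simp: a_r_coset_def' linear_mapsD[OF g])
  then show ?thesis
    by (simp add: tensor_lift_def free_lift_def g_def Let_def)
qed

lemma tensor_lift_pure:
  assumes M: "module k M" and N: "module k N" and P: "module k P"
    and b: "b \<in> bilinear_maps k M N P" and x: "x \<in> carrier M" and y: "y \<in> carrier N"
  shows "tensor_lift k P b (pure_tensor k M N x y) = b x y"
proof -
  interpret M: module k M by fact
  have b_closed: "(\<lambda>s. b (fst s) (snd s)) \<in> carrier M \<times> carrier N \<rightarrow> carrier P"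
    by (intro Pi_I linear_mapsD(1)[OF bilinear_mapsD(1)[OF b]]) (simp_all add: mem_Times_iff)
  show ?thesis
    unfolding pure_tensor_def
    using x y basis_vec_closed[OF M.is_cring, of "(x, y)" "carrier M \<times> carrier N"]
      free_lift_basis_vec[OF P b_closed, of "(x, y)"]
    by (simp add: tensor_lift_coset[OF M N P b])
qed

lemma tensor_lift_linear:
  assumes M: "module k M" and N: "module k N" and P: "module k P"
    and b: "b \<in> bilinear_maps k M N P"
  shows "tensor_lift k P b \<in> linear_maps k (tensor_product k M N) P"
proof -
  interpret M: module k M by fact
  let ?F = "free_module k (carrier M \<times> carrier N)" and ?K = "tensor_kernel k M N"
  interpret F: module k ?F
    by (rule free_module_module) (rule M.is_cring)
  have "(\<lambda>s. b (fst s) (snd s)) \<in> carrier M \<times> carrier N \<rightarrow> carrier P"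
    by (intro Pi_I linear_mapsD(1)[OF bilinear_mapsD(1)[OF b]]) (simp_all add: mem_Times_iff)
  note g = linear_mapsD[OF free_lift_linear[OF P this]]
  note coset = quotient_module_simps[OF F.module_axioms tensor_kernel_submodule[OF M N]]
  note lift = tensor_lift_coset[OF M N P b]
  show ?thesis
    unfolding tensor_product_def
  proof (rule linear_mapsI)
    fix s t r
    assume "s \<in> carrier (quotient_module ?F ?K)"
    then obtain \<phi> where \<phi>: "\<phi> \<in> carrier ?F" "s = ?K +>\<^bsub>?F\<^esub> \<phi>"
      using coset(4) by auto
    show "tensor_lift k P b s \<in> carrier P"
      using \<phi> by (simp add: lift g)
    show "tensor_lift k P b (r \<odot>\<^bsub>quotient_module ?F ?K\<^esub> s) = r \<odot>\<^bsub>P\<^esub> tensor_lift k P b s"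
      if "r \<in> carrier k"
      using \<phi> that by (simp add: coset(2) lift g)
    assume "t \<in> carrier (quotient_module ?F ?K)"
    then obtain \<psi> where "\<psi> \<in> carrier ?F" "t = ?K +>\<^bsub>?F\<^esub> \<psi>"
      using coset(4) by auto
    with \<phi> show "tensor_lift k P b (s \<oplus>\<^bsub>quotient_module ?F ?K\<^esub> t) =
        tensor_lift k P b s \<oplus>\<^bsub>P\<^esub> tensor_lift k P b t"
      by (simp add: coset(1) lift g)
  qed
qed

section \<open>Bilinear maps, tensor maps and associators\<close>

lemma bilinear_maps_swap:
  "b \<in> bilinear_maps k M N P \<Longrightarrow> (\<lambda>y x. b x y) \<in> bilinear_maps k N M P"
  by (auto simp: bilinear_maps_def)

lemma bilinear_maps_comp:
  assumes "b \<in> bilinear_maps k M N P" "f \<in> linear_maps k M' M" "g \<in> linear_maps k N' N"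
    "h \<in> linear_maps k P Q"
  shows "(\<lambda>x y. h (b (f x) (g y))) \<in> bilinear_maps k M' N' Q"
proof -
  have "(\<lambda>y. h (b (f x) (g y))) \<in> linear_maps k N' Q" if "x \<in> carrier M'" for x
    using linear_maps_comp[OF assms(4) linear_maps_comp[OF bilinear_mapsD(1)[OF assms(1)] assms(3)]]
      linear_mapsD(1)[OF assms(2) that] by (simp add: comp_def)
  moreover have "(\<lambda>x. h (b (f x) (g y))) \<in> linear_maps k M' Q" if "y \<in> carrier N'" for y
    using linear_maps_comp[OF assms(4) linear_maps_comp[OF bilinear_mapsD(2)[OF assms(1)] assms(2)]]
      linear_mapsD(1)[OF assms(3) that] by (simp add: comp_def)
  ultimately show ?thesis
    by (simp add: bilinear_maps_def)
qed

lemma linear_maps_add: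
  assumes "module k M" "module k N" "f \<in> linear_maps k M N" "g \<in> linear_maps k M N"
  shows "(\<lambda>x. f x \<oplus>\<^bsub>N\<^esub> g x) \<in> linear_maps k M N"
proof -
  interpret N: module k N by fact
  show ?thesis
    by (rule linear_mapsI)
      (simp_all add: linear_mapsD[OF assms(3)] linear_mapsD[OF assms(4)] N.smult_r_distr N.a_ac)
qed

lemma linear_maps_smult:
  assumes "module k M" "module k N" "f \<in> linear_maps k M N" "r \<in> carrier k"
  shows "(\<lambda>x. r \<odot>\<^bsub>N\<^esub> f x) \<in> linear_maps k M N"
proof -
  interpret N: module k N by fact
  show ?thesis
    using assms(4)
    by (intro linear_mapsI)
      (simp_all add: linear_mapsD[OF assms(3)] N.smult_r_distr N.smult_assoc1[symmetric] N.m_comm)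
qed

text \<open>
  The associators are nested lifts, and the outer lift needs a bilinear function. Linearity in \<open>z\<close>
  holds because, for fixed \<open>z\<close> and \<open>z'\<close>, both sides of the additivity law are linear in \<open>t\<close> and
  agree on pure tensors.
\<close>

lemma tensor_lift_bilinear:
  assumes M: "module k M" and N: "module k N" and P: "module k P" and Q: "module k Q"
    and b: "\<And>z. z \<in> carrier P \<Longrightarrow> (\<lambda>x y. b x y z) \<in> bilinear_maps k M N Q"
    and b': "\<And>x y. x \<in> carrier M \<Longrightarrow> y \<in> carrier N \<Longrightarrow> b x y \<in> linear_maps k P Q"
  shows "(\<lambda>t z. tensor_lift k Q (\<lambda>x y. b x y z) t) \<in> bilinear_maps k (tensor_product k M N) P Q"
proof -
  let ?T = "tensor_product k M N"
  let ?f = "\<lambda>z. tensor_lift k Q (\<lambda>x y. b x y z)"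
  interpret P: module k P by fact
  note T = tensor_product_module[OF M N]
  have lin: "?f z \<in> linear_maps k ?T Q" if "z \<in> carrier P" for z
    by (rule tensor_lift_linear[OF M N Q b[OF that]])
  have pure: "?f z (pure_tensor k M N x y) = b x y z"
    if "x \<in> carrier M" "y \<in> carrier N" "z \<in> carrier P" for x y z
    using tensor_lift_pure[OF M N Q b[OF that(3)] that(1,2)] .
  have "(\<lambda>z. ?f z t) \<in> linear_maps k P Q" if t: "t \<in> carrier ?T" for t
  proof (rule linear_mapsI)
    show "?f z t \<in> carrier Q" if "z \<in> carrier P" for z
      using linear_mapsD(1)[OF lin[OF that] t] .
    show "?f (z \<oplus>\<^bsub>P\<^esub> z') t = ?f z t \<oplus>\<^bsub>Q\<^esub> ?f z' t" if z: "z \<in> carrier P" "z' \<in> carrier P" for z z'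
      by (rule tensor_lift_eqI[OF M N Q linear_maps_add[OF T Q lin[OF z(1)] lin[OF z(2)]] _ t])
        (simp add: pure z linear_mapsD(2)[OF b'])
    show "?f (r \<odot>\<^bsub>P\<^esub> z) t = r \<odot>\<^bsub>Q\<^esub> ?f z t" if z: "r \<in> carrier k" "z \<in> carrier P" for r z
      by (rule tensor_lift_eqI[OF M N Q linear_maps_smult[OF T Q lin[OF z(2)] z(1)] _ t])
        (simp add: pure z linear_mapsD(3)[OF b'])
  qed
  then show ?thesis
    using lin by (simp add: bilinear_maps_def)
qed

lemma tensor_map_bilinear:
  assumes "module k M" "module k N" "f \<in> linear_maps k M' M" "g \<in> linear_maps k N' N"
  shows "(\<lambda>x y. pure_tensor k M N (f x) (g y)) \<in> bilinear_maps k M' N' (tensor_product k M N)"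
  using bilinear_maps_comp[OF pure_tensor_bilinear[OF assms(1,2)] assms(3,4) linear_maps_id]
  by simp

lemma tensor_map_linear:
  assumes "module k M'" "module k N'" "module k M" "module k N"
    "f \<in> linear_maps k M' M" "g \<in> linear_maps k N' N"
  shows "tensor_map k M N f g \<in> linear_maps k (tensor_product k M' N') (tensor_product k M N)"
  unfolding tensor_map_def
  by (intro tensor_lift_linear tensor_product_module tensor_map_bilinear assms)

lemma tensor_map_pure:
  assumes "module k M'" "module k N'" "module k M" "module k N"
    "f \<in> linear_maps k M' M" "g \<in> linear_maps k N' N" "x \<in> carrier M'" "y \<in> carrier N'"
  shows "tensor_map k M N f g (pure_tensor k M' N' x y) = pure_tensor k M N (f x) (g y)"
  unfolding tensor_map_def
  by (intro tensor_lift_pure tensor_product_module tensor_map_bilinear assms)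

lemma associator_bilinear:
  assumes M: "module k M" and N: "module k N" and P: "module k P"
  defines "T \<equiv> tensor_product k M (tensor_product k N P)"
  shows "z \<in> carrier P \<Longrightarrow>
      (\<lambda>x y. pure_tensor k M (tensor_product k N P) x (pure_tensor k N P y z))
        \<in> bilinear_maps k M N T" (is "_ \<Longrightarrow> ?inner")
    and "(\<lambda>t z. tensor_lift k T
        (\<lambda>x y. pure_tensor k M (tensor_product k N P) x (pure_tensor k N P y z)) t)
        \<in> bilinear_maps k (tensor_product k M N) P T"
proof -
  note NP = tensor_product_module[OF N P]
  show inner: "(\<lambda>x y. pure_tensor k M (tensor_product k N P) x (pure_tensor k N P y z))
      \<in> bilinear_maps k M N T" if "z \<in> carrier P" for z
    using bilinear_maps_comp[OF pure_tensor_bilinear[OF M NP] linear_maps_id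
        pure_tensor_linear_left[OF N P that] linear_maps_id] by (simp add: T_def)
  have "(\<lambda>z. pure_tensor k M (tensor_product k N P) x (pure_tensor k N P y z)) \<in> linear_maps k P T"
    if "x \<in> carrier M" "y \<in> carrier N" for x y
    using linear_maps_comp[OF pure_tensor_linear_right[OF M NP that(1)]
        pure_tensor_linear_right[OF N P that(2)]] by (simp add: T_def comp_def)
  then show "(\<lambda>t z. tensor_lift k T
        (\<lambda>x y. pure_tensor k M (tensor_product k N P) x (pure_tensor k N P y z)) t)
        \<in> bilinear_maps k (tensor_product k M N) P T"
    using inner unfolding T_def by (intro tensor_lift_bilinear tensor_product_module M N P)
qed

lemma associator_linear:
  assumes M: "module k M" and N: "module k N" and P: "module k P"
  shows "associator k M N P \<in> linear_maps k (tensor_product k (tensor_product k M N) P)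
    (tensor_product k M (tensor_product k N P))"
  unfolding associator_def Let_def
  by (intro tensor_lift_linear tensor_product_module associator_bilinear assms)

lemma associator_pure:
  assumes M: "module k M" and N: "module k N" and P: "module k P"
    and x: "x \<in> carrier M" and y: "y \<in> carrier N" and z: "z \<in> carrier P"
  shows "associator k M N P (pure_tensor k (tensor_product k M N) P (pure_tensor k M N x y) z) =
    pure_tensor k M (tensor_product k N P) x (pure_tensor k N P y z)"
proof -
  note MN = tensor_product_module[OF M N]
    and T = tensor_product_module[OF M tensor_product_module[OF N P]]
  show ?thesis
    unfolding associator_def Let_def
    using tensor_lift_pure[OF MN P T associator_bilinear(2)[OF M N P]
        pure_tensor_closed[OF M N x y] z]
      tensor_lift_pure[OF M N T associator_bilinear(1)[OF M N P z] x y]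
    by simp
qed

lemma associator_inv_bilinear:
  assumes M: "module k M" and N: "module k N" and P: "module k P"
  defines "T \<equiv> tensor_product k (tensor_product k M N) P"
  shows "x \<in> carrier M \<Longrightarrow>
      (\<lambda>y z. pure_tensor k (tensor_product k M N) P (pure_tensor k M N x y) z)
        \<in> bilinear_maps k N P T"
    and "(\<lambda>x t. tensor_lift k T
        (\<lambda>y z. pure_tensor k (tensor_product k M N) P (pure_tensor k M N x y) z) t)
        \<in> bilinear_maps k M (tensor_product k N P) T"
proof -
  note MN = tensor_product_module[OF M N]
  show inner: "(\<lambda>y z. pure_tensor k (tensor_product k M N) P (pure_tensor k M N x y) z)
      \<in> bilinear_maps k N P T" if "x \<in> carrier M" for x
    using bilinear_maps_comp[OF pure_tensor_bilinear[OF MN P] pure_tensor_linear_right[OF M N that]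
        linear_maps_id linear_maps_id] by (simp add: T_def)
  have "(\<lambda>x. pure_tensor k (tensor_product k M N) P (pure_tensor k M N x y) z) \<in> linear_maps k M T"
    if "y \<in> carrier N" "z \<in> carrier P" for y z
    using linear_maps_comp[OF pure_tensor_linear_left[OF MN P that(2)]
        pure_tensor_linear_left[OF M N that(1)]] by (simp add: T_def comp_def)
  then have "(\<lambda>t x. tensor_lift k T
        (\<lambda>y z. pure_tensor k (tensor_product k M N) P (pure_tensor k M N x y) z) t)
        \<in> bilinear_maps k (tensor_product k N P) M T"
    using inner unfolding T_def by (intro tensor_lift_bilinear tensor_product_module M N P)
  then show "(\<lambda>x t. tensor_lift k T
        (\<lambda>y z. pure_tensor k (tensor_product k M N) P (pure_tensor k M N x y) z) t)
        \<in> bilinear_maps k M (tensor_product k N P) T"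
    by (rule bilinear_maps_swap)
qed

lemma associator_inv_linear:
  assumes M: "module k M" and N: "module k N" and P: "module k P"
  shows "associator_inv k M N P \<in> linear_maps k (tensor_product k M (tensor_product k N P))
    (tensor_product k (tensor_product k M N) P)"
  unfolding associator_inv_def Let_def
  by (intro tensor_lift_linear tensor_product_module associator_inv_bilinear assms)

lemma associator_inv_pure:
  assumes M: "module k M" and N: "module k N" and P: "module k P"
    and x: "x \<in> carrier M" and y: "y \<in> carrier N" and z: "z \<in> carrier P"
  shows "associator_inv k M N P (pure_tensor k M (tensor_product k N P) x (pure_tensor k N P y z)) =
    pure_tensor k (tensor_product k M N) P (pure_tensor k M N x y) z"
proof -
  note NP = tensor_product_module[OF N P]
    and T = tensor_product_module[OF tensor_product_module[OF M N] P]
  show ?thesis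
    unfolding associator_inv_def Let_def
    using tensor_lift_pure[OF M NP T associator_inv_bilinear(2)[OF M N P]
        x pure_tensor_closed[OF N P y z]]
      tensor_lift_pure[OF N P T associator_inv_bilinear(1)[OF M N P x] y z]
    by simp
qed

lemma linear_maps_tensor3_ext:
  assumes M: "module k M" and N: "module k N" and P: "module k P" and Q: "module k Q"
    and f: "f \<in> linear_maps k (tensor_product k M (tensor_product k N P)) Q"
    and g: "g \<in> linear_maps k (tensor_product k M (tensor_product k N P)) Q"
    and eq: "\<And>x y z. x \<in> carrier M \<Longrightarrow> y \<in> carrier N \<Longrightarrow> z \<in> carrier P \<Longrightarrow>
      f (pure_tensor k M (tensor_product k N P) x (pure_tensor k N P y z)) =
      g (pure_tensor k M (tensor_product k N P) x (pure_tensor k N P y z))"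
    and t: "t \<in> carrier (tensor_product k M (tensor_product k N P))"
  shows "f t = g t"
proof -
  note NP = tensor_product_module[OF N P]
  have "f (pure_tensor k M (tensor_product k N P) x u) = g (pure_tensor k M (tensor_product k N P) x u)"
    if "x \<in> carrier M" "u \<in> carrier (tensor_product k N P)" for x u
    using linear_maps_tensor_ext[OF N P Q linear_maps_comp[OF f pure_tensor_linear_right[OF M NP that(1)]]
        linear_maps_comp[OF g pure_tensor_linear_right[OF M NP that(1)]]] eq that by simp
  then show ?thesis
    by (rule linear_maps_tensor_ext[OF M NP Q f g _ t])
qed

lemma linear_maps_tensor3_ext':
  assumes M: "module k M" and N: "module k N" and P: "module k P" and Q: "module k Q"
    and f: "f \<in> linear_maps k (tensor_product k (tensor_product k M N) P) Q"
    and g: "g \<in> linear_maps k (tensor_product k (tensor_product k M N) P) Q"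
    and eq: "\<And>x y z. x \<in> carrier M \<Longrightarrow> y \<in> carrier N \<Longrightarrow> z \<in> carrier P \<Longrightarrow>
      f (pure_tensor k (tensor_product k M N) P (pure_tensor k M N x y) z) =
      g (pure_tensor k (tensor_product k M N) P (pure_tensor k M N x y) z)"
    and t: "t \<in> carrier (tensor_product k (tensor_product k M N) P)"
  shows "f t = g t"
proof -
  note MN = tensor_product_module[OF M N]
  have "f (pure_tensor k (tensor_product k M N) P u z) = g (pure_tensor k (tensor_product k M N) P u z)"
    if "u \<in> carrier (tensor_product k M N)" "z \<in> carrier P" for u z
    using linear_maps_tensor_ext[OF M N Q linear_maps_comp[OF f pure_tensor_linear_left[OF MN P that(2)]]
        linear_maps_comp[OF g pure_tensor_linear_left[OF MN P that(2)]]] eq that by simp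
  then show ?thesis
    by (rule linear_maps_tensor_ext[OF MN P Q f g _ t])
qed

lemma tensor_lift3_eqI:
  assumes M: "module k M" and N: "module k N" and P: "module k P" and Q: "module k Q"
    and g: "g \<in> linear_maps k (tensor_product k M (tensor_product k N P)) Q"
    and b: "\<And>x y z. x \<in> carrier M \<Longrightarrow> y \<in> carrier N \<Longrightarrow> z \<in> carrier P \<Longrightarrow>
      b x y z = g (pure_tensor3 k M N P x y z)"
    and t: "t \<in> carrier (tensor_product k M (tensor_product k N P))"
  shows "tensor_lift3 k Q b t = g t"
proof -
  note NP = tensor_product_module[OF N P]
  have "tensor_lift k Q (b x) u = g (pure_tensor k M (tensor_product k N P) x u)"
    if "x \<in> carrier M" "u \<in> carrier (tensor_product k N P)" for x u
    using tensor_lift_eqI[OF N P Q linear_maps_comp[OF g pure_tensor_linear_right[OF M NP that(1)]] _ that(2)]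
      b that(1) by (simp add: pure_tensor3_def)
  then show ?thesis
    unfolding tensor_lift3_def by (rule tensor_lift_eqI[OF M NP Q g _ t])
qed

section \<open>Linear functionals\<close>

text \<open>
  A subspace \<open>H\<close> that is maximal among those that avoid \<open>m\<close> is a complement of the line through
  \<open>m\<close>: if \<open>x \<notin> H\<close>, then \<open>m\<close> lies in the span of \<open>H\<close> and \<open>x\<close>, and its coefficient at \<open>x\<close> is
  invertible. The functional reads off the coordinate along \<open>m\<close>. Its values lie in \<open>k\<close>, which as a
  ring record is not a module record, so the conclusion lists the linearity laws one by one.
\<close>

lemma linear_functional_exists:
  assumes k: "field k" and M: "module k M" and m: "m \<in> carrier M" "m \<noteq> \<zero>\<^bsub>M\<^esub>"
  obtains f where "f \<in> carrier M \<rightarrow> carrier k"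
    and "\<And>x y. x \<in> carrier M \<Longrightarrow> y \<in> carrier M \<Longrightarrow> f (x \<oplus>\<^bsub>M\<^esub> y) = f x \<oplus>\<^bsub>k\<^esub> f y"
    and "\<And>r x. r \<in> carrier k \<Longrightarrow> x \<in> carrier M \<Longrightarrow> f (r \<odot>\<^bsub>M\<^esub> x) = r \<otimes>\<^bsub>k\<^esub> f x"
    and "f m = \<one>\<^bsub>k\<^esub>"
proof -
  interpret k: field k by fact
  interpret M: module k M by fact
  have neg_zero: "\<ominus>\<^bsub>M\<^esub> \<zero>\<^bsub>M\<^esub> = \<zero>\<^bsub>M\<^esub>"
    using M.minus_equality[of "\<zero>\<^bsub>M\<^esub>" "\<zero>\<^bsub>M\<^esub>"] by simp
  let ?\<H> = "{H. submodule H k M \<and> m \<notin> H}"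
  have sub_diff: "x \<ominus>\<^bsub>M\<^esub> y \<in> H" if "submodule H k M" "x \<in> H" "y \<in> H" for H x y
    using M.submoduleE[OF that(1)] that(2,3) by (simp add: a_minus_def)
  have "\<exists>H\<in>?\<H>. \<forall>X\<in>?\<H>. H \<subseteq> X \<longrightarrow> X = H"
  proof (rule subset_Zorn_nonempty)
    have "submodule {\<zero>\<^bsub>M\<^esub>} k M"
      by (rule M.submoduleI) auto
    then show "?\<H> \<noteq> {}"
      using m by auto
  next
    fix \<C>
    assume "\<C> \<noteq> {}" and chain: "subset.chain ?\<H> \<C>"
    then obtain H0 where H0: "H0 \<in> \<C>" by blast
    have sub: "submodule H k M" "m \<notin> H" if "H \<in> \<C>" for H
      using chain that by (auto simp: subset.chain_def)
    have "submodule (\<Union>\<C>) k M"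
    proof (rule M.submoduleI)
      show "\<Union>\<C> \<subseteq> carrier M"
        using sub M.submoduleE(1) by blast
      show "\<zero>\<^bsub>M\<^esub> \<in> \<Union>\<C>"
        using H0 subgroup.one_closed[OF submodule.axioms(1)[OF sub(1)[OF H0]]] by auto
      show "\<ominus>\<^bsub>M\<^esub> x \<in> \<Union>\<C>" if "x \<in> \<Union>\<C>" for x
        using that sub M.submoduleE(3) by blast
      show "r \<odot>\<^bsub>M\<^esub> x \<in> \<Union>\<C>" if "r \<in> carrier k" "x \<in> \<Union>\<C>" for r x
        using that sub M.submoduleE(4) by blast
      show "x \<oplus>\<^bsub>M\<^esub> y \<in> \<Union>\<C>" if xy: "x \<in> \<Union>\<C>" "y \<in> \<Union>\<C>" for x y
      proof -
        obtain X Y where XY: "X \<in> \<C>" "Y \<in> \<C>" "x \<in> X" "y \<in> Y"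
          using xy by blast
        then have "X \<subseteq> Y \<or> Y \<subseteq> X"
          using chain by (auto simp: subset.chain_def)
        then obtain Z where "Z \<in> \<C>" "x \<in> Z" "y \<in> Z"
          using XY by blast
        then show ?thesis
          using sub M.submoduleE(5) by blast
      qed
    qed
    then show "\<Union>\<C> \<in> ?\<H>"
      using sub by blast
  qed
  then obtain H where H: "submodule H k M" "m \<notin> H"
    and max: "\<And>X. submodule X k M \<Longrightarrow> m \<notin> X \<Longrightarrow> H \<subseteq> X \<Longrightarrow> X = H"
    by blast
  note H_closed = M.submoduleE[OF H(1)]
  have H_carrier: "h \<in> carrier M" if "h \<in> H" for h
    using that H_closed(1) by blast
  have H_zero: "\<zero>\<^bsub>M\<^esub> \<in> H"
    using subgroup.one_closed[OF submodule.axioms(1)[OF H(1)]] by simp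
  \<comment> \<open>The line through a vector outside \<open>H\<close> meets \<open>H\<close> only in zero; this makes coordinates unique.\<close>
  have coeff_zero: "r = \<zero>\<^bsub>k\<^esub>" if r: "r \<in> carrier k" and rx: "r \<odot>\<^bsub>M\<^esub> x \<in> H"
    and x: "x \<in> carrier M" "x \<notin> H" for r x
  proof (rule ccontr)
    assume "r \<noteq> \<zero>\<^bsub>k\<^esub>"
    then have "inv\<^bsub>k\<^esub> r \<in> carrier k" "inv\<^bsub>k\<^esub> r \<otimes>\<^bsub>k\<^esub> r = \<one>\<^bsub>k\<^esub>"
      using r k.field_Units by auto
    then have "inv\<^bsub>k\<^esub> r \<odot>\<^bsub>M\<^esub> (r \<odot>\<^bsub>M\<^esub> x) = x"
      using r x by (simp add: M.smult_assoc1[symmetric])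
    then show False
      using H_closed(4)[OF \<open>inv\<^bsub>k\<^esub> r \<in> carrier k\<close> rx] x by simp
  qed
  have decompose: "\<exists>r\<in>carrier k. x \<ominus>\<^bsub>M\<^esub> r \<odot>\<^bsub>M\<^esub> m \<in> H" if x: "x \<in> carrier M" for x
  proof (cases "x \<in> H")
    case True
    then show ?thesis
      using x m by (intro bexI[of _ "\<zero>\<^bsub>k\<^esub>"]) (auto simp: a_minus_def neg_zero)
  next
    case False
    \<comment> \<open>If \<open>x \<notin> H\<close>, then \<open>H\<close> and \<open>x\<close> span a larger subspace, which must contain \<open>m\<close>.\<close>
    let ?X = "{h \<oplus>\<^bsub>M\<^esub> r \<odot>\<^bsub>M\<^esub> x | h r. h \<in> H \<and> r \<in> carrier k}"
    have "submodule ?X k M"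
    proof (rule M.submoduleI)
      show "?X \<subseteq> carrier M"
        using x H_carrier by auto
      show "\<zero>\<^bsub>M\<^esub> \<in> ?X"
        using x H_zero by (auto intro!: exI[of _ "\<zero>\<^bsub>M\<^esub>"] exI[of _ "\<zero>\<^bsub>k\<^esub>"])
    next
      fix y
      assume "y \<in> ?X"
      then obtain h r where y: "y = h \<oplus>\<^bsub>M\<^esub> r \<odot>\<^bsub>M\<^esub> x" "h \<in> H" "r \<in> carrier k"
        by blast
      have "\<ominus>\<^bsub>M\<^esub> y = \<ominus>\<^bsub>M\<^esub> h \<oplus>\<^bsub>M\<^esub> (\<ominus>\<^bsub>k\<^esub> r) \<odot>\<^bsub>M\<^esub> x"
        using x y H_carrier by (simp add: M.minus_add M.smult_l_minus)
      then show "\<ominus>\<^bsub>M\<^esub> y \<in> ?X"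
        using y H_closed(3) k.a_inv_closed by blast
      show "s \<odot>\<^bsub>M\<^esub> y \<in> ?X" if s: "s \<in> carrier k" for s
      proof -
        have "s \<odot>\<^bsub>M\<^esub> y = s \<odot>\<^bsub>M\<^esub> h \<oplus>\<^bsub>M\<^esub> (s \<otimes>\<^bsub>k\<^esub> r) \<odot>\<^bsub>M\<^esub> x"
          using x y s H_carrier by (simp add: M.smult_r_distr M.smult_assoc1)
        then show ?thesis
          using y s H_closed(4) k.m_closed by blast
      qed
      fix y'
      assume "y' \<in> ?X"
      then obtain h' r' where y': "y' = h' \<oplus>\<^bsub>M\<^esub> r' \<odot>\<^bsub>M\<^esub> x" "h' \<in> H" "r' \<in> carrier k"
        by blast
      have "y \<oplus>\<^bsub>M\<^esub> y' = (h \<oplus>\<^bsub>M\<^esub> h') \<oplus>\<^bsub>M\<^esub> (r \<oplus>\<^bsub>k\<^esub> r') \<odot>\<^bsub>M\<^esub> x"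
        using x y y' H_carrier by (simp add: M.smult_l_distr M.a_ac)
      then show "y \<oplus>\<^bsub>M\<^esub> y' \<in> ?X"
        using y y' H_closed(5) k.a_closed by blast
    qed
    moreover have "H \<subseteq> ?X"
    proof
      fix h assume h: "h \<in> H"
      then have "h = h \<oplus>\<^bsub>M\<^esub> \<zero>\<^bsub>k\<^esub> \<odot>\<^bsub>M\<^esub> x"
        using x H_carrier by simp
      with h show "h \<in> ?X"
        using k.zero_closed by blast
    qed
    moreover have "x = \<zero>\<^bsub>M\<^esub> \<oplus>\<^bsub>M\<^esub> \<one>\<^bsub>k\<^esub> \<odot>\<^bsub>M\<^esub> x"
      using x by simp
    then have "x \<in> ?X"
      using H_zero k.one_closed by blast
    ultimately have "m \<in> ?X"
      using max[of ?X] False by blast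
    then obtain h r where m_eq: "m = h \<oplus>\<^bsub>M\<^esub> r \<odot>\<^bsub>M\<^esub> x" and h: "h \<in> H" and r: "r \<in> carrier k"
      by blast
    have "r \<noteq> \<zero>\<^bsub>k\<^esub>"
      using m_eq h H(2) x H_carrier by auto
    then have inv: "inv\<^bsub>k\<^esub> r \<in> carrier k" "inv\<^bsub>k\<^esub> r \<otimes>\<^bsub>k\<^esub> r = \<one>\<^bsub>k\<^esub>"
      using r k.field_Units by auto
    have "inv\<^bsub>k\<^esub> r \<odot>\<^bsub>M\<^esub> m = inv\<^bsub>k\<^esub> r \<odot>\<^bsub>M\<^esub> h \<oplus>\<^bsub>M\<^esub> x"
      using inv r x h H_carrier by (simp add: m_eq M.smult_r_distr M.smult_assoc1[symmetric])
    then have "x \<ominus>\<^bsub>M\<^esub> inv\<^bsub>k\<^esub> r \<odot>\<^bsub>M\<^esub> m = \<ominus>\<^bsub>M\<^esub> (inv\<^bsub>k\<^esub> r \<odot>\<^bsub>M\<^esub> h)"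
      using inv x h H_carrier by (simp add: a_minus_def M.minus_add M.a_ac M.r_neg M.r_neg2)
    then show ?thesis
      using inv(1) H_closed(3)[OF H_closed(4)[OF inv(1) h]]
      by (intro bexI[of _ "inv\<^bsub>k\<^esub> r"]) simp_all
  qed
  define f where "f x = (SOME r. r \<in> carrier k \<and> x \<ominus>\<^bsub>M\<^esub> r \<odot>\<^bsub>M\<^esub> m \<in> H)" for x
  have f: "f x \<in> carrier k" "x \<ominus>\<^bsub>M\<^esub> f x \<odot>\<^bsub>M\<^esub> m \<in> H" if "x \<in> carrier M" for x
    using someI_ex[OF decompose[OF that, unfolded Bex_def]] by (auto simp: f_def)
  have f_eqI: "f x = r" if x: "x \<in> carrier M" and r: "r \<in> carrier k" "x \<ominus>\<^bsub>M\<^esub> r \<odot>\<^bsub>M\<^esub> m \<in> H" for x r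
  proof -
    have "(x \<ominus>\<^bsub>M\<^esub> f x \<odot>\<^bsub>M\<^esub> m) \<ominus>\<^bsub>M\<^esub> (x \<ominus>\<^bsub>M\<^esub> r \<odot>\<^bsub>M\<^esub> m) = (r \<ominus>\<^bsub>k\<^esub> f x) \<odot>\<^bsub>M\<^esub> m"
      using x r(1) f(1)[OF x] m
      by (simp add: a_minus_def M.smult_l_distr M.smult_l_minus M.minus_add M.a_ac M.r_neg2 M.r_neg1)
    then have "(r \<ominus>\<^bsub>k\<^esub> f x) \<odot>\<^bsub>M\<^esub> m \<in> H"
      using sub_diff[OF H(1) f(2)[OF x] r(2)] by simp
    then have "r \<ominus>\<^bsub>k\<^esub> f x = \<zero>\<^bsub>k\<^esub>"
      using coeff_zero[OF _ _ m(1) H(2)] r(1) f(1)[OF x] k.minus_closed by blast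
    then show ?thesis
      using r(1) f(1)[OF x] k.minus_equality[of r "\<ominus>\<^bsub>k\<^esub> f x"] by (simp add: a_minus_def)
  qed
  show ?thesis
  proof (rule that)
    show "f \<in> carrier M \<rightarrow> carrier k"
      using f(1) by blast
    show "f m = \<one>\<^bsub>k\<^esub>"
      using m(1) H_zero by (intro f_eqI) (auto simp: a_minus_def M.r_neg)
    show "f (x \<oplus>\<^bsub>M\<^esub> y) = f x \<oplus>\<^bsub>k\<^esub> f y" if x: "x \<in> carrier M" and y: "y \<in> carrier M" for x y
    proof (rule f_eqI)
      have "(x \<oplus>\<^bsub>M\<^esub> y) \<ominus>\<^bsub>M\<^esub> (f x \<oplus>\<^bsub>k\<^esub> f y) \<odot>\<^bsub>M\<^esub> m =
          (x \<ominus>\<^bsub>M\<^esub> f x \<odot>\<^bsub>M\<^esub> m) \<oplus>\<^bsub>M\<^esub> (y \<ominus>\<^bsub>M\<^esub> f y \<odot>\<^bsub>M\<^esub> m)"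
        using x y f(1)[OF x] f(1)[OF y] m
        by (simp add: a_minus_def M.smult_l_distr M.minus_add M.a_ac)
      then show "(x \<oplus>\<^bsub>M\<^esub> y) \<ominus>\<^bsub>M\<^esub> (f x \<oplus>\<^bsub>k\<^esub> f y) \<odot>\<^bsub>M\<^esub> m \<in> H"
        using H_closed(5)[OF f(2)[OF x] f(2)[OF y]] by simp
    qed (use x y f(1) in auto)
    show "f (r \<odot>\<^bsub>M\<^esub> x) = r \<otimes>\<^bsub>k\<^esub> f x" if r: "r \<in> carrier k" and x: "x \<in> carrier M" for r x
    proof (rule f_eqI)
      have "r \<odot>\<^bsub>M\<^esub> x \<ominus>\<^bsub>M\<^esub> (r \<otimes>\<^bsub>k\<^esub> f x) \<odot>\<^bsub>M\<^esub> m = r \<odot>\<^bsub>M\<^esub> (x \<ominus>\<^bsub>M\<^esub> f x \<odot>\<^bsub>M\<^esub> m)"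
        using r x f(1)[OF x] m
        by (simp add: a_minus_def M.smult_r_distr M.smult_assoc1 M.smult_r_minus)
      then show "r \<odot>\<^bsub>M\<^esub> x \<ominus>\<^bsub>M\<^esub> (r \<otimes>\<^bsub>k\<^esub> f x) \<odot>\<^bsub>M\<^esub> m \<in> H"
        using H_closed(4)[OF r f(2)[OF x]] by simp
    qed (use r x f(1) in auto)
  qed
qed

text \<open>
  Applying a functional with value one at \<open>m\<close> to the first tensor factor retracts \<open>M \<otimes> N\<close> onto
  \<open>m \<otimes> N\<close>. These retractions show that \<open>A \<otimes> V\<close>, \<open>V \<otimes> C\<close> and \<open>A \<otimes> C\<close> embed into
  \<open>A \<otimes> V \<otimes> C\<close>.
\<close>

lemma contraction_left_exists:
  assumes k: "field k" and M: "module k M" and N: "module k N"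
    and m: "m \<in> carrier M" "m \<noteq> \<zero>\<^bsub>M\<^esub>"
  obtains h where "h \<in> linear_maps k (tensor_product k M N) N"
    and "\<And>y. y \<in> carrier N \<Longrightarrow> h (pure_tensor k M N m y) = y"
proof -
  interpret N: module k N by fact
  obtain f where f: "f \<in> carrier M \<rightarrow> carrier k" "f m = \<one>\<^bsub>k\<^esub>"
    "\<And>x y. x \<in> carrier M \<Longrightarrow> y \<in> carrier M \<Longrightarrow> f (x \<oplus>\<^bsub>M\<^esub> y) = f x \<oplus>\<^bsub>k\<^esub> f y"
    "\<And>r x. r \<in> carrier k \<Longrightarrow> x \<in> carrier M \<Longrightarrow> f (r \<odot>\<^bsub>M\<^esub> x) = r \<otimes>\<^bsub>k\<^esub> f x"
    using linear_functional_exists[OF k M m] by metis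
  have val: "f x \<in> carrier k" if "x \<in> carrier M" for x
    using f(1) that by blast
  have b: "(\<lambda>x y. f x \<odot>\<^bsub>N\<^esub> y) \<in> bilinear_maps k M N N"
    unfolding bilinear_maps_def
    by (auto intro!: linear_mapsI
        simp: val f(3,4) N.smult_l_distr N.smult_r_distr N.smult_assoc1[symmetric] N.R.m_comm)
  show ?thesis
    using tensor_lift_pure[OF M N N b m(1)] f(2)
    by (intro that[OF tensor_lift_linear[OF M N N b]]) simp
qed

lemma contraction_right_exists:
  assumes k: "field k" and M: "module k M" and N: "module k N"
    and n: "n \<in> carrier N" "n \<noteq> \<zero>\<^bsub>N\<^esub>"
  obtains h where "h \<in> linear_maps k (tensor_product k M N) M"
    and "\<And>x. x \<in> carrier M \<Longrightarrow> h (pure_tensor k M N x n) = x"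
proof -
  obtain h where h: "h \<in> linear_maps k (tensor_product k N M) M"
    "\<And>x. x \<in> carrier M \<Longrightarrow> h (pure_tensor k N M n x) = x"
    using contraction_left_exists[OF k N M n] by metis
  have b: "(\<lambda>x y. h (pure_tensor k N M y x)) \<in> bilinear_maps k M N M"
    using bilinear_maps_swap[OF bilinear_maps_comp[OF pure_tensor_bilinear[OF N M]
          linear_maps_id linear_maps_id h(1)]] by simp
  show ?thesis
    using tensor_lift_pure[OF M N M b _ n(1)] h(2)
    by (intro that[OF tensor_lift_linear[OF M N M b]]) simp
qed


section \<open>Maps into an algebra\<close>

lemma unital_algebra_module: "unital_algebra k A \<Longrightarrow> module k A"
  by (simp add: unital_algebra_def)

lemma mult_bilinear:
  assumes "unital_algebra k W"
  shows "mult W \<in> bilinear_maps k W W W"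
proof -
  interpret W: unital_algebra k W by fact
  show ?thesis
    unfolding bilinear_maps_def
    by (auto intro!: linear_mapsI
        simp: W.A.r_distr W.A.l_distr W.smult_mult_left W.smult_mult_right)
qed

text \<open>
  With this operation a composite of linear maps between iterated tensor products
  can be described by the product in \<open>W\<close> that it computes, without mentioning elements.
\<close>

definition mult_map ::
    "('k, 'r) ring_scheme \<Rightarrow> ('k, 'w, 'x) module_scheme \<Rightarrow> ('m \<Rightarrow> 'w) \<Rightarrow> ('n \<Rightarrow> 'w) \<Rightarrow>
      ('m \<times> 'n \<Rightarrow> 'k) set \<Rightarrow> 'w"
  where "mult_map k W f g = tensor_lift k W (\<lambda>x y. f x \<otimes>\<^bsub>W\<^esub> g y)"

lemma mult_map_bilinear:
  assumes "unital_algebra k W" "f \<in> linear_maps k M W" "g \<in> linear_maps k N W"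
  shows "(\<lambda>x y. f x \<otimes>\<^bsub>W\<^esub> g y) \<in> bilinear_maps k M N W"
  using bilinear_maps_comp[OF mult_bilinear[OF assms(1)] assms(2,3) linear_maps_id] by simp

lemma mult_map_linear:
  assumes "unital_algebra k W" "module k M" "module k N"
    "f \<in> linear_maps k M W" "g \<in> linear_maps k N W"
  shows "mult_map k W f g \<in> linear_maps k (tensor_product k M N) W"
  unfolding mult_map_def
  by (intro tensor_lift_linear mult_map_bilinear unital_algebra_module assms)

lemma mult_map_pure:
  assumes "unital_algebra k W" "module k M" "module k N"
    "f \<in> linear_maps k M W" "g \<in> linear_maps k N W" "x \<in> carrier M" "y \<in> carrier N"
  shows "mult_map k W f g (pure_tensor k M N x y) = f x \<otimes>\<^bsub>W\<^esub> g y"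
  unfolding mult_map_def
  by (intro tensor_lift_pure mult_map_bilinear unital_algebra_module assms)

text \<open>
  A commuting triangle over \<open>W\<close>. The modules and the linearity of all three maps are part of the
  notion, so that the rules below have no side
  conditions at intermediate stages and a long composite is treated by applying them repeatedly:
  \<open>p\<close> and \<open>f\<close> determine the rule, and \<open>f'\<close> is computed on the way.
\<close>

definition factors ::
    "('k, 'r) ring_scheme \<Rightarrow> ('k, 'w, 'x) module_scheme \<Rightarrow> ('k, 'm, 'y) module_scheme \<Rightarrow>
      ('k, 'n, 'z) module_scheme \<Rightarrow> ('m \<Rightarrow> 'n) \<Rightarrow> ('n \<Rightarrow> 'w) \<Rightarrow> ('m \<Rightarrow> 'w) \<Rightarrow> bool"
  where "factors k W M N p f f' \<longleftrightarrow> module k M \<and> module k N \<and>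
    p \<in> linear_maps k M N \<and> f \<in> linear_maps k N W \<and> f' \<in> linear_maps k M W \<and>
    (\<forall>x\<in>carrier M. f (p x) = f' x)"

lemma factorsD:
  assumes "factors k W M N p f f'"
  shows "module k M" "module k N" "p \<in> linear_maps k M N" "f \<in> linear_maps k N W"
    "f' \<in> linear_maps k M W" "\<And>x. x \<in> carrier M \<Longrightarrow> f (p x) = f' x"
  using assms by (auto simp: factors_def)

lemma factors_comp:
  assumes "factors k W M N p f f'" "factors k W L M q f' f''"
  shows "factors k W L N (p \<circ> q) f f''"
  using assms linear_maps_comp unfolding factors_def
  by (auto simp: linear_mapsD(1))

lemma factors_id:
  assumes "module k M" "f \<in> linear_maps k M W"
  shows "factors k W M M id f f"
  using assms by (simp add: factors_def linear_maps_id)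

lemma factors_tensor_map:
  assumes W: "unital_algebra k W" and p: "factors k W M M' p f f'" and q: "factors k W N N' q g g'"
  shows "factors k W (tensor_product k M N) (tensor_product k M' N') (tensor_map k M' N' p q)
    (mult_map k W f g) (mult_map k W f' g')"
proof -
  note p = factorsD[OF p] and q = factorsD[OF q]
  note map = tensor_map_linear[OF p(1) q(1) p(2) q(2) p(3) q(3)]
    and lin = mult_map_linear[OF W p(2) q(2) p(4) q(4)]
    and lin' = mult_map_linear[OF W p(1) q(1) p(5) q(5)]
  have "(mult_map k W f g \<circ> tensor_map k M' N' p q) t = mult_map k W f' g' t"
    if t: "t \<in> carrier (tensor_product k M N)" for t
  proof (rule linear_maps_tensor_ext[OF p(1) q(1) unital_algebra_module[OF W]
        linear_maps_comp[OF lin map] lin' _ t])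
    show "(mult_map k W f g \<circ> tensor_map k M' N' p q) (pure_tensor k M N x y) =
        mult_map k W f' g' (pure_tensor k M N x y)" if "x \<in> carrier M" "y \<in> carrier N" for x y
      using that by (simp add: tensor_map_pure[OF p(1) q(1) p(2) q(2) p(3) q(3)]
          mult_map_pure[OF W p(2) q(2) p(4) q(4)] mult_map_pure[OF W p(1) q(1) p(5) q(5)]
          linear_mapsD(1)[OF p(3)] linear_mapsD(1)[OF q(3)] p(6) q(6))
  qed
  then show ?thesis
    by (simp add: factors_def map lin lin' tensor_product_module p(1,2) q(1,2))
qed

text \<open>
  This is the associative law of \<open>W\<close>.
\<close>

lemma factors_associator:
  assumes W: "unital_algebra k W" and M: "module k M" and N: "module k N" and P: "module k P"
    and f: "f \<in> linear_maps k M W" and g: "g \<in> linear_maps k N W" and h: "h \<in> linear_maps k P W"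
  shows "factors k W (tensor_product k (tensor_product k M N) P)
    (tensor_product k M (tensor_product k N P)) (associator k M N P)
    (mult_map k W f (mult_map k W g h)) (mult_map k W (mult_map k W f g) h)"
proof -
  interpret W: unital_algebra k W by fact
  note MN = tensor_product_module[OF M N] and NP = tensor_product_module[OF N P]
  note fg = mult_map_linear[OF W M N f g] and gh = mult_map_linear[OF W N P g h]
  note l = mult_map_linear[OF W MN P fg h] and r = mult_map_linear[OF W M NP f gh]
  note assoc = associator_linear[OF M N P]
  have "(mult_map k W f (mult_map k W g h) \<circ> associator k M N P) t =
      mult_map k W (mult_map k W f g) h t"
    if t: "t \<in> carrier (tensor_product k (tensor_product k M N) P)" for t
    by (rule linear_maps_tensor3_ext'[OF M N P W.module_axioms linear_maps_comp[OF r assoc] l _ t])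
      (simp add: associator_pure[OF M N P] pure_tensor_closed MN NP M N P
        mult_map_pure[OF W] f g h fg gh W.A.m_assoc linear_mapsD(1)[OF f] linear_mapsD(1)[OF g]
        linear_mapsD(1)[OF h])
  then show ?thesis
    by (simp add: factors_def assoc l r tensor_product_module M N P)
qed

lemma factors_associator_inv:
  assumes W: "unital_algebra k W" and M: "module k M" and N: "module k N" and P: "module k P"
    and f: "f \<in> linear_maps k M W" and g: "g \<in> linear_maps k N W" and h: "h \<in> linear_maps k P W"
  shows "factors k W (tensor_product k M (tensor_product k N P))
    (tensor_product k (tensor_product k M N) P) (associator_inv k M N P)
    (mult_map k W (mult_map k W f g) h) (mult_map k W f (mult_map k W g h))"
proof -
  interpret W: unital_algebra k W by fact
  note MN = tensor_product_module[OF M N] and NP = tensor_product_module[OF N P]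
  note fg = mult_map_linear[OF W M N f g] and gh = mult_map_linear[OF W N P g h]
  note l = mult_map_linear[OF W MN P fg h] and r = mult_map_linear[OF W M NP f gh]
  note assoc = associator_inv_linear[OF M N P]
  have "(mult_map k W (mult_map k W f g) h \<circ> associator_inv k M N P) t =
      mult_map k W f (mult_map k W g h) t"
    if t: "t \<in> carrier (tensor_product k M (tensor_product k N P))" for t
    by (rule linear_maps_tensor3_ext[OF M N P W.module_axioms linear_maps_comp[OF l assoc] r _ t])
      (simp add: associator_inv_pure[OF M N P] pure_tensor_closed MN NP M N P
        mult_map_pure[OF W] f g h fg gh W.A.m_assoc linear_mapsD(1)[OF f] linear_mapsD(1)[OF g]
        linear_mapsD(1)[OF h])
  then show ?thesis
    by (simp add: factors_def assoc l r tensor_product_module M N P)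
qed

text \<open>
  This is the multiplicativity of \<open>j\<close>.
\<close>

lemma factors_mult:
  assumes W: "unital_algebra k W" and A: "unital_algebra k A" and j: "j \<in> algebra_maps k A W"
  shows "factors k W (tensor_product k A A) A (tensor_lift k A (mult A)) j (mult_map k W j j)"
proof -
  interpret A: unital_algebra k A by fact
  note A' = A.module_axioms and W' = unital_algebra_module[OF W]
  have lin: "j \<in> linear_maps k A W" and hom: "j \<in> ring_hom A W"
    using j by (auto simp: algebra_maps_def)
  note mult = tensor_lift_linear[OF A' A' A' mult_bilinear[OF A]]
    and lin2 = mult_map_linear[OF W A' A' lin lin]
  have "(j \<circ> tensor_lift k A (mult A)) t = mult_map k W j j t"
    if t: "t \<in> carrier (tensor_product k A A)" for t
    by (rule linear_maps_tensor_ext[OF A' A' W' linear_maps_comp[OF lin mult] lin2 _ t])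
      (simp add: tensor_lift_pure[OF A' A' A' mult_bilinear[OF A]] mult_map_pure[OF W A' A' lin lin]
        ring_hom_mult[OF hom])
  then show ?thesis
    by (simp add: factors_def mult lin lin2 tensor_product_module A')
qed

text \<open>
  Both sides of an identity compute the same product in \<open>W\<close>, and the target embeds into \<open>W\<close>.
\<close>

lemma factors_unique:
  assumes "factors k W M N p f f'" "factors k W M N q f f'" "inj_on f (carrier N)" "x \<in> carrier M"
  shows "p x = q x"
  using assms by (metis factorsD(3,6) inj_onD linear_mapsD(1))

text \<open>
  If the values of \<open>g\<close> can be rewritten in the order of factors that \<open>i\<close> describes, a retraction of
  \<open>i\<close> turns \<open>g\<close> into a linear map that performs the rewriting. No choices of rewritings are
  involved, which is why the result is linear.
\<close>

lemma factors_retraction: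
  assumes M: "module k M" and N: "module k N" and P: "module k P" and W: "module k W"
    and i: "i \<in> linear_maps k P W" and r: "r \<in> linear_maps k W P"
    and ri: "\<And>t. t \<in> carrier P \<Longrightarrow> r (i t) = t"
    and g: "g \<in> linear_maps k (tensor_product k M N) W"
    and image: "\<And>x y. x \<in> carrier M \<Longrightarrow> y \<in> carrier N \<Longrightarrow>
      g (pure_tensor k M N x y) \<in> i ` carrier P"
  shows "factors k W (tensor_product k M N) P (r \<circ> g) i g"
proof -
  have "(i \<circ> (r \<circ> g)) t = g t" if t: "t \<in> carrier (tensor_product k M N)" for t
  proof (rule linear_maps_tensor_ext[OF M N W linear_maps_comp[OF i linear_maps_comp[OF r g]] g _ t])
    show "(i \<circ> (r \<circ> g)) (pure_tensor k M N x y) = g (pure_tensor k M N x y)"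
      if "x \<in> carrier M" "y \<in> carrier N" for x y
      using image[OF that] ri by auto
  qed
  then show ?thesis
    by (simp add: factors_def linear_maps_comp[OF r g] i g tensor_product_module M N P)
qed


section \<open>The flip\<close>

text \<open>
  If \<open>A\<close> or \<open>C\<close> is the zero algebra, then \<open>A \<otimes> V \<otimes> C\<close> vanishes, but \<open>V \<otimes> C\<close> or \<open>A \<otimes> V\<close> need
  not. The algebra \<open>W\<close> then contains no information about \<open>R\<^sub>2\<close> or \<open>R\<^sub>1\<close>, and the flip serves
  instead.
\<close>

definition flip ::
    "('k, 'r) ring_scheme \<Rightarrow> ('k, 'm, 'x) module_scheme \<Rightarrow> ('k, 'n, 'y) module_scheme \<Rightarrow>
      ('m \<times> 'n \<Rightarrow> 'k) set \<Rightarrow> ('n \<times> 'm \<Rightarrow> 'k) set"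
  where "flip k M N = tensor_lift k (tensor_product k N M) (\<lambda>x y. pure_tensor k N M y x)"

lemma flip_linear:
  assumes "module k M" "module k N"
  shows "flip k M N \<in> linear_maps k (tensor_product k M N) (tensor_product k N M)"
  unfolding flip_def
  by (intro tensor_lift_linear bilinear_maps_swap[OF pure_tensor_bilinear] tensor_product_module assms)

lemma flip_pure:
  assumes "module k M" "module k N" "x \<in> carrier M" "y \<in> carrier N"
  shows "flip k M N (pure_tensor k M N x y) = pure_tensor k N M y x"
  unfolding flip_def
  by (intro tensor_lift_pure bilinear_maps_swap[OF pure_tensor_bilinear] tensor_product_module assms)

context two_sided_notation
begin

lemma mult_linear:
  assumes "unital_algebra k A"
  shows "\<mu>[A] \<in> linear_maps k (A \<boxtimes> A) A"
  by (intro tensor_lift_linear mult_bilinear unital_algebra_module assms)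

lemma mult_pure:
  assumes "unital_algebra k A" "a \<in> carrier A" "b \<in> carrier A"
  shows "\<mu>[A] (a \<diamondop>[A, A] b) = a \<otimes>\<^bsub>A\<^esub> b"
  by (intro tensor_lift_pure mult_bilinear unital_algebra_module assms)

lemma flip_mult_right:
  assumes A: "unital_algebra k A" and V: "module k V" and t: "t \<in> carrier (V \<boxtimes> A \<boxtimes> A)"
  shows "(flip k V A \<circ> (id \<star>[V, A] \<mu>[A])) t =
    ((\<mu>[A] \<star>[A, V] id) \<circ> \<beta>[A, A, V] \<circ> (id \<star>[A, A \<boxtimes> V] flip k V A) \<circ> \<alpha>[A, V, A]
      \<circ> (flip k V A \<star>[A \<boxtimes> V, A] id) \<circ> \<beta>[V, A, A]) t"
proof -
  interpret A: unital_algebra k A by fact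
  note A' = A.module_axioms
  note mods = A' V tensor_product_module
  show ?thesis
    by (rule linear_maps_tensor3_ext[OF V A' A' tensor_product_module[OF A' V] _ _ _ t])
      ((rule linear_maps_comp[rotated] tensor_map_linear associator_linear associator_inv_linear flip_linear
          linear_maps_id mult_linear mods A)+,
        simp add: mods A tensor_map_pure associator_pure associator_inv_pure flip_pure mult_pure
          pure_tensor_closed flip_linear mult_linear linear_maps_id linear_maps_id[unfolded id_def])
qed

lemma flip_mult_left:
  assumes C: "unital_algebra k C" and V: "module k V" and t: "t \<in> carrier (C \<boxtimes> C \<boxtimes> V)"
  shows "(flip k C V \<circ> (\<mu>[C] \<star>[C, V] id) \<circ> \<beta>[C, C, V]) t =
    ((id \<star>[V, C] \<mu>[C]) \<circ> \<alpha>[V, C, C] \<circ> (flip k C V \<star>[V \<boxtimes> C, C] id) \<circ> \<beta>[C, V, C]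
      \<circ> (id \<star>[C, V \<boxtimes> C] flip k C V)) t"
proof -
  interpret C: unital_algebra k C by fact
  note C' = C.module_axioms
  note mods = C' V tensor_product_module
  show ?thesis
    by (rule linear_maps_tensor3_ext[OF C' C' V tensor_product_module[OF V C'] _ _ _ t])
      ((rule linear_maps_comp[rotated] tensor_map_linear associator_linear associator_inv_linear flip_linear
          linear_maps_id mult_linear mods C)+,
        simp add: mods C tensor_map_pure associator_pure associator_inv_pure flip_pure mult_pure
          pure_tensor_closed flip_linear mult_linear linear_maps_id linear_maps_id[unfolded id_def])
qed

end

section \<open>Algebras factorized as \<open>A \<otimes> V \<otimes> C\<close>\<close>

text \<open>
  The locale collects the hypotheses of the theorem, so that the lemmas leading to it can share them.
\<close>

locale factorized_algebra = two_sided_notation k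
  for k :: "('k, 'r) ring_scheme" +
  fixes A :: "('k, 'a, 'x) module_scheme"
    and V :: "('k, 'v, 'y) module_scheme"
    and C :: "('k, 'c, 'z) module_scheme"
    and v1 :: 'v
    and prd :: "('a \<times> ('v \<times> 'c \<Rightarrow> 'k) set \<Rightarrow> 'k) set \<Rightarrow>
      ('a \<times> ('v \<times> 'c \<Rightarrow> 'k) set \<Rightarrow> 'k) set \<Rightarrow> ('a \<times> ('v \<times> 'c \<Rightarrow> 'k) set \<Rightarrow> 'k) set"
    and W :: "('k, ('a \<times> ('v \<times> 'c \<Rightarrow> 'k) set \<Rightarrow> 'k) set) module"
  assumes k: "field k"
    and A: "unital_algebra k A"
    and C: "unital_algebra k C"
    and V: "module k V"
    and v1: "v1 \<in> carrier V" "v1 \<noteq> \<zero>\<^bsub>V\<^esub>"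
    and W_eq: "W = (A \<boxtimes> V \<boxtimes> C) \<lparr>mult := prd, one := pure_tensor3 k A V C \<one>\<^bsub>A\<^esub> v1 \<one>\<^bsub>C\<^esub>\<rparr>"
    and W: "unital_algebra k W"
    and A_map: "(\<lambda>a. pure_tensor3 k A V C a v1 \<one>\<^bsub>C\<^esub>) \<in> algebra_maps k A W"
    and C_map: "(\<lambda>c. pure_tensor3 k A V C \<one>\<^bsub>A\<^esub> v1 c) \<in> algebra_maps k C W"
    and VA: "\<And>v a'. \<lbrakk>v \<in> carrier V; a' \<in> carrier A\<rbrakk> \<Longrightarrow>
      \<exists>(n::nat) a\<^sub>i v\<^sub>i. (\<forall>i<n. a\<^sub>i i \<in> carrier A \<and> v\<^sub>i i \<in> carrier V) \<and>
        pure_tensor3 k A V C \<one>\<^bsub>A\<^esub> v \<one>\<^bsub>C\<^esub> \<otimes>\<^bsub>W\<^esub> pure_tensor3 k A V C a' v1 \<one>\<^bsub>C\<^esub> =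
        (\<Oplus>\<^bsub>W\<^esub>i\<in>{..<n}. pure_tensor3 k A V C (a\<^sub>i i) (v\<^sub>i i) \<one>\<^bsub>C\<^esub>)"
    and CV: "\<And>c v'. \<lbrakk>c \<in> carrier C; v' \<in> carrier V\<rbrakk> \<Longrightarrow>
      \<exists>(n::nat) v\<^sub>j c\<^sub>j. (\<forall>j<n. v\<^sub>j j \<in> carrier V \<and> c\<^sub>j j \<in> carrier C) \<and>
        pure_tensor3 k A V C \<one>\<^bsub>A\<^esub> v1 c \<otimes>\<^bsub>W\<^esub> pure_tensor3 k A V C \<one>\<^bsub>A\<^esub> v' \<one>\<^bsub>C\<^esub> =
        (\<Oplus>\<^bsub>W\<^esub>j\<in>{..<n}. pure_tensor3 k A V C \<one>\<^bsub>A\<^esub> (v\<^sub>j j) (c\<^sub>j j))"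
    and CA: "\<And>c a'. \<lbrakk>c \<in> carrier C; a' \<in> carrier A\<rbrakk> \<Longrightarrow>
      \<exists>(n::nat) a\<^sub>l c\<^sub>l. (\<forall>l<n. a\<^sub>l l \<in> carrier A \<and> c\<^sub>l l \<in> carrier C) \<and>
        pure_tensor3 k A V C \<one>\<^bsub>A\<^esub> v1 c \<otimes>\<^bsub>W\<^esub> pure_tensor3 k A V C a' v1 \<one>\<^bsub>C\<^esub> =
        (\<Oplus>\<^bsub>W\<^esub>l\<in>{..<n}. pure_tensor3 k A V C (a\<^sub>l l) v1 (c\<^sub>l l))"
    and AVC: "\<And>a v c. \<lbrakk>a \<in> carrier A; v \<in> carrier V; c \<in> carrier C\<rbrakk> \<Longrightarrow>
      pure_tensor3 k A V C a v c =
        pure_tensor3 k A V C a v1 \<one>\<^bsub>C\<^esub> \<otimes>\<^bsub>W\<^esub> pure_tensor3 k A V C \<one>\<^bsub>A\<^esub> v \<one>\<^bsub>C\<^esub>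
          \<otimes>\<^bsub>W\<^esub> pure_tensor3 k A V C \<one>\<^bsub>A\<^esub> v1 c"
begin

sublocale A: unital_algebra k A by (rule A)
sublocale C: unital_algebra k C by (rule C)
sublocale W: unital_algebra k W by (rule W)

lemmas A_module = A.module_axioms and C_module = C.module_axioms and W_module = W.module_axioms
lemmas VC_module = tensor_product_module[OF V C_module]
  and T_module = tensor_product_module[OF A_module tensor_product_module[OF V C_module]]
lemmas modules = A_module C_module V W_module tensor_product_module

lemma W_simps:
  "carrier W = carrier (A \<boxtimes> V \<boxtimes> C)" "\<zero>\<^bsub>W\<^esub> = \<zero>\<^bsub>A \<boxtimes> V \<boxtimes> C\<^esub>"
  "\<one>\<^bsub>W\<^esub> = pure_tensor3 k A V C \<one>\<^bsub>A\<^esub> v1 \<one>\<^bsub>C\<^esub>"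
  by (simp_all add: W_eq)

lemma linear_maps_to_W: "linear_maps k M W = linear_maps k M (A \<boxtimes> V \<boxtimes> C)"
  by (simp add: linear_maps_def W_eq)

lemma linear_maps_from_W: "linear_maps k W M = linear_maps k (A \<boxtimes> V \<boxtimes> C) M"
  by (simp add: linear_maps_def W_eq)

abbreviation tensor3
  where "tensor3 \<equiv> pure_tensor3 k A V C"

definition inA where "inA a = tensor3 a v1 \<one>\<^bsub>C\<^esub>"
definition inV where "inV v = tensor3 \<one>\<^bsub>A\<^esub> v \<one>\<^bsub>C\<^esub>"
definition inC where "inC c = tensor3 \<one>\<^bsub>A\<^esub> v1 c"

lemma inA_algebra_map: "inA \<in> algebra_maps k A W"
  using A_map by (simp add: inA_def[abs_def])

lemma inC_algebra_map: "inC \<in> algebra_maps k C W"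
  using C_map by (simp add: inC_def[abs_def])

lemma inA_linear: "inA \<in> linear_maps k A W"
  using inA_algebra_map by (simp add: algebra_maps_def)

lemma inC_linear: "inC \<in> linear_maps k C W"
  using inC_algebra_map by (simp add: algebra_maps_def)

lemma inV_linear: "inV \<in> linear_maps k V W"
  using linear_maps_comp[OF pure_tensor_linear_right[OF A_module VC_module A.A.one_closed]
      pure_tensor_linear_left[OF V C_module C.A.one_closed]]
  by (simp add: linear_maps_to_W inV_def[abs_def] pure_tensor3_def comp_def)

lemmas in_linear = inA_linear inV_linear inC_linear
lemmas in_closed = in_linear[THEN linear_mapsD(1)]

lemma in_one: "inA \<one>\<^bsub>A\<^esub> = \<one>\<^bsub>W\<^esub>" "inV v1 = \<one>\<^bsub>W\<^esub>" "inC \<one>\<^bsub>C\<^esub> = \<one>\<^bsub>W\<^esub>"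
  by (simp_all add: inA_def inV_def inC_def W_simps)

lemma inA_mult: "a \<in> carrier A \<Longrightarrow> b \<in> carrier A \<Longrightarrow> inA (a \<otimes>\<^bsub>A\<^esub> b) = inA a \<otimes>\<^bsub>W\<^esub> inA b"
  using inA_algebra_map ring_hom_mult by (fastforce simp: algebra_maps_def)

lemma inC_mult: "c \<in> carrier C \<Longrightarrow> d \<in> carrier C \<Longrightarrow> inC (c \<otimes>\<^bsub>C\<^esub> d) = inC c \<otimes>\<^bsub>W\<^esub> inC d"
  using inC_algebra_map ring_hom_mult by (fastforce simp: algebra_maps_def)

lemma tensor3_eq:
  "a \<in> carrier A \<Longrightarrow> v \<in> carrier V \<Longrightarrow> c \<in> carrier C \<Longrightarrow>
    tensor3 a v c = inA a \<otimes>\<^bsub>W\<^esub> inV v \<otimes>\<^bsub>W\<^esub> inC c"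
  unfolding inA_def inV_def inC_def by (rule AVC)

abbreviation prod_map (infixr "\<ast>" 70)
  where "f \<ast> g \<equiv> mult_map k W f g"

lemma prod_map_linear:
  "module k M \<Longrightarrow> module k N \<Longrightarrow> f \<in> linear_maps k M W \<Longrightarrow> g \<in> linear_maps k N W \<Longrightarrow>
    f \<ast> g \<in> linear_maps k (M \<boxtimes> N) W"
  by (rule mult_map_linear[OF W])

lemmas AV_linear = prod_map_linear[OF A_module V inA_linear inV_linear]
  and VC_linear = prod_map_linear[OF V C_module inV_linear inC_linear]
  and AC_linear = prod_map_linear[OF A_module C_module inA_linear inC_linear]

lemmas AV_pure = mult_map_pure[OF W A_module V inA_linear inV_linear]
  and VC_pure = mult_map_pure[OF W V C_module inV_linear inC_linear]
  and AC_pure = mult_map_pure[OF W A_module C_module inA_linear inC_linear]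
  and VA_pure = mult_map_pure[OF W V A_module inV_linear inA_linear]
  and CV_pure = mult_map_pure[OF W C_module V inC_linear inV_linear]
  and CA_pure = mult_map_pure[OF W C_module A_module inC_linear inA_linear]
  and VV_pure = mult_map_pure[OF W V V inV_linear inV_linear]

lemma AVC_linear: "inA \<ast> inV \<ast> inC \<in> linear_maps k (A \<boxtimes> V \<boxtimes> C) W"
  by (intro prod_map_linear in_linear modules)

text \<open>
  Both sides are linear, and on pure tensors the identity is the hypothesis that \<open>a \<otimes> v \<otimes> c\<close> is the
  product of its factors.
\<close>

lemma AVC_identity:
  assumes "t \<in> carrier W"
  shows "(inA \<ast> inV \<ast> inC) t = t"
proof -
  have id: "id \<in> linear_maps k (A \<boxtimes> V \<boxtimes> C) W"
    by (simp only: linear_maps_to_W linear_maps_id)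
  have "(inA \<ast> inV \<ast> inC) t = id t"
  proof (rule linear_maps_tensor3_ext[OF A_module V C_module W_module AVC_linear id
        _ assms[unfolded W_simps]])
    show "(inA \<ast> inV \<ast> inC) (x \<diamondop>[A, V \<boxtimes> C] (y \<diamondop>[V, C] z)) = id (x \<diamondop>[A, V \<boxtimes> C] (y \<diamondop>[V, C] z))"
      if "x \<in> carrier A" "y \<in> carrier V" "z \<in> carrier C" for x y z
    proof -
      have "(inA \<ast> inV \<ast> inC) (x \<diamondop>[A, V \<boxtimes> C] (y \<diamondop>[V, C] z)) = tensor3 x y z"
        using that
        by (simp add: mult_map_pure[OF W A_module VC_module inA_linear VC_linear] VC_pure tensor3_eq
            pure_tensor_closed V C_module in_closed W.A.m_assoc)
      then show ?thesis
        by (simp add: pure_tensor3_def)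
    qed
  qed
  then show ?thesis by simp
qed

lemma AVC_inj: "inj_on (inA \<ast> inV \<ast> inC) (carrier (A \<boxtimes> V \<boxtimes> C))"
  by (simp add: inj_on_def AVC_identity W_simps(1))

lemma AV_tensor3: "a \<in> carrier A \<Longrightarrow> v \<in> carrier V \<Longrightarrow> inA a \<otimes>\<^bsub>W\<^esub> inV v = tensor3 a v \<one>\<^bsub>C\<^esub>"
  by (simp add: tensor3_eq in_one in_closed)

lemma VC_tensor3: "v \<in> carrier V \<Longrightarrow> c \<in> carrier C \<Longrightarrow> inV v \<otimes>\<^bsub>W\<^esub> inC c = tensor3 \<one>\<^bsub>A\<^esub> v c"
  by (simp add: tensor3_eq in_one in_closed)

lemma AC_tensor3: "a \<in> carrier A \<Longrightarrow> c \<in> carrier C \<Longrightarrow> inA a \<otimes>\<^bsub>W\<^esub> inC c = tensor3 a v1 c"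
  by (simp add: tensor3_eq in_one in_closed v1)


section \<open>Exchanging two factors\<close>

text \<open>
  The hypotheses on products of two factors provide finite sums that depend on the factors; all
  that matters about them is that such a sum lies in the image of a linear map.
\<close>

lemma finsum_in_image:
  assumes M: "module k M" and N: "module k N" and i: "i \<in> linear_maps k (M \<boxtimes> N) W"
    and mn: "\<forall>j<n. m j \<in> carrier M \<and> p j \<in> carrier N"
    and eq: "\<And>j. j < (n::nat) \<Longrightarrow> q j = i (m j \<diamondop>[M, N] p j)"
  shows "(\<Oplus>\<^bsub>W\<^esub>j\<in>{..<n}. q j) \<in> i ` carrier (M \<boxtimes> N)"
proof -
  interpret MN: module k "M \<boxtimes> N" by (rule tensor_product_module[OF M N])
  have closed: "(\<lambda>j. m j \<diamondop>[M, N] p j) \<in> {..<n} \<rightarrow> carrier (M \<boxtimes> N)"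
    using mn by (auto intro!: pure_tensor_closed M N)
  have "(\<Oplus>\<^bsub>W\<^esub>j\<in>{..<n}. q j) = (\<Oplus>\<^bsub>W\<^esub>j\<in>{..<n}. i (m j \<diamondop>[M, N] p j))"
    using eq closed linear_mapsD(1)[OF i] by (intro W.M.finsum_cong') auto
  also have "\<dots> = i (\<Oplus>\<^bsub>M \<boxtimes> N\<^esub>j\<in>{..<n}. m j \<diamondop>[M, N] p j)"
    using linear_maps_finsum[OF MN.module_axioms W_module i closed] by simp
  finally show ?thesis
    using MN.finsum_closed[OF closed] by blast
qed

lemma VA_image:
  assumes "v \<in> carrier V" "a \<in> carrier A"
  shows "(inV \<ast> inA) (v \<diamondop>[V, A] a) \<in> (inA \<ast> inV) ` carrier (A \<boxtimes> V)"
proof -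
  obtain n :: nat and m p where mp: "\<forall>i<n. m i \<in> carrier A \<and> p i \<in> carrier V"
    and eq: "inV v \<otimes>\<^bsub>W\<^esub> inA a = (\<Oplus>\<^bsub>W\<^esub>i\<in>{..<n}. tensor3 (m i) (p i) \<one>\<^bsub>C\<^esub>)"
    using VA[OF assms] unfolding inA_def inV_def by blast
  have "(\<Oplus>\<^bsub>W\<^esub>i\<in>{..<n}. tensor3 (m i) (p i) \<one>\<^bsub>C\<^esub>) \<in> (inA \<ast> inV) ` carrier (A \<boxtimes> V)"
    using mp by (intro finsum_in_image[OF A_module V AV_linear mp]) (simp add: AV_pure AV_tensor3)
  then show ?thesis
    using eq assms by (simp add: VA_pure)
qed

lemma CV_image:
  assumes "c \<in> carrier C" "v \<in> carrier V"
  shows "(inC \<ast> inV) (c \<diamondop>[C, V] v) \<in> (inV \<ast> inC) ` carrier (V \<boxtimes> C)"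
proof -
  obtain n :: nat and m p where mp: "\<forall>i<n. m i \<in> carrier V \<and> p i \<in> carrier C"
    and eq: "inC c \<otimes>\<^bsub>W\<^esub> inV v = (\<Oplus>\<^bsub>W\<^esub>i\<in>{..<n}. tensor3 \<one>\<^bsub>A\<^esub> (m i) (p i))"
    using CV[OF assms] unfolding inC_def inV_def by blast
  have "(\<Oplus>\<^bsub>W\<^esub>i\<in>{..<n}. tensor3 \<one>\<^bsub>A\<^esub> (m i) (p i)) \<in> (inV \<ast> inC) ` carrier (V \<boxtimes> C)"
    using mp by (intro finsum_in_image[OF V C_module VC_linear mp]) (simp add: VC_pure VC_tensor3)
  then show ?thesis
    using eq assms by (simp add: CV_pure)
qed

lemma CA_image:
  assumes "c \<in> carrier C" "a \<in> carrier A"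
  shows "(inC \<ast> inA) (c \<diamondop>[C, A] a) \<in> (inA \<ast> inC) ` carrier (A \<boxtimes> C)"
proof -
  obtain n :: nat and m p where mp: "\<forall>i<n. m i \<in> carrier A \<and> p i \<in> carrier C"
    and eq: "inC c \<otimes>\<^bsub>W\<^esub> inA a = (\<Oplus>\<^bsub>W\<^esub>i\<in>{..<n}. tensor3 (m i) v1 (p i))"
    using CA[OF assms] unfolding inC_def inA_def by blast
  have "(\<Oplus>\<^bsub>W\<^esub>i\<in>{..<n}. tensor3 (m i) v1 (p i)) \<in> (inA \<ast> inC) ` carrier (A \<boxtimes> C)"
    using mp by (intro finsum_in_image[OF A_module C_module AC_linear mp]) (simp add: AC_pure AC_tensor3)
  then show ?thesis
    using eq assms by (simp add: CA_pure)
qed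

lemma AV_retraction:
  assumes "\<one>\<^bsub>C\<^esub> \<noteq> \<zero>\<^bsub>C\<^esub>"
  obtains r where "r \<in> linear_maps k W (A \<boxtimes> V)"
    and "\<And>t. t \<in> carrier (A \<boxtimes> V) \<Longrightarrow> r ((inA \<ast> inV) t) = t"
proof -
  obtain h where h: "h \<in> linear_maps k (V \<boxtimes> C) V"
    and h_pure: "\<And>v. v \<in> carrier V \<Longrightarrow> h (v \<diamondop>[V, C] \<one>\<^bsub>C\<^esub>) = v"
    using contraction_right_exists[OF k V C_module C.A.one_closed assms] by metis
  let ?r = "id \<star>[A, V] h"
  have r: "?r \<in> linear_maps k W (A \<boxtimes> V)"
    unfolding linear_maps_from_W by (intro tensor_map_linear linear_maps_id h modules)
  have "(?r \<circ> (inA \<ast> inV)) t = id t" if t: "t \<in> carrier (A \<boxtimes> V)" for t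
    by (rule linear_maps_tensor_ext[OF A_module V tensor_product_module[OF A_module V]
          linear_maps_comp[OF r AV_linear] linear_maps_id _ t])
      (simp add: AV_pure AV_tensor3 pure_tensor3_def h_pure pure_tensor_closed V C_module
        tensor_map_pure[OF A_module VC_module A_module V linear_maps_id h])
  with r show ?thesis
    using that by simp
qed

lemma VC_retraction:
  assumes "\<one>\<^bsub>A\<^esub> \<noteq> \<zero>\<^bsub>A\<^esub>"
  obtains r where "r \<in> linear_maps k W (V \<boxtimes> C)"
    and "\<And>t. t \<in> carrier (V \<boxtimes> C) \<Longrightarrow> r ((inV \<ast> inC) t) = t"
proof -
  obtain r where r: "r \<in> linear_maps k W (V \<boxtimes> C)"
    and r_pure: "\<And>t. t \<in> carrier (V \<boxtimes> C) \<Longrightarrow> r (\<one>\<^bsub>A\<^esub> \<diamondop>[A, V \<boxtimes> C] t) = t"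
    unfolding linear_maps_from_W
    using contraction_left_exists[OF k A_module VC_module A.A.one_closed assms] by metis
  have "(r \<circ> (inV \<ast> inC)) t = id t" if t: "t \<in> carrier (V \<boxtimes> C)" for t
    by (rule linear_maps_tensor_ext[OF V C_module VC_module
          linear_maps_comp[OF r VC_linear] linear_maps_id _ t])
      (simp add: VC_pure VC_tensor3 pure_tensor3_def r_pure pure_tensor_closed V C_module)
  with r show ?thesis
    using that by simp
qed

lemma AC_retraction:
  obtains r where "r \<in> linear_maps k W (A \<boxtimes> C)"
    and "\<And>t. t \<in> carrier (A \<boxtimes> C) \<Longrightarrow> r ((inA \<ast> inC) t) = t"
proof -
  obtain h where h: "h \<in> linear_maps k (V \<boxtimes> C) C"
    and h_pure: "\<And>c. c \<in> carrier C \<Longrightarrow> h (v1 \<diamondop>[V, C] c) = c"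
    using contraction_left_exists[OF k V C_module v1] by metis
  let ?r = "id \<star>[A, C] h"
  have r: "?r \<in> linear_maps k W (A \<boxtimes> C)"
    unfolding linear_maps_from_W by (intro tensor_map_linear linear_maps_id h modules)
  have "(?r \<circ> (inA \<ast> inC)) t = id t" if t: "t \<in> carrier (A \<boxtimes> C)" for t
    by (rule linear_maps_tensor_ext[OF A_module C_module tensor_product_module[OF A_module C_module]
          linear_maps_comp[OF r AC_linear] linear_maps_id _ t])
      (simp add: AC_pure AC_tensor3 pure_tensor3_def h_pure pure_tensor_closed V C_module v1
        tensor_map_pure[OF A_module VC_module A_module C_module linear_maps_id h])
  with r show ?thesis
    using that by simp
qed

text \<open>
  The embeddings are unital, so \<open>1 = 0\<close> in \<open>A\<close> or \<open>C\<close> forces \<open>1 = 0\<close> in \<open>W\<close>.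
\<close>

lemma W_trivial:
  assumes "\<one>\<^bsub>A\<^esub> = \<zero>\<^bsub>A\<^esub> \<or> \<one>\<^bsub>C\<^esub> = \<zero>\<^bsub>C\<^esub>"
  shows "carrier W = {\<zero>\<^bsub>W\<^esub>}"
proof -
  have "\<one>\<^bsub>W\<^esub> = \<zero>\<^bsub>W\<^esub>"
    using assms in_one linear_maps_zero[OF A_module W_module inA_linear]
      linear_maps_zero[OF C_module W_module inC_linear] by metis
  then show ?thesis
    by (simp add: W.A.carrier_one_zero)
qed

lemma factors_trivial:
  assumes "carrier W = {\<zero>\<^bsub>W\<^esub>}" "module k M" "module k N" "p \<in> linear_maps k M N"
    "f \<in> linear_maps k N W" "g \<in> linear_maps k M W"
  shows "factors k W M N p f g"
  using assms linear_mapsD(1) unfolding factors_def by (metis singletonD)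

lemmas factors_rules = factors_comp factors_tensor_map[OF W] factors_associator[OF W]
  factors_associator_inv[OF W] factors_mult[OF W A inA_algebra_map]
  factors_mult[OF W C inC_algebra_map] factors_id

text \<open>
  The factors \<open>v\<close> and \<open>a\<close> are exchanged by rewriting \<open>v a\<close> in \<open>A \<otimes> V\<close>. If \<open>A \<otimes> V\<close> embeds into
  \<open>W\<close>, both sides of the rule for \<open>a a'\<close> compute \<open>v a a'\<close>. Otherwise \<open>C\<close> is zero, hence so is
  \<open>W\<close>, and only the laws that live in \<open>A \<otimes> V\<close> have content; the flip satisfies them.
\<close>

lemma R1_exists:
  obtains R1 where "factors k W (V \<boxtimes> A) (A \<boxtimes> V) R1 (inA \<ast> inV) (inV \<ast> inA)"
    and "\<And>a. a \<in> carrier A \<Longrightarrow> R1 (v1 \<diamondop>[V, A] a) = a \<diamondop>[A, V] v1"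
    and "\<And>v. v \<in> carrier V \<Longrightarrow> R1 (v \<diamondop>[V, A] \<one>\<^bsub>A\<^esub>) = \<one>\<^bsub>A\<^esub> \<diamondop>[A, V] v"
    and "\<And>t. t \<in> carrier (V \<boxtimes> A \<boxtimes> A) \<Longrightarrow>
      (R1 \<circ> (id \<star>[V, A] \<mu>[A])) t =
      ((\<mu>[A] \<star>[A, V] id) \<circ> \<beta>[A, A, V] \<circ> (id \<star>[A, A \<boxtimes> V] R1) \<circ> \<alpha>[A, V, A]
        \<circ> (R1 \<star>[A \<boxtimes> V, A] id) \<circ> \<beta>[V, A, A]) t"
proof (cases "\<one>\<^bsub>C\<^esub> = \<zero>\<^bsub>C\<^esub>")
  case True
  show ?thesis
  proof (rule that)
    show "factors k W (V \<boxtimes> A) (A \<boxtimes> V) (flip k V A) (inA \<ast> inV) (inV \<ast> inA)"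
      using True by (intro factors_trivial W_trivial flip_linear prod_map_linear in_linear modules) simp
  qed (simp_all add: flip_pure V A_module v1 flip_mult_right[OF A V] del: comp_apply)
next
  case False
  obtain r where r: "r \<in> linear_maps k W (A \<boxtimes> V)"
    and r_inv: "\<And>t. t \<in> carrier (A \<boxtimes> V) \<Longrightarrow> r ((inA \<ast> inV) t) = t"
    using AV_retraction[OF False] by metis
  define R1 where "R1 = r \<circ> (inV \<ast> inA)"
  have R1: "factors k W (V \<boxtimes> A) (A \<boxtimes> V) R1 (inA \<ast> inV) (inV \<ast> inA)"
    unfolding R1_def
    by (intro factors_retraction r r_inv VA_image prod_map_linear in_linear modules)
  have inj: "inj_on (inA \<ast> inV) (carrier (A \<boxtimes> V))"
    by (rule inj_on_inverseI) (rule r_inv)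
  show ?thesis
  proof (rule that[OF R1])
    show "R1 (v1 \<diamondop>[V, A] a) = a \<diamondop>[A, V] v1" if "a \<in> carrier A" for a
      using that r_inv[of "a \<diamondop>[A, V] v1"]
      by (simp add: R1_def VA_pure AV_pure v1 in_one in_closed pure_tensor_closed V A_module)
    show "R1 (v \<diamondop>[V, A] \<one>\<^bsub>A\<^esub>) = \<one>\<^bsub>A\<^esub> \<diamondop>[A, V] v" if "v \<in> carrier V" for v
      using that r_inv[of "\<one>\<^bsub>A\<^esub> \<diamondop>[A, V] v"]
      by (simp add: R1_def VA_pure AV_pure in_one in_closed pure_tensor_closed V A_module)
    show "(R1 \<circ> (id \<star>[V, A] \<mu>[A])) t =
      ((\<mu>[A] \<star>[A, V] id) \<circ> \<beta>[A, A, V] \<circ> (id \<star>[A, A \<boxtimes> V] R1) \<circ> \<alpha>[A, V, A]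
        \<circ> (R1 \<star>[A \<boxtimes> V, A] id) \<circ> \<beta>[V, A, A]) t" if "t \<in> carrier (V \<boxtimes> A \<boxtimes> A)" for t
    proof (rule factors_unique[OF _ _ inj that])
      show "factors k W (V \<boxtimes> A \<boxtimes> A) (A \<boxtimes> V) (R1 \<circ> (id \<star>[V, A] \<mu>[A])) (inA \<ast> inV)
          (inV \<ast> inA \<ast> inA)"
        by (rule factors_rules R1 modules in_linear prod_map_linear)+
      show "factors k W (V \<boxtimes> A \<boxtimes> A) (A \<boxtimes> V)
          ((\<mu>[A] \<star>[A, V] id) \<circ> \<beta>[A, A, V] \<circ> (id \<star>[A, A \<boxtimes> V] R1) \<circ> \<alpha>[A, V, A]
            \<circ> (R1 \<star>[A \<boxtimes> V, A] id) \<circ> \<beta>[V, A, A]) (inA \<ast> inV) (inV \<ast> inA \<ast> inA)"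
        by (rule factors_rules R1 modules in_linear prod_map_linear)+
    qed
  qed
qed

lemma R2_exists:
  obtains R2 where "factors k W (C \<boxtimes> V) (V \<boxtimes> C) R2 (inV \<ast> inC) (inC \<ast> inV)"
    and "\<And>c. c \<in> carrier C \<Longrightarrow> R2 (c \<diamondop>[C, V] v1) = v1 \<diamondop>[V, C] c"
    and "\<And>v. v \<in> carrier V \<Longrightarrow> R2 (\<one>\<^bsub>C\<^esub> \<diamondop>[C, V] v) = v \<diamondop>[V, C] \<one>\<^bsub>C\<^esub>"
    and "\<And>t. t \<in> carrier (C \<boxtimes> C \<boxtimes> V) \<Longrightarrow>
      (R2 \<circ> (\<mu>[C] \<star>[C, V] id) \<circ> \<beta>[C, C, V]) t =
      ((id \<star>[V, C] \<mu>[C]) \<circ> \<alpha>[V, C, C] \<circ> (R2 \<star>[V \<boxtimes> C, C] id) \<circ> \<beta>[C, V, C]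
        \<circ> (id \<star>[C, V \<boxtimes> C] R2)) t"
proof (cases "\<one>\<^bsub>A\<^esub> = \<zero>\<^bsub>A\<^esub>")
  case True
  show ?thesis
  proof (rule that)
    show "factors k W (C \<boxtimes> V) (V \<boxtimes> C) (flip k C V) (inV \<ast> inC) (inC \<ast> inV)"
      using True by (intro factors_trivial W_trivial flip_linear prod_map_linear in_linear modules) simp
  qed (simp_all add: flip_pure V C_module v1 flip_mult_left[OF C V] del: comp_apply)
next
  case False
  obtain r where r: "r \<in> linear_maps k W (V \<boxtimes> C)"
    and r_inv: "\<And>t. t \<in> carrier (V \<boxtimes> C) \<Longrightarrow> r ((inV \<ast> inC) t) = t"
    using VC_retraction[OF False] by metis
  define R2 where "R2 = r \<circ> (inC \<ast> inV)"
  have R2: "factors k W (C \<boxtimes> V) (V \<boxtimes> C) R2 (inV \<ast> inC) (inC \<ast> inV)"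
    unfolding R2_def
    by (intro factors_retraction r r_inv CV_image prod_map_linear in_linear modules)
  have inj: "inj_on (inV \<ast> inC) (carrier (V \<boxtimes> C))"
    by (rule inj_on_inverseI) (rule r_inv)
  show ?thesis
  proof (rule that[OF R2])
    show "R2 (c \<diamondop>[C, V] v1) = v1 \<diamondop>[V, C] c" if "c \<in> carrier C" for c
      using that r_inv[of "v1 \<diamondop>[V, C] c"]
      by (simp add: R2_def CV_pure VC_pure v1 in_one in_closed pure_tensor_closed V C_module)
    show "R2 (\<one>\<^bsub>C\<^esub> \<diamondop>[C, V] v) = v \<diamondop>[V, C] \<one>\<^bsub>C\<^esub>" if "v \<in> carrier V" for v
      using that r_inv[of "v \<diamondop>[V, C] \<one>\<^bsub>C\<^esub>"]
      by (simp add: R2_def CV_pure VC_pure in_one in_closed pure_tensor_closed V C_module)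
    show "(R2 \<circ> (\<mu>[C] \<star>[C, V] id) \<circ> \<beta>[C, C, V]) t =
      ((id \<star>[V, C] \<mu>[C]) \<circ> \<alpha>[V, C, C] \<circ> (R2 \<star>[V \<boxtimes> C, C] id) \<circ> \<beta>[C, V, C]
        \<circ> (id \<star>[C, V \<boxtimes> C] R2)) t" if "t \<in> carrier (C \<boxtimes> C \<boxtimes> V)" for t
    proof (rule factors_unique[OF _ _ inj that])
      show "factors k W (C \<boxtimes> C \<boxtimes> V) (V \<boxtimes> C) (R2 \<circ> (\<mu>[C] \<star>[C, V] id) \<circ> \<beta>[C, C, V])
          (inV \<ast> inC) (inC \<ast> inC \<ast> inV)"
        by (rule factors_rules R2 modules in_linear prod_map_linear)+
      show "factors k W (C \<boxtimes> C \<boxtimes> V) (V \<boxtimes> C)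
          ((id \<star>[V, C] \<mu>[C]) \<circ> \<alpha>[V, C, C] \<circ> (R2 \<star>[V \<boxtimes> C, C] id) \<circ> \<beta>[C, V, C]
            \<circ> (id \<star>[C, V \<boxtimes> C] R2)) (inV \<ast> inC) (inC \<ast> inC \<ast> inV)"
        by (rule factors_rules R2 modules in_linear prod_map_linear)+
    qed
  qed
qed

lemma left_mult_linear: "w \<in> carrier W \<Longrightarrow> (\<lambda>x. w \<otimes>\<^bsub>W\<^esub> x) \<in> linear_maps k W W"
  using bilinear_mapsD(1)[OF mult_bilinear[OF W]] .

lemma right_mult_linear: "w \<in> carrier W \<Longrightarrow> (\<lambda>x. x \<otimes>\<^bsub>W\<^esub> w) \<in> linear_maps k W W"
  using bilinear_mapsD(2)[OF mult_bilinear[OF W]] .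

text \<open>
  Here the embedding of \<open>A \<otimes> C\<close> only needs \<open>v1 \<noteq> 0\<close>, so there is no degenerate case. The
  twisting laws state that \<open>c a a'\<close> and \<open>c c' a\<close> may be rewritten in two steps. They are given in
  Sweedler notation, and the lifts are evaluated from the inside, writing a pure tensor
  \<open>a \<otimes> c\<close> as the image \<open>r (a c)\<close> of a product under the retraction \<open>r\<close>.
\<close>

lemma R3_exists:
  obtains R3 where "factors k W (C \<boxtimes> A) (A \<boxtimes> C) R3 (inA \<ast> inC) (inC \<ast> inA)"
    and "twisting_map k A C R3"
proof -
  obtain r where r: "r \<in> linear_maps k W (A \<boxtimes> C)"
    and r_inv: "\<And>t. t \<in> carrier (A \<boxtimes> C) \<Longrightarrow> r ((inA \<ast> inC) t) = t"
    using AC_retraction by metis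
  define R3 where "R3 = r \<circ> (inC \<ast> inA)"
  have R3: "factors k W (C \<boxtimes> A) (A \<boxtimes> C) R3 (inA \<ast> inC) (inC \<ast> inA)"
    unfolding R3_def
    by (intro factors_retraction r r_inv CA_image prod_map_linear in_linear modules)
  note AC = tensor_product_module[OF A_module C_module]
  note R3_closed = linear_mapsD(1)[OF factorsD(3)[OF R3] pure_tensor_closed[OF C_module A_module]]
  note R3_AC = factorsD(6)[OF R3 pure_tensor_closed[OF C_module A_module]]
  have r_pure: "r (inA a \<otimes>\<^bsub>W\<^esub> inC c) = a \<diamondop>[A, C] c" if "a \<in> carrier A" "c \<in> carrier C" for a c
    using that r_inv[of "a \<diamondop>[A, C] c"] by (simp add: AC_pure pure_tensor_closed A_module C_module)
  have R3_pure: "R3 (c \<diamondop>[C, A] a) = r (inC c \<otimes>\<^bsub>W\<^esub> inA a)"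
    if "c \<in> carrier C" "a \<in> carrier A" for c a
    using that by (simp add: R3_def CA_pure)
  have AC_r_pure: "(inA \<ast> inC) (r (inA a \<otimes>\<^bsub>W\<^esub> inC c)) = inA a \<otimes>\<^bsub>W\<^esub> inC c"
    if "a \<in> carrier A" "c \<in> carrier C" for a c
    using that by (simp add: r_pure AC_pure)
  have AC_r: "(inA \<ast> inC) (r (inC c \<otimes>\<^bsub>W\<^esub> inA a)) = inC c \<otimes>\<^bsub>W\<^esub> inA a"
    if "c \<in> carrier C" "a \<in> carrier A" for c a
    using that R3_AC[OF that] by (simp add: R3_pure CA_pure)
  have "R3 (c \<diamondop>[C, A] (a \<otimes>\<^bsub>A\<^esub> a')) =
      tensor_lift k (A \<boxtimes> C) (\<lambda>p q. tensor_lift k (A \<boxtimes> C)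
        (\<lambda>p' q'. (p \<otimes>\<^bsub>A\<^esub> p') \<diamondop>[A, C] q') (R3 (q \<diamondop>[C, A] a'))) (R3 (c \<diamondop>[C, A] a))"
    if a: "a \<in> carrier A" "a' \<in> carrier A" and c: "c \<in> carrier C" for a a' c
  proof -
    have inner: "tensor_lift k (A \<boxtimes> C) (\<lambda>p' q'. (p \<otimes>\<^bsub>A\<^esub> p') \<diamondop>[A, C] q') (R3 (q \<diamondop>[C, A] a')) =
        r (inA p \<otimes>\<^bsub>W\<^esub> inC q \<otimes>\<^bsub>W\<^esub> inA a')" if "p \<in> carrier A" "q \<in> carrier C" for p q
    proof -
      let ?g = "r \<circ> ((\<lambda>x. inA p \<otimes>\<^bsub>W\<^esub> x) \<circ> (inA \<ast> inC))"
      have g: "?g \<in> linear_maps k (A \<boxtimes> C) (A \<boxtimes> C)"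
        using that by (intro linear_maps_comp[OF r] linear_maps_comp[OF left_mult_linear] AC_linear in_closed)
      have "tensor_lift k (A \<boxtimes> C) (\<lambda>p' q'. (p \<otimes>\<^bsub>A\<^esub> p') \<diamondop>[A, C] q') (R3 (q \<diamondop>[C, A] a')) =
          ?g (R3 (q \<diamondop>[C, A] a'))"
        using that a R3_closed
        by (subst tensor_lift_eqI[OF A_module C_module AC g])
          (simp_all add: AC_pure in_closed r_pure[symmetric] AC_r_pure inA_mult W.A.m_assoc)
      then show ?thesis
        using that a by (simp add: R3_AC CA_pure in_closed W.A.m_assoc)
    qed
    let ?g = "r \<circ> ((\<lambda>x. x \<otimes>\<^bsub>W\<^esub> inA a') \<circ> (inA \<ast> inC))"
    have g: "?g \<in> linear_maps k (A \<boxtimes> C) (A \<boxtimes> C)"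
      using a by (intro linear_maps_comp[OF r] linear_maps_comp[OF right_mult_linear] AC_linear in_closed)
    have "tensor_lift k (A \<boxtimes> C) (\<lambda>p q. tensor_lift k (A \<boxtimes> C)
        (\<lambda>p' q'. (p \<otimes>\<^bsub>A\<^esub> p') \<diamondop>[A, C] q') (R3 (q \<diamondop>[C, A] a'))) (R3 (c \<diamondop>[C, A] a)) =
        ?g (R3 (c \<diamondop>[C, A] a))"
      using a c R3_closed
      by (subst tensor_lift_eqI[OF A_module C_module AC g]) (simp_all add: AC_pure inner)
    then show ?thesis
      using a c by (simp add: AC_r R3_pure in_closed W.A.m_assoc inA_mult)
  qed
  moreover have "R3 ((c \<otimes>\<^bsub>C\<^esub> c') \<diamondop>[C, A] a) =
      tensor_lift k (A \<boxtimes> C) (\<lambda>p q. tensor_lift k (A \<boxtimes> C)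
        (\<lambda>p' q'. p' \<diamondop>[A, C] (q' \<otimes>\<^bsub>C\<^esub> q)) (R3 (c \<diamondop>[C, A] p))) (R3 (c' \<diamondop>[C, A] a))"
    if a: "a \<in> carrier A" and c: "c \<in> carrier C" "c' \<in> carrier C" for a c c'
  proof -
    have inner: "tensor_lift k (A \<boxtimes> C) (\<lambda>p' q'. p' \<diamondop>[A, C] (q' \<otimes>\<^bsub>C\<^esub> q)) (R3 (c \<diamondop>[C, A] p)) =
        r (inC c \<otimes>\<^bsub>W\<^esub> inA p \<otimes>\<^bsub>W\<^esub> inC q)" if "p \<in> carrier A" "q \<in> carrier C" for p q
    proof -
      let ?g = "r \<circ> ((\<lambda>x. x \<otimes>\<^bsub>W\<^esub> inC q) \<circ> (inA \<ast> inC))"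
      have g: "?g \<in> linear_maps k (A \<boxtimes> C) (A \<boxtimes> C)"
        using that by (intro linear_maps_comp[OF r] linear_maps_comp[OF right_mult_linear] AC_linear in_closed)
      have "tensor_lift k (A \<boxtimes> C) (\<lambda>p' q'. p' \<diamondop>[A, C] (q' \<otimes>\<^bsub>C\<^esub> q)) (R3 (c \<diamondop>[C, A] p)) =
          ?g (R3 (c \<diamondop>[C, A] p))"
        using that c R3_closed
        by (subst tensor_lift_eqI[OF A_module C_module AC g])
          (simp_all add: AC_pure in_closed r_pure[symmetric] AC_r_pure inC_mult W.A.m_assoc)
      then show ?thesis
        using that c by (simp add: R3_AC CA_pure in_closed W.A.m_assoc)
    qed
    let ?g = "r \<circ> ((\<lambda>x. inC c \<otimes>\<^bsub>W\<^esub> x) \<circ> (inA \<ast> inC))"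
    have g: "?g \<in> linear_maps k (A \<boxtimes> C) (A \<boxtimes> C)"
      using c by (intro linear_maps_comp[OF r] linear_maps_comp[OF left_mult_linear] AC_linear in_closed)
    have "tensor_lift k (A \<boxtimes> C) (\<lambda>p q. tensor_lift k (A \<boxtimes> C)
        (\<lambda>p' q'. p' \<diamondop>[A, C] (q' \<otimes>\<^bsub>C\<^esub> q)) (R3 (c \<diamondop>[C, A] p))) (R3 (c' \<diamondop>[C, A] a)) =
        ?g (R3 (c' \<diamondop>[C, A] a))"
      using a c R3_closed
      by (subst tensor_lift_eqI[OF A_module C_module AC g])
        (simp_all add: AC_pure inner in_closed W.A.m_assoc)
    then show ?thesis
      using a c by (simp add: AC_r R3_pure in_closed W.A.m_assoc inC_mult)
  qed
  moreover have "R3 (c \<diamondop>[C, A] \<one>\<^bsub>A\<^esub>) = \<one>\<^bsub>A\<^esub> \<diamondop>[A, C] c" if "c \<in> carrier C" for c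
    using that by (simp add: R3_pure r_pure[symmetric] in_one in_closed)
  moreover have "R3 (\<one>\<^bsub>C\<^esub> \<diamondop>[C, A] a) = a \<diamondop>[A, C] \<one>\<^bsub>C\<^esub>" if "a \<in> carrier A" for a
    using that by (simp add: R3_pure r_pure[symmetric] in_one in_closed)
  ultimately have "twisting_map k A C R3"
    unfolding twisting_map_def using factorsD(3)[OF R3] by simp
  with R3 show ?thesis
    by (rule that)
qed


section \<open>The crossed product\<close>

text \<open>
  Products of two elements of \<open>V\<close> have no special form, so \<open>E\<close> is the multiplication itself.
\<close>

lemma E_factors:
  "factors k W (V \<boxtimes> V) (A \<boxtimes> V \<boxtimes> C) (inV \<ast> inV) (inA \<ast> inV \<ast> inC) (inV \<ast> inV)"
proof -
  have lin: "inV \<ast> inV \<in> linear_maps k (V \<boxtimes> V) W"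
    by (intro prod_map_linear in_linear modules)
  then show ?thesis
    using AVC_identity linear_mapsD(1)[OF lin] AVC_linear
    by (simp add: factors_def linear_maps_to_W[symmetric] tensor_product_module V T_module)
qed

text \<open>
  The relations with values in \<open>A \<otimes> V \<otimes> C\<close> hold because both sides compute the same product of
  three factors in \<open>W\<close>; that product is the map supplied as \<open>f'\<close> in each of the last four cases.
\<close>

lemma crossed_product_data:
  assumes R1: "factors k W (V \<boxtimes> A) (A \<boxtimes> V) R1 (inA \<ast> inV) (inV \<ast> inA)"
    and R2: "factors k W (C \<boxtimes> V) (V \<boxtimes> C) R2 (inV \<ast> inC) (inC \<ast> inV)"
    and R3: "factors k W (C \<boxtimes> A) (A \<boxtimes> C) R3 (inA \<ast> inC) (inC \<ast> inA)"
    and R3_twisting: "twisting_map k A C R3"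
    and R1_one: "\<And>a. a \<in> carrier A \<Longrightarrow> R1 (v1 \<diamondop>[V, A] a) = a \<diamondop>[A, V] v1"
      "\<And>v. v \<in> carrier V \<Longrightarrow> R1 (v \<diamondop>[V, A] \<one>\<^bsub>A\<^esub>) = \<one>\<^bsub>A\<^esub> \<diamondop>[A, V] v"
    and R2_one: "\<And>c. c \<in> carrier C \<Longrightarrow> R2 (c \<diamondop>[C, V] v1) = v1 \<diamondop>[V, C] c"
      "\<And>v. v \<in> carrier V \<Longrightarrow> R2 (\<one>\<^bsub>C\<^esub> \<diamondop>[C, V] v) = v \<diamondop>[V, C] \<one>\<^bsub>C\<^esub>"
    and R1_mult: "\<And>t. t \<in> carrier (V \<boxtimes> A \<boxtimes> A) \<Longrightarrow>
      (R1 \<circ> (id \<star>[V, A] \<mu>[A])) t =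
      ((\<mu>[A] \<star>[A, V] id) \<circ> \<beta>[A, A, V] \<circ> (id \<star>[A, A \<boxtimes> V] R1) \<circ> \<alpha>[A, V, A]
        \<circ> (R1 \<star>[A \<boxtimes> V, A] id) \<circ> \<beta>[V, A, A]) t"
    and R2_mult: "\<And>t. t \<in> carrier (C \<boxtimes> C \<boxtimes> V) \<Longrightarrow>
      (R2 \<circ> (\<mu>[C] \<star>[C, V] id) \<circ> \<beta>[C, C, V]) t =
      ((id \<star>[V, C] \<mu>[C]) \<circ> \<alpha>[V, C, C] \<circ> (R2 \<star>[V \<boxtimes> C, C] id) \<circ> \<beta>[C, V, C]
        \<circ> (id \<star>[C, V \<boxtimes> C] R2)) t"
  shows "two_sided_crossed_product_data k A V v1 C R1 R2 R3 (inV \<ast> inV)"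
proof (unfold_locales, goal_cases)
  case 1 show ?case using factorsD(3)[OF R1] .
next
  case 2 show ?case using factorsD(3)[OF R2] .
next
  case 3 show ?case using factorsD(3)[OF R3] .
next
  case 4 show ?case using factorsD(3)[OF E_factors] .
next
  case 5 show ?case by (rule R3_twisting)
next
  case (6 a) then show ?case by (rule R1_one)
next
  case (7 v) then show ?case by (rule R1_one)
next
  case (8 c) then show ?case by (rule R2_one)
next
  case (9 v) then show ?case by (rule R2_one)
next
  case (10 v) then show ?case
    by (simp add: VV_pure v1 in_one in_closed inV_def[unfolded pure_tensor3_def, symmetric])
next
  case (11 v) then show ?case
    by (simp add: VV_pure v1 in_one in_closed inV_def[unfolded pure_tensor3_def, symmetric])
next
  case (12 t) then show ?case by (rule R1_mult)
next
  case (13 t) then show ?case by (rule R2_mult)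
next
  case (14 t)
  show ?case
    by (rule factors_unique[OF _ _ AVC_inj 14, where f' = "inC \<ast> inV \<ast> inA"];
        (rule factors_rules R1 R2 R3 modules in_linear prod_map_linear)+)
next
  case (15 t)
  show ?case
    by (rule factors_unique[OF _ _ AVC_inj 15, where f' = "inV \<ast> inV \<ast> inA"];
        (rule factors_rules R1 R2 R3 E_factors modules in_linear prod_map_linear)+)
next
  case (16 t)
  show ?case
    by (rule factors_unique[OF _ _ AVC_inj 16, where f' = "inC \<ast> inV \<ast> inV"];
        (rule factors_rules R1 R2 R3 E_factors modules in_linear prod_map_linear)+)
next
  case (17 t)
  show ?case
    by (rule factors_unique[OF _ _ AVC_inj 17, where f' = "inV \<ast> inV \<ast> inV"];
        (rule factors_rules R1 R2 R3 E_factors modules in_linear prod_map_linear)+)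
qed

text \<open>
  The product of \<open>a v c\<close> and \<open>a' v' c'\<close> in \<open>W\<close> is rearranged by
  \<open>a v (c a') v' c' = a (v p) (q v') c' = (a p') (w w') (q' c')\<close>, where \<open>R\<^sub>3\<close>, \<open>R\<^sub>1\<close> and \<open>R\<^sub>2\<close> rewrite
  the bracketed products. The nested lifts in the definition of the crossed product carry out
  these steps; evaluated from the inside, each lift undoes one of them.
\<close>

lemma crossed_product_mult:
  assumes R1: "factors k W (V \<boxtimes> A) (A \<boxtimes> V) R1 (inA \<ast> inV) (inV \<ast> inA)"
    and R2: "factors k W (C \<boxtimes> V) (V \<boxtimes> C) R2 (inV \<ast> inC) (inC \<ast> inV)"
    and R3: "factors k W (C \<boxtimes> A) (A \<boxtimes> C) R3 (inA \<ast> inC) (inC \<ast> inA)"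
    and s: "s \<in> carrier W" and t: "t \<in> carrier W"
  shows "s \<otimes>\<^bsub>two_sided_crossed_product k A V v1 C R1 R2 R3 (inV \<ast> inV)\<^esub> t = s \<otimes>\<^bsub>W\<^esub> t"
proof -
  let ?T = "A \<boxtimes> V \<boxtimes> C"
  note lift = tensor_lift_eqI[OF _ _ T_module] and lift3 = tensor_lift3_eqI[OF A_module V C_module T_module]
  note closed = in_closed pure_tensor_closed A_module V C_module
  have E: "tensor_lift3 k ?T (\<lambda>e u d. tensor3 (a \<otimes>\<^bsub>A\<^esub> p' \<otimes>\<^bsub>A\<^esub> e) u (d \<otimes>\<^bsub>C\<^esub> q' \<otimes>\<^bsub>C\<^esub> c'))
      ((inV \<ast> inV) (w \<diamondop>[V, V] w')) =
      (inA a \<otimes>\<^bsub>W\<^esub> inA p' \<otimes>\<^bsub>W\<^esub> inV w) \<otimes>\<^bsub>W\<^esub> (inV w' \<otimes>\<^bsub>W\<^esub> inC q') \<otimes>\<^bsub>W\<^esub> inC c'"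
    if "a \<in> carrier A" "p' \<in> carrier A" "w \<in> carrier V" "w' \<in> carrier V" "q' \<in> carrier C" "c' \<in> carrier C"
    for a p' w w' q' c'
  proof -
    let ?g = "(\<lambda>x. (inA a \<otimes>\<^bsub>W\<^esub> inA p') \<otimes>\<^bsub>W\<^esub> x) \<circ> (\<lambda>x. x \<otimes>\<^bsub>W\<^esub> (inC q' \<otimes>\<^bsub>W\<^esub> inC c'))"
    have g: "?g \<in> linear_maps k ?T ?T"
      unfolding linear_maps_to_W[symmetric] linear_maps_from_W[symmetric]
      using that by (intro linear_maps_comp[OF left_mult_linear right_mult_linear] W.A.m_closed in_closed)
    have E_closed: "(inV \<ast> inV) (w \<diamondop>[V, V] w') \<in> carrier ?T"
      using that by (simp add: W_simps(1)[symmetric] VV_pure in_closed)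
    show ?thesis
      using that
      by (subst lift3[OF g _ E_closed])
        (simp_all add: VV_pure tensor3_eq inA_mult inC_mult in_closed W.A.m_assoc)
  qed
  have R2_step: "tensor_lift k ?T (\<lambda>w' q'. tensor_lift3 k ?T
        (\<lambda>e u d. tensor3 (a \<otimes>\<^bsub>A\<^esub> p' \<otimes>\<^bsub>A\<^esub> e) u (d \<otimes>\<^bsub>C\<^esub> q' \<otimes>\<^bsub>C\<^esub> c'))
        ((inV \<ast> inV) (w \<diamondop>[V, V] w'))) (R2 (q \<diamondop>[C, V] v')) =
      inA a \<otimes>\<^bsub>W\<^esub> (inA p' \<otimes>\<^bsub>W\<^esub> inV w) \<otimes>\<^bsub>W\<^esub> (inC q \<otimes>\<^bsub>W\<^esub> inV v' \<otimes>\<^bsub>W\<^esub> inC c')"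
    if "a \<in> carrier A" "p' \<in> carrier A" "w \<in> carrier V" "q \<in> carrier C" "v' \<in> carrier V" "c' \<in> carrier C"
    for a p' w q v' c'
  proof -
    let ?g = "((\<lambda>x. x \<otimes>\<^bsub>W\<^esub> inC c') \<circ> (\<lambda>x. (inA a \<otimes>\<^bsub>W\<^esub> inA p' \<otimes>\<^bsub>W\<^esub> inV w) \<otimes>\<^bsub>W\<^esub> x)) \<circ> (inV \<ast> inC)"
    have g: "?g \<in> linear_maps k (V \<boxtimes> C) ?T"
      unfolding linear_maps_to_W[symmetric]
      using that by (intro linear_maps_comp[OF linear_maps_comp[OF right_mult_linear left_mult_linear]]
          VC_linear W.A.m_closed in_closed)
    have R2_closed: "R2 (q \<diamondop>[C, V] v') \<in> carrier (V \<boxtimes> C)"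
      using that by (intro linear_mapsD(1)[OF factorsD(3)[OF R2]] closed)
    show ?thesis
      using that factorsD(6)[OF R2, of "q \<diamondop>[C, V] v'"]
      by (subst lift[OF V C_module g _ R2_closed])
        (simp_all add: E VC_pure CV_pure closed W.A.m_assoc)
  qed
  have R1_step: "tensor_lift k ?T (\<lambda>p' w. tensor_lift k ?T (\<lambda>w' q'. tensor_lift3 k ?T
        (\<lambda>e u d. tensor3 (a \<otimes>\<^bsub>A\<^esub> p' \<otimes>\<^bsub>A\<^esub> e) u (d \<otimes>\<^bsub>C\<^esub> q' \<otimes>\<^bsub>C\<^esub> c'))
        ((inV \<ast> inV) (w \<diamondop>[V, V] w'))) (R2 (q \<diamondop>[C, V] v'))) (R1 (v \<diamondop>[V, A] p)) =
      inA a \<otimes>\<^bsub>W\<^esub> inV v \<otimes>\<^bsub>W\<^esub> (inA p \<otimes>\<^bsub>W\<^esub> inC q) \<otimes>\<^bsub>W\<^esub> (inV v' \<otimes>\<^bsub>W\<^esub> inC c')"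
    if "a \<in> carrier A" "v \<in> carrier V" "p \<in> carrier A" "q \<in> carrier C" "v' \<in> carrier V" "c' \<in> carrier C"
    for a v p q v' c'
  proof -
    let ?g = "((\<lambda>x. x \<otimes>\<^bsub>W\<^esub> (inC q \<otimes>\<^bsub>W\<^esub> inV v' \<otimes>\<^bsub>W\<^esub> inC c')) \<circ> (\<lambda>x. inA a \<otimes>\<^bsub>W\<^esub> x)) \<circ> (inA \<ast> inV)"
    have g: "?g \<in> linear_maps k (A \<boxtimes> V) ?T"
      unfolding linear_maps_to_W[symmetric]
      using that by (intro linear_maps_comp[OF linear_maps_comp[OF right_mult_linear left_mult_linear]]
          AV_linear W.A.m_closed in_closed)
    have R1_closed: "R1 (v \<diamondop>[V, A] p) \<in> carrier (A \<boxtimes> V)"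
      using that by (intro linear_mapsD(1)[OF factorsD(3)[OF R1]] closed)
    show ?thesis
      using that factorsD(6)[OF R1, of "v \<diamondop>[V, A] p"]
      by (subst lift[OF A_module V g _ R1_closed])
        (simp_all add: R2_step AV_pure VA_pure closed W.A.m_assoc)
  qed
  have R3_step: "tensor_lift k ?T (\<lambda>p q. tensor_lift k ?T (\<lambda>p' w. tensor_lift k ?T
        (\<lambda>w' q'. tensor_lift3 k ?T
        (\<lambda>e u d. tensor3 (a \<otimes>\<^bsub>A\<^esub> p' \<otimes>\<^bsub>A\<^esub> e) u (d \<otimes>\<^bsub>C\<^esub> q' \<otimes>\<^bsub>C\<^esub> c'))
        ((inV \<ast> inV) (w \<diamondop>[V, V] w'))) (R2 (q \<diamondop>[C, V] v'))) (R1 (v \<diamondop>[V, A] p)))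
        (R3 (c \<diamondop>[C, A] a')) =
      tensor3 a v c \<otimes>\<^bsub>W\<^esub> tensor3 a' v' c'"
    if "a \<in> carrier A" "v \<in> carrier V" "c \<in> carrier C" "a' \<in> carrier A" "v' \<in> carrier V" "c' \<in> carrier C"
    for a v c a' v' c'
  proof -
    let ?g = "((\<lambda>x. x \<otimes>\<^bsub>W\<^esub> (inV v' \<otimes>\<^bsub>W\<^esub> inC c')) \<circ> (\<lambda>x. (inA a \<otimes>\<^bsub>W\<^esub> inV v) \<otimes>\<^bsub>W\<^esub> x)) \<circ> (inA \<ast> inC)"
    have g: "?g \<in> linear_maps k (A \<boxtimes> C) ?T"
      unfolding linear_maps_to_W[symmetric]
      using that by (intro linear_maps_comp[OF linear_maps_comp[OF right_mult_linear left_mult_linear]]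
          AC_linear W.A.m_closed in_closed)
    have R3_closed: "R3 (c \<diamondop>[C, A] a') \<in> carrier (A \<boxtimes> C)"
      using that by (intro linear_mapsD(1)[OF factorsD(3)[OF R3]] closed)
    show ?thesis
      using that factorsD(6)[OF R3, of "c \<diamondop>[C, A] a'"]
      by (subst lift[OF A_module C_module g _ R3_closed])
        (simp_all add: R1_step AC_pure CA_pure closed tensor3_eq W.A.m_assoc)
  qed
  note T_carrier = s[unfolded W_simps(1)] t[unfolded W_simps(1)]
  have right: "tensor_lift3 k ?T (\<lambda>a' v' c'. tensor_lift k ?T (\<lambda>p q. tensor_lift k ?T (\<lambda>p' w.
        tensor_lift k ?T (\<lambda>w' q'. tensor_lift3 k ?T
        (\<lambda>e u d. tensor3 (a \<otimes>\<^bsub>A\<^esub> p' \<otimes>\<^bsub>A\<^esub> e) u (d \<otimes>\<^bsub>C\<^esub> q' \<otimes>\<^bsub>C\<^esub> c'))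
        ((inV \<ast> inV) (w \<diamondop>[V, V] w'))) (R2 (q \<diamondop>[C, V] v'))) (R1 (v \<diamondop>[V, A] p)))
        (R3 (c \<diamondop>[C, A] a'))) t = tensor3 a v c \<otimes>\<^bsub>W\<^esub> t"
    if "a \<in> carrier A" "v \<in> carrier V" "c \<in> carrier C" for a v c
  proof (rule lift3[OF _ _ T_carrier(2)])
    show "(\<lambda>x. tensor3 a v c \<otimes>\<^bsub>W\<^esub> x) \<in> linear_maps k ?T ?T"
      unfolding linear_maps_to_W[symmetric] linear_maps_from_W[symmetric]
      using that by (intro left_mult_linear) (simp add: tensor3_eq in_closed)
  qed (simp add: R3_step that)
  have left: "tensor_lift3 k ?T b s = s \<otimes>\<^bsub>W\<^esub> t"
    if "\<And>a v c. a \<in> carrier A \<Longrightarrow> v \<in> carrier V \<Longrightarrow> c \<in> carrier C \<Longrightarrow> b a v c = tensor3 a v c \<otimes>\<^bsub>W\<^esub> t"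
    for b
  proof (rule lift3[OF _ _ T_carrier(1)])
    show "(\<lambda>x. x \<otimes>\<^bsub>W\<^esub> t) \<in> linear_maps k ?T ?T"
      unfolding linear_maps_to_W[symmetric] linear_maps_from_W[symmetric]
      by (rule right_mult_linear[OF t])
  qed (rule that)
  show ?thesis
    unfolding two_sided_crossed_product_def Let_def
    by (simp add: left right)
qed

end

theorem theorem2p2:
  fixes k :: "('k, 'r) ring_scheme"
    and A :: "('k, 'a, 'x) module_scheme"
    and V :: "('k, 'v, 'y) module_scheme"
    and C :: "('k, 'c, 'z) module_scheme"
    and v1 :: 'v
    and prd :: "('a \<times> ('v \<times> 'c \<Rightarrow> 'k) set \<Rightarrow> 'k) set \<Rightarrow>
      ('a \<times> ('v \<times> 'c \<Rightarrow> 'k) set \<Rightarrow> 'k) set \<Rightarrow> ('a \<times> ('v \<times> 'c \<Rightarrow> 'k) set \<Rightarrow> 'k) set"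
    and W :: "('k, ('a \<times> ('v \<times> 'c \<Rightarrow> 'k) set \<Rightarrow> 'k) set) module"
  assumes k: "field k"
    and A: "unital_algebra k A"
    and C: "unital_algebra k C"
    and V: "module k V"
    and v1: "v1 \<in> carrier V" "v1 \<noteq> \<zero>\<^bsub>V\<^esub>"
    and W_eq: "W = (tensor_product k A (tensor_product k V C))
      \<lparr>mult := prd, one := pure_tensor3 k A V C \<one>\<^bsub>A\<^esub> v1 \<one>\<^bsub>C\<^esub>\<rparr>"
    and W: "unital_algebra k W"
    and A_map: "(\<lambda>a. pure_tensor3 k A V C a v1 \<one>\<^bsub>C\<^esub>) \<in> algebra_maps k A W"
    and C_map: "(\<lambda>c. pure_tensor3 k A V C \<one>\<^bsub>A\<^esub> v1 c) \<in> algebra_maps k C W"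
    and VA: "\<And>v a'. \<lbrakk>v \<in> carrier V; a' \<in> carrier A\<rbrakk> \<Longrightarrow>
      \<exists>(n::nat) a\<^sub>i v\<^sub>i. (\<forall>i<n. a\<^sub>i i \<in> carrier A \<and> v\<^sub>i i \<in> carrier V) \<and>
        pure_tensor3 k A V C \<one>\<^bsub>A\<^esub> v \<one>\<^bsub>C\<^esub> \<otimes>\<^bsub>W\<^esub> pure_tensor3 k A V C a' v1 \<one>\<^bsub>C\<^esub> =
        (\<Oplus>\<^bsub>W\<^esub>i\<in>{..<n}. pure_tensor3 k A V C (a\<^sub>i i) (v\<^sub>i i) \<one>\<^bsub>C\<^esub>)"
    and CV: "\<And>c v'. \<lbrakk>c \<in> carrier C; v' \<in> carrier V\<rbrakk> \<Longrightarrow>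
      \<exists>(n::nat) v\<^sub>j c\<^sub>j. (\<forall>j<n. v\<^sub>j j \<in> carrier V \<and> c\<^sub>j j \<in> carrier C) \<and>
        pure_tensor3 k A V C \<one>\<^bsub>A\<^esub> v1 c \<otimes>\<^bsub>W\<^esub> pure_tensor3 k A V C \<one>\<^bsub>A\<^esub> v' \<one>\<^bsub>C\<^esub> =
        (\<Oplus>\<^bsub>W\<^esub>j\<in>{..<n}. pure_tensor3 k A V C \<one>\<^bsub>A\<^esub> (v\<^sub>j j) (c\<^sub>j j))"
    and CA: "\<And>c a'. \<lbrakk>c \<in> carrier C; a' \<in> carrier A\<rbrakk> \<Longrightarrow>
      \<exists>(n::nat) a\<^sub>l c\<^sub>l. (\<forall>l<n. a\<^sub>l l \<in> carrier A \<and> c\<^sub>l l \<in> carrier C) \<and>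
        pure_tensor3 k A V C \<one>\<^bsub>A\<^esub> v1 c \<otimes>\<^bsub>W\<^esub> pure_tensor3 k A V C a' v1 \<one>\<^bsub>C\<^esub> =
        (\<Oplus>\<^bsub>W\<^esub>l\<in>{..<n}. pure_tensor3 k A V C (a\<^sub>l l) v1 (c\<^sub>l l))"
    and AVC: "\<And>a v c. \<lbrakk>a \<in> carrier A; v \<in> carrier V; c \<in> carrier C\<rbrakk> \<Longrightarrow>
      pure_tensor3 k A V C a v c =
        pure_tensor3 k A V C a v1 \<one>\<^bsub>C\<^esub> \<otimes>\<^bsub>W\<^esub> pure_tensor3 k A V C \<one>\<^bsub>A\<^esub> v \<one>\<^bsub>C\<^esub>
          \<otimes>\<^bsub>W\<^esub> pure_tensor3 k A V C \<one>\<^bsub>A\<^esub> v1 c"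
  shows "\<exists>R1 R2 R3 E. two_sided_crossed_product_data k A V v1 C R1 R2 R3 E \<and>
    \<one>\<^bsub>W\<^esub> = \<one>\<^bsub>two_sided_crossed_product k A V v1 C R1 R2 R3 E\<^esub> \<and>
    (\<forall>s\<in>carrier W. \<forall>t\<in>carrier W.
      s \<otimes>\<^bsub>W\<^esub> t = s \<otimes>\<^bsub>two_sided_crossed_product k A V v1 C R1 R2 R3 E\<^esub> t)"
proof -
  interpret factorized_algebra k A V C v1 prd W
    by (rule factorized_algebra.intro) (fact assms)+
  obtain R1 where R1: "factors k W (V \<boxtimes> A) (A \<boxtimes> V) R1 (inA \<ast> inV) (inV \<ast> inA)"
    "\<And>a. a \<in> carrier A \<Longrightarrow> R1 (v1 \<diamondop>[V, A] a) = a \<diamondop>[A, V] v1"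
    "\<And>v. v \<in> carrier V \<Longrightarrow> R1 (v \<diamondop>[V, A] \<one>\<^bsub>A\<^esub>) = \<one>\<^bsub>A\<^esub> \<diamondop>[A, V] v"
    "\<And>t. t \<in> carrier (V \<boxtimes> A \<boxtimes> A) \<Longrightarrow>
      (R1 \<circ> (id \<star>[V, A] \<mu>[A])) t =
      ((\<mu>[A] \<star>[A, V] id) \<circ> \<beta>[A, A, V] \<circ> (id \<star>[A, A \<boxtimes> V] R1) \<circ> \<alpha>[A, V, A]
        \<circ> (R1 \<star>[A \<boxtimes> V, A] id) \<circ> \<beta>[V, A, A]) t"
    by (rule R1_exists) (rule that; blast)
  obtain R2 where R2: "factors k W (C \<boxtimes> V) (V \<boxtimes> C) R2 (inV \<ast> inC) (inC \<ast> inV)"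
    "\<And>c. c \<in> carrier C \<Longrightarrow> R2 (c \<diamondop>[C, V] v1) = v1 \<diamondop>[V, C] c"
    "\<And>v. v \<in> carrier V \<Longrightarrow> R2 (\<one>\<^bsub>C\<^esub> \<diamondop>[C, V] v) = v \<diamondop>[V, C] \<one>\<^bsub>C\<^esub>"
    "\<And>t. t \<in> carrier (C \<boxtimes> C \<boxtimes> V) \<Longrightarrow>
      (R2 \<circ> (\<mu>[C] \<star>[C, V] id) \<circ> \<beta>[C, C, V]) t =
      ((id \<star>[V, C] \<mu>[C]) \<circ> \<alpha>[V, C, C] \<circ> (R2 \<star>[V \<boxtimes> C, C] id) \<circ> \<beta>[C, V, C]
        \<circ> (id \<star>[C, V \<boxtimes> C] R2)) t"
    by (rule R2_exists) (rule that; blast)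
  obtain R3 where R3: "factors k W (C \<boxtimes> A) (A \<boxtimes> C) R3 (inA \<ast> inC) (inC \<ast> inA)"
    "twisting_map k A C R3"
    by (rule R3_exists)
  have "two_sided_crossed_product_data k A V v1 C R1 R2 R3 (inV \<ast> inV)"
    using R1 R2 R3 by (intro crossed_product_data) assumption+
  moreover have "\<one>\<^bsub>W\<^esub> = \<one>\<^bsub>two_sided_crossed_product k A V v1 C R1 R2 R3 (inV \<ast> inV)\<^esub>"
    by (simp add: W_simps two_sided_crossed_product_def Let_def)
  moreover have "s \<otimes>\<^bsub>W\<^esub> t = s \<otimes>\<^bsub>two_sided_crossed_product k A V v1 C R1 R2 R3 (inV \<ast> inV)\<^esub> t"
    if "s \<in> carrier W" "t \<in> carrier W" for s t
    using crossed_product_mult[OF R1(1) R2(1) R3(1) that] by simp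
  ultimately show ?thesis
    by blast
qed

end
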